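(* For every complete ultrametric field $\mathbb{K}$, locally convex topological $\mathbb{K}$-vector space $E$, $n_1,\ldots,n_\ell\in\mathbb{N}$, $\alpha\in(\mathbb{N}_0\cup\{\infty\})^\ell$ and locally closed, locally cartesian subset $U\subseteq\mathbb{K}^{n_1}\times\cdots\times\mathbb{K}^{n_\ell}=\mathbb{K}^n$ with $n:=n_1+\cdots+n_\ell$, the space $\mathrm{Pol}(U,E)$ of $E$-valued polynomial functions is dense in $C^\alpha(U,E)$.
   Context: An ultrametric field is a field $\mathbb{K}$ with an absolute value satisfying the ultrametric inequality and defining a non-discrete topology; complete means complete for the metric $|x-y|$. All topological vector spaces are Hausdorff. A topological $\mathbb{K}$-vector space is locally convex if its open $\mathbb{O}$-submodules form a basis of $0$-neighbourhoods, $\mathbb{O}=\{z\in\mathbb{K}:|z|\le1\}$. $\mathbb{N}_0=\{0,1,\ldots\}$. $\mathrm{Pol}(U,E)$ is the space of functions $p\colon U\to E$ of the form $p(x)=\sum_\beta x^\beta a_\beta$ with a finite family of $a_\beta\in E$, $\beta\in\mathbb{N}_0^n$, $x^\beta=x_1^{\beta_1}\cdots x_n^{\beta_n}$. A subset $Y$ of a topological space $X$ is locally closed if for each $x\in Y$ and each neighbourhood $W\subseteq Y$ of $x$ (in the induced topology) there is a neighbourhood $V\subseteq W$ of $x$ in $Y$ which is closed in $X$. A subset $U\subseteq\mathbb{K}^n$ is cartesian if $U=U_1\times\cdots\times U_n$ with subsets $U_i\subseteq\mathbb{K}$ without isolated points; it is locally cartesian if every point of $U$ has a relatively open neighbourhood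 in $U$ which is cartesian. Coordinatewise $C^\eta$-maps. Let $U=U_1\times\cdots\times U_n\subseteq\mathbb{K}^n$ be cartesian, $f\colon U\to E$ and $\gamma\in\mathbb{N}_0^n$. Put $U^{<\gamma>}:=U_1^{1+\gamma_1}\times\cdots\times U_n^{1+\gamma_n}$, with elements $x=(x^{(1)},\ldots,x^{(n)})$, $x^{(i)}=(x^{(i)}_0,\ldots,x^{(i)}_{\gamma_i})$, and let $U^{>\gamma<}$ be the (dense, open) set of $x\in U^{<\gamma>}$ with $x^{(i)}_j\ne x^{(i)}_k$ for all $i$ and $0\le j<k\le\gamma_i$. Define \[ f^{>\gamma<}(x)=\sum_{j_1=0}^{\gamma_1}\cdots\sum_{j_n=0}^{\gamma_n}\Big(\prod_{i=1}^n\ \prod_{k_i\in\{0,\ldots,\gamma_i\}\setminus\{j_i\}}\frac{1}{x^{(i)}_{j_i}-x^{(i)}_{k_i}}\Big)f(x^{(1)}_{j_1},\ldots,x^{(n)}_{j_n}) \] for $x\in U^{>\gamma<}$ (empty products are $1$). For $\eta\in\mathbb{N}_0^n$, $f$ is $C^\eta$ if for every $\gamma\in\mathbb{N}_0^n$ with $\gamma\le\eta$ (componentwise) $f^{>\gamma<}$ has a (unique) continuous extension $f^{<\gamma>}\colon U^{<\gamma>}\to E$. If $U$ is only locally cartesian, $f$ is $C^\eta$ if $f|_V$ is $C^\eta$ for each cartesian relatively open $V\subseteq U$. $C^\eta(U,E)$ carries the initial topology with respect to the maps $f\mapsto(f|_V)^{<\gamma>}\in C(V^{<\gamma>},E)$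 (compact-open topology on the target) for all $\gamma\le\eta$ in $\mathbb{N}_0^n$ and cartesian relatively open $V\subseteq U$. For $\alpha\in(\mathbb{N}_0\cup\{\infty\})^\ell$, let $N_\alpha$ be the set of all $\eta=(\eta_1,\ldots,\eta_\ell)\in\mathbb{N}_0^{n_1}\times\cdots\times\mathbb{N}_0^{n_\ell}=\mathbb{N}_0^n$ with $|\eta_j|\le\alpha_j$ for all $j$, where $|\eta_j|$ is the sum of the components of $\eta_j$. A map $f\colon U\to E$ is $C^\alpha$ if it is $C^\eta$ for all $\eta\in N_\alpha$; $C^\alpha(U,E)=\bigcap_{\eta\in N_\alpha}C^\eta(U,E)$ carries the initial topology with respect to the inclusion maps $C^\alpha(U,E)\to C^\eta(U,E)$, $\eta\in N_\alpha$. *)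

theory Defs
  imports "HOL-Analysis.Analysis"
begin

section \<open>Ultrametric fields and locally convex spaces\<close>

text \<open>The library's \<open>norm\<close> is restricted to real normed vector spaces, so the absolute value is a
  class parameter of its own. That it is nonnegative and vanishes only at \<open>0\<close> follows from
  \<open>dist_abs_value\<close> and the metric axioms. Completeness is the sort \<open>complete_space\<close>.\<close>

class ultrametric_field = field + metric_space +
  fixes abs_value :: "'a \<Rightarrow> real"
  assumes dist_abs_value: "dist x y = abs_value (x - y)"
    and abs_value_mult: "abs_value (x * y) = abs_value x * abs_value y"
    and abs_value_ultrametric: "abs_value (x + y) \<le> max (abs_value x) (abs_value y)"
    and not_discrete: "\<not> discrete UNIV"

definition unit_ball_submodule ::
  "('k::ultrametric_field \<Rightarrow> 'e::ab_group_add \<Rightarrow> 'e) \<Rightarrow> 'e set \<Rightarrow> bool" where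
  "unit_ball_submodule smul W \<longleftrightarrow>
     0 \<in> W \<and> (\<forall>x\<in>W. \<forall>y\<in>W. x + y \<in> W) \<and> (\<forall>c. abs_value c \<le> 1 \<longrightarrow> (\<forall>x\<in>W. smul c x \<in> W))"

locale ultrametric_lcs = vector_space smul
  for smul :: "'k::ultrametric_field \<Rightarrow> 'e::{topological_ab_group_add, t2_space} \<Rightarrow> 'e" +
  assumes continuous_smul: "continuous_on UNIV (\<lambda>(c, x). smul c x)"
    and locally_convex:
      "\<lbrakk>open S; 0 \<in> S\<rbrakk> \<Longrightarrow> \<exists>W. open W \<and> W \<subseteq> S \<and> unit_ball_submodule smul W"

section \<open>Topologies on function spaces\<close>

definition initial_topology ::
  "'a set \<Rightarrow> 'j set \<Rightarrow> ('j \<Rightarrow> 'a \<Rightarrow> 'b) \<Rightarrow> ('j \<Rightarrow> 'b topology) \<Rightarrow> 'a topology" where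
  "initial_topology S J h T =
     topology_generated_by (insert S {S \<inter> h j -` W | j W. j \<in> J \<and> openin (T j) W})"

text \<open>Functions on a set are represented by their extensional representatives, so that equality
  of functions is equality on the domain.\<close>

definition continuous_functions :: "'a topology \<Rightarrow> 'b topology \<Rightarrow> ('a \<Rightarrow> 'b) set" where
  "continuous_functions X Y = {f \<in> extensional (topspace X). continuous_map X Y f}"

definition compact_open_topology :: "'a topology \<Rightarrow> 'b topology \<Rightarrow> ('a \<Rightarrow> 'b) topology" where
  "compact_open_topology X Y = topology_generated_by
     {{f \<in> continuous_functions X Y. f ` K \<subseteq> W} | K W. compactin X K \<and> openin Y W}"

section \<open>Subsets of finite powers of the field\<close>

text \<open>For a finite index set \<open>I\<close>, the space of \<open>I\<close>-tuples over \<open>'k\<close> is \<open>I \<rightarrow>\<^sub>E UNIV\<close> with the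
  product topology; multi-indices are elements of \<open>I \<rightarrow>\<^sub>E (UNIV :: nat set)\<close>.\<close>

definition power_space :: "'i set \<Rightarrow> ('i \<Rightarrow> 'k::topological_space) topology" where
  "power_space I = product_topology (\<lambda>_. euclidean) I"

definition locally_closed :: "'a topology \<Rightarrow> 'a set \<Rightarrow> bool" where
  "locally_closed X Y \<longleftrightarrow>
     Y \<subseteq> topspace X \<and> neighbourhood_base_of (closedin X) (subtopology X Y)"

definition cartesian_factors :: "'i set \<Rightarrow> ('i \<Rightarrow> 'k::topological_space set) \<Rightarrow> bool" where
  "cartesian_factors I V \<longleftrightarrow> (\<forall>i\<in>I. \<forall>x. \<not> x isolated_in V i)"

definition cartesian :: "'i set \<Rightarrow> ('i \<Rightarrow> 'k::topological_space) set \<Rightarrow> bool" where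
  "cartesian I U \<longleftrightarrow> (\<exists>V. cartesian_factors I V \<and> U = Pi\<^sub>E I V)"

definition locally_cartesian :: "'i set \<Rightarrow> ('i \<Rightarrow> 'k::topological_space) set \<Rightarrow> bool" where
  "locally_cartesian I U \<longleftrightarrow>
     U \<subseteq> topspace (power_space I) \<and>
     (\<forall>x\<in>U. \<exists>V. openin (subtopology (power_space I) U) V \<and> x \<in> V \<and> cartesian I V)"

text \<open>Cartesian relatively open subsets of \<open>U\<close>, given by their families of factors. The factors
  are determined by the product unless it is empty; in that case all spaces built from it below
  are empty as well, so the choice of factors is irrelevant.\<close>

definition cartesian_charts ::
  "'i set \<Rightarrow> ('i \<Rightarrow> 'k::topological_space) set \<Rightarrow> ('i \<Rightarrow> 'k set) set" where
  "cartesian_charts I U =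
     {V. cartesian_factors I V \<and> openin (subtopology (power_space I) U) (Pi\<^sub>E I V)}"

section \<open>Coordinatewise differentiability\<close>

text \<open>The space \<open>\<Prod>\<^sub>i V\<^sub>i\<^bsup>1+\<gamma>\<^sub>i\<^esup>\<close>; the entry \<open>x (i, j)\<close> is the \<open>j\<close>-th component of the \<open>i\<close>-th block.\<close>

definition multi_space ::
  "'i set \<Rightarrow> ('i \<Rightarrow> 'k::topological_space set) \<Rightarrow> ('i \<Rightarrow> nat) \<Rightarrow> ('i \<times> nat \<Rightarrow> 'k) topology" where
  "multi_space I V \<gamma> =
     product_topology (\<lambda>(i, j). subtopology euclidean (V i)) (SIGMA i:I. {..\<gamma> i})"

definition distinct_points ::
  "'i set \<Rightarrow> ('i \<Rightarrow> 'k::topological_space set) \<Rightarrow> ('i \<Rightarrow> nat) \<Rightarrow> ('i \<times> nat \<Rightarrow> 'k) set" where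
  "distinct_points I V \<gamma> =
     {x \<in> topspace (multi_space I V \<gamma>). \<forall>i\<in>I. \<forall>j k. j < k \<and> k \<le> \<gamma> i \<longrightarrow> x (i, j) \<noteq> x (i, k)}"

definition divided_difference ::
  "('k::ultrametric_field \<Rightarrow> 'e::ab_group_add \<Rightarrow> 'e) \<Rightarrow> 'i set \<Rightarrow> ('i \<Rightarrow> nat) \<Rightarrow>
   (('i \<Rightarrow> 'k) \<Rightarrow> 'e) \<Rightarrow> ('i \<times> nat \<Rightarrow> 'k) \<Rightarrow> 'e" where
  "divided_difference smul I \<gamma> f x =
     (\<Sum>j\<in>(\<Pi>\<^sub>E i\<in>I. {..\<gamma> i}).
        smul (\<Prod>i\<in>I. \<Prod>k\<in>{..\<gamma> i} - {j i}. 1 / (x (i, j i) - x (i, k)))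
              (f (\<lambda>i\<in>I. x (i, j i))))"

definition extends_divided_difference ::
  "('k::ultrametric_field \<Rightarrow> 'e::{ab_group_add, topological_space} \<Rightarrow> 'e) \<Rightarrow> 'i set \<Rightarrow>
   ('i \<Rightarrow> 'k set) \<Rightarrow> ('i \<Rightarrow> nat) \<Rightarrow> (('i \<Rightarrow> 'k) \<Rightarrow> 'e) \<Rightarrow> (('i \<times> nat \<Rightarrow> 'k) \<Rightarrow> 'e) \<Rightarrow> bool" where
  "extends_divided_difference smul I V \<gamma> f g \<longleftrightarrow>
     g \<in> continuous_functions (multi_space I V \<gamma>) euclidean \<and>
     (\<forall>x\<in>distinct_points I V \<gamma>. g x = divided_difference smul I \<gamma> f x)"

text \<open>If \<open>V\<close> consists of sets without isolated points, then the points with distinct entries are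
  dense, so for Hausdorff \<open>'e\<close> there is at most one extension.\<close>

definition extended_divided_difference ::
  "('k::ultrametric_field \<Rightarrow> 'e::{ab_group_add, topological_space} \<Rightarrow> 'e) \<Rightarrow> 'i set \<Rightarrow>
   ('i \<Rightarrow> 'k set) \<Rightarrow> ('i \<Rightarrow> nat) \<Rightarrow> (('i \<Rightarrow> 'k) \<Rightarrow> 'e) \<Rightarrow> ('i \<times> nat \<Rightarrow> 'k) \<Rightarrow> 'e" where
  "extended_divided_difference smul I V \<gamma> f =
     (THE g. extends_divided_difference smul I V \<gamma> f g)"

text \<open>Since \<open>divided_difference\<close> at points of \<open>multi_space I V \<gamma>\<close> only evaluates \<open>f\<close> on \<open>Pi\<^sub>E I V\<close>,
  the restriction of \<open>f\<close> to the chart \<open>Pi\<^sub>E I V\<close> need not be written out below.\<close>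

definition C_eta ::
  "('k::ultrametric_field \<Rightarrow> 'e::{ab_group_add, topological_space} \<Rightarrow> 'e) \<Rightarrow> 'i set \<Rightarrow>
   ('i \<Rightarrow> 'k) set \<Rightarrow> ('i \<Rightarrow> nat) \<Rightarrow> (('i \<Rightarrow> 'k) \<Rightarrow> 'e) set" where
  "C_eta smul I U \<eta> =
     {f \<in> extensional U. \<forall>V\<in>cartesian_charts I U. \<forall>\<gamma>\<in>(\<Pi>\<^sub>E i\<in>I. {..\<eta> i}).
        \<exists>g. extends_divided_difference smul I V \<gamma> f g}"

definition C_eta_topology ::
  "('k::ultrametric_field \<Rightarrow> 'e::{ab_group_add, topological_space} \<Rightarrow> 'e) \<Rightarrow> 'i set \<Rightarrow>
   ('i \<Rightarrow> 'k) set \<Rightarrow> ('i \<Rightarrow> nat) \<Rightarrow> (('i \<Rightarrow> 'k) \<Rightarrow> 'e) topology" where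
  "C_eta_topology smul I U \<eta> =
     initial_topology (C_eta smul I U \<eta>) (cartesian_charts I U \<times> (\<Pi>\<^sub>E i\<in>I. {..\<eta> i}))
       (\<lambda>(V, \<gamma>). extended_divided_difference smul I V \<gamma>)
       (\<lambda>(V, \<gamma>). compact_open_topology (multi_space I V \<gamma>) euclidean)"

section \<open>Maps of class \<open>C\<^sup>\<alpha>\<close>\<close>

text \<open>The coordinates of \<open>K\<^bsup>n\<^sub>1\<^esup> \<times> \<dots> \<times> K\<^bsup>n\<^sub>l\<^esup>\<close> are indexed by pairs \<open>(j, i)\<close>: the \<open>i\<close>-th coordinate in
  the \<open>j\<close>-th factor.\<close>

definition block_indices :: "nat \<Rightarrow> (nat \<Rightarrow> nat) \<Rightarrow> (nat \<times> nat) set" where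
  "block_indices l n = (SIGMA j:{1..l}. {1..n j})"

definition multi_orders ::
  "nat \<Rightarrow> (nat \<Rightarrow> nat) \<Rightarrow> (nat \<Rightarrow> enat) \<Rightarrow> (nat \<times> nat \<Rightarrow> nat) set" where
  "multi_orders l n \<alpha> =
     {\<eta> \<in> block_indices l n \<rightarrow>\<^sub>E UNIV. \<forall>j\<in>{1..l}. enat (\<Sum>i\<in>{1..n j}. \<eta> (j, i)) \<le> \<alpha> j}"

definition C_alpha ::
  "('k::ultrametric_field \<Rightarrow> 'e::{ab_group_add, topological_space} \<Rightarrow> 'e) \<Rightarrow> nat \<Rightarrow>
   (nat \<Rightarrow> nat) \<Rightarrow> (nat \<times> nat \<Rightarrow> 'k) set \<Rightarrow> (nat \<Rightarrow> enat) \<Rightarrow> ((nat \<times> nat \<Rightarrow> 'k) \<Rightarrow> 'e) set" where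
  "C_alpha smul l n U \<alpha> =
     (\<Inter>\<eta>\<in>multi_orders l n \<alpha>. C_eta smul (block_indices l n) U \<eta>)"

definition C_alpha_topology ::
  "('k::ultrametric_field \<Rightarrow> 'e::{ab_group_add, topological_space} \<Rightarrow> 'e) \<Rightarrow> nat \<Rightarrow>
   (nat \<Rightarrow> nat) \<Rightarrow> (nat \<times> nat \<Rightarrow> 'k) set \<Rightarrow> (nat \<Rightarrow> enat) \<Rightarrow>
   ((nat \<times> nat \<Rightarrow> 'k) \<Rightarrow> 'e) topology" where
  "C_alpha_topology smul l n U \<alpha> =
     initial_topology (C_alpha smul l n U \<alpha>) (multi_orders l n \<alpha>)
       (\<lambda>\<eta> f. f) (C_eta_topology smul (block_indices l n) U)"

definition Pol ::
  "('k::ultrametric_field \<Rightarrow> 'e::ab_group_add \<Rightarrow> 'e) \<Rightarrow> 'i set \<Rightarrow> ('i \<Rightarrow> 'k) set \<Rightarrow>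
   (('i \<Rightarrow> 'k) \<Rightarrow> 'e) set" where
  "Pol smul I U =
     {\<lambda>x\<in>U. \<Sum>\<beta>\<in>B. smul (\<Prod>i\<in>I. x i ^ \<beta> i) (a \<beta>) | B a. finite B \<and> B \<subseteq> (I \<rightarrow>\<^sub>E UNIV)}"

end

theory Submission
  imports Defs
begin

text \<open>
  Let \<open>f\<close> be of class \<open>C\<^sup>\<alpha>\<close>. On a small ball in one block of coordinates, interpolate \<open>f\<close> at distinct
  nodes by a Newton polynomial of total degree \<open>\<alpha>\<^sub>j\<close>, with the other blocks as parameters. For
  \<open>|\<gamma>| \<le> \<alpha>\<^sub>j\<close> the divided differences of order \<open>\<gamma>\<close> of the error on a ball of radius \<open>r\<close> are small
  compared with \<open>r\<close> to the power \<open>\<alpha>\<^sub>j - |\<gamma>|\<close>; this is exactly what is lost when the nodes of a divided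
  difference are spread over different balls, so cutting the error off to the ball is harmless.
  Treating the blocks successively, and working in small boxes on which the domain is cartesian, one
  approximates \<open>f\<close> near a compact set by sums of products of locally polynomial functions of one
  variable. Finally, the indicator function of a ball is approximated near a compact set by
  polynomials, together with all divided differences up to a given order, by the argument behind
  Kaplansky's ultrametric Stone--Weierstrass theorem. All estimates concern distinct nodes near the
  compact set; they pass to the extended divided differences because open submodules are closed.
\<close>

section \<open>Absolute values\<close>

text \<open>The radius of the balls in the Newton step is chosen after the target submodule Q,
  because it comes from the modulus of continuity of the differences for Q. Powers of the inverse
  radius lost on cutting off can therefore not be absorbed by shrinking Q; the interpolation error
  itself has to supply them, which forces interpolation of full total degree in a block and makes
  the count of powers tight. An infinite bound \<alpha> j causes no trouble: a neighbourhood in the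
  C^\<alpha>-topology involves finitely many orders, and their maximum replaces it. The second
  obstacle is the charts. A neighbourhood involves several of them, with unrelated factors, while
  the approximant has to be one function. On a small box around a point of the relevant compact set,
  however, a chart is just U intersected with the box, so the charts that enter the box coincide
  there. The radius of these boxes depends on the compact sets alone, so here the loss can be paid
  in advance by shrinking Q. Orders are counted by numbers of nodes: k nodes mean order k - 1, hence
  the summands \<open>card J\<close>.\<close>

lemma abs_value_nonneg [simp]: "0 \<le> abs_value (x::'k::ultrametric_field)"
  using zero_le_dist[of x 0] by (simp add: dist_abs_value)

lemma abs_value_eq_0 [simp]: "abs_value (x::'k::ultrametric_field) = 0 \<longleftrightarrow> x = 0"
  using dist_eq_0_iff[of x 0] by (simp add: dist_abs_value)

lemma abs_value_zero [simp]: "abs_value (0::'k::ultrametric_field) = 0"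
  by (simp only: abs_value_eq_0)

lemma abs_value_pos [simp]: "0 < abs_value (x::'k::ultrametric_field) \<longleftrightarrow> x \<noteq> 0"
  using abs_value_nonneg[of x] abs_value_eq_0[of x] by linarith

lemma abs_value_one [simp]: "abs_value (1::'k::ultrametric_field) = 1"
  using abs_value_mult[of "1::'k" 1] by simp

lemma abs_value_minus [simp]: "abs_value (- x) = abs_value (x::'k::ultrametric_field)"
  using dist_commute[of x 0] by (simp add: dist_abs_value)

lemma abs_value_minus_commute: "abs_value (x - y) = abs_value (y - x :: 'k::ultrametric_field)"
  by (metis abs_value_minus minus_diff_eq)

lemma abs_value_inverse: "abs_value (inverse x) = inverse (abs_value (x::'k::ultrametric_field))"
proof (cases "x = 0")
  case False
  then have "abs_value x * abs_value (inverse x) = 1" by (simp add: abs_value_mult [symmetric])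
  then show ?thesis by (metis inverse_unique)
qed simp

lemma abs_value_divide: "abs_value (x / y) = abs_value x / abs_value (y::'k::ultrametric_field)"
  by (simp add: divide_inverse abs_value_mult abs_value_inverse)

lemma abs_value_power: "abs_value (x ^ m) = abs_value (x::'k::ultrametric_field) ^ m"
  by (induction m) (auto simp: abs_value_mult)

lemma abs_value_prod: "abs_value (prod g A) = (\<Prod>i\<in>A. abs_value (g i :: 'k::ultrametric_field))"
  by (induction A rule: infinite_finite_induct) (auto simp: abs_value_mult)

lemma abs_value_diff_le: "abs_value (x - y) \<le> max (abs_value x) (abs_value (y::'k::ultrametric_field))"
  using abs_value_ultrametric[of x "- y"] by simp

lemma abs_value_numeral_le_1: "abs_value (numeral m :: 'k::ultrametric_field) \<le> 1"
proof -
  have "abs_value (of_nat q :: 'k) \<le> 1" for q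
  proof (induction q)
    case (Suc q)
    then show ?case using abs_value_ultrametric[of 1 "of_nat q :: 'k"] by simp
  qed simp
  from this[of "numeral m"] show ?thesis by simp
qed

lemma dist_ultrametric: "dist x z \<le> max (dist x y) (dist y (z::'k::ultrametric_field))"
  using abs_value_ultrametric[of "x - y" "y - z"] by (simp add: dist_abs_value)

lemma dist_ultrametric_le:
  "\<lbrakk>dist x y \<le> r; dist y z \<le> r\<rbrakk> \<Longrightarrow> dist x (z::'k::ultrametric_field) \<le> r"
  using dist_ultrametric[of x z y] by linarith

lemma dist_ultrametric_less:
  "\<lbrakk>dist x y < r; dist y z < r\<rbrakk> \<Longrightarrow> dist x (z::'k::ultrametric_field) < r"
  using dist_ultrametric[of x z y] by linarith

lemma ex_small_scalar:
  assumes "0 < r"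
  obtains \<pi> :: "'k::ultrametric_field" where "\<pi> \<noteq> 0" "abs_value \<pi> < r"
proof -
  obtain x :: 'k where x: "\<not> x isolated_in UNIV"
    using not_discrete by (auto simp: discrete_def)
  moreover have "open (ball x r)" "x \<in> ball x r" using assms by auto
  ultimately have "ball x r \<inter> UNIV \<noteq> {x}" "x \<in> ball x r"
    unfolding isolated_in_def by blast+
  then obtain y where "y \<in> ball x r" "y \<noteq> x" by blast
  then show ?thesis
    using that[of "y - x"] by (auto simp: dist_abs_value abs_value_minus_commute)
qed

lemma ex_large_scalar:
  obtains c :: "'k::ultrametric_field" where "c \<noteq> 0" "M < abs_value c"
proof -
  obtain \<pi> :: 'k where p: "\<pi> \<noteq> 0" "abs_value \<pi> < inverse (max 1 M)"
    by (rule ex_small_scalar[of "inverse (max 1 M)"]) auto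
  have "max 1 M < inverse (abs_value \<pi>)"
    using less_imp_inverse_less[OF p(2)] p(1) by simp
  then show ?thesis using that[of "inverse \<pi>"] p(1) by (simp add: abs_value_inverse)
qed

text \<open>Among the centres of a finite subcover take a maximal separated subset: every other
  centre is within \<open>r\<close> of it, and ultrametrically its ball is then contained in one of
  the remaining closed balls. Separation makes these balls disjoint, so that cut-offs to them form a
  partition of unity.\<close>

lemma compact_separated_cover:
  fixes \<Lambda> :: "'k::ultrametric_field set"
  assumes "compact \<Lambda>" "0 < r"
  obtains C where "finite C" "C \<subseteq> \<Lambda>" "\<Lambda> \<subseteq> (\<Union>c\<in>C. cball c r)"
    "\<And>c d. \<lbrakk>c \<in> C; d \<in> C; c \<noteq> d\<rbrakk> \<Longrightarrow> r < dist c d"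
proof -
  have "\<Lambda> \<subseteq> (\<Union>c\<in>\<Lambda>. ball c r)" using assms(2) by auto
  then obtain F where F: "F \<subseteq> \<Lambda>" "finite F" "\<Lambda> \<subseteq> (\<Union>c\<in>F. ball c r)"
    using compactE_image[OF assms(1), of \<Lambda> "\<lambda>c. ball c r"] by auto
  define sep where "sep D \<longleftrightarrow> (\<forall>c\<in>D. \<forall>d\<in>D. c \<noteq> d \<longrightarrow> r < dist c d)" for D :: "'k set"
  have "finite {D. D \<subseteq> F \<and> sep D}" "{} \<in> {D. D \<subseteq> F \<and> sep D}" using F(2) by (auto simp: sep_def)
  from finite_has_maximal2[OF this] obtain C where C: "C \<subseteq> F" "sep C"
    "\<And>D. \<lbrakk>D \<subseteq> F; sep D; C \<subseteq> D\<rbrakk> \<Longrightarrow> C = D"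
    by auto
  have cov: "\<exists>c\<in>C. dist c d \<le> r" if "d \<in> F" for d
  proof (rule ccontr)
    assume *: "\<not> (\<exists>c\<in>C. dist c d \<le> r)"
    then have "sep (insert d C)" using C(2) unfolding sep_def by (auto simp: dist_commute not_le)
    then have "d \<in> C" using C(3)[of "insert d C"] C(1) that by blast
    then have "\<not> dist d d \<le> r" using * by blast
    then show False using assms(2) by simp
  qed
  have "\<Lambda> \<subseteq> (\<Union>c\<in>C. cball c r)"
  proof
    fix x assume "x \<in> \<Lambda>"
    then obtain d where "d \<in> F" "dist d x \<le> r" using F(3) by force
    moreover then obtain c where "c \<in> C" "dist c d \<le> r" using cov by blast
    ultimately show "x \<in> (\<Union>c\<in>C. cball c r)" using dist_ultrametric_le[of c d r x] by auto
  qed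
  moreover have "finite C" using C(1) F(2) finite_subset by blast
  moreover have "C \<subseteq> \<Lambda>" using C(1) F(1) by simp
  moreover have "r < dist c d" if "c \<in> C" "d \<in> C" "c \<noteq> d" for c d
    using C(2) that by (simp add: sep_def)
  ultimately show ?thesis using that[of C] by simp
qed

section \<open>Divided differences over sets of nodes\<close>

text \<open>For a node \<open>s\<close> of \<open>A\<close> this is the reciprocal of the derivative
  at \<open>s\<close> of the monic polynomial with simple roots \<open>A\<close>.\<close>

definition node_weight :: "'k::field set \<Rightarrow> 'k \<Rightarrow> 'k" where
  "node_weight A s = (\<Prod>t\<in>A - {s}. 1 / (s - t))"

lemma node_weight_remove:
  assumes "finite A" "u \<in> A" "s \<noteq> u"
  shows "node_weight (A - {u}) s = node_weight A s * (s - u)"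
proof -
  have "A - {s} = insert u (A - {u} - {s})" using assms by auto
  then have "node_weight A s = 1 / (s - u) * node_weight (A - {u}) s"
    unfolding node_weight_def using assms by (subst \<open>A - {s} = _\<close>) (auto intro!: prod.insert)
  then show ?thesis using assms(3) by simp
qed

text \<open>The classical divided difference \<open>f[A]\<close> in Lagrange form; its order is
  \<open>card A - 1\<close>.\<close>

definition point_dd ::
  "('k::field \<Rightarrow> 'e::ab_group_add \<Rightarrow> 'e) \<Rightarrow> 'k set \<Rightarrow> ('k \<Rightarrow> 'e) \<Rightarrow> 'e" where
  "point_dd smul A f = (\<Sum>s\<in>A. smul (node_weight A s) (f s))"

abbreviation scalar_dd :: "'k::field set \<Rightarrow> ('k \<Rightarrow> 'k) \<Rightarrow> 'k" where
  "scalar_dd \<equiv> point_dd (*)"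

text \<open>Indexing by finite sets of nodes instead of tuples makes the symmetry of divided differences
  automatic. The coordinates outside \<open>J\<close> are those of the base point \<open>x\<close>, so that
  \<open>mdd smul J S f\<close> is again a function of all coordinates and such operators can be composed.\<close>

definition mdd ::
  "('k::field \<Rightarrow> 'e::ab_group_add \<Rightarrow> 'e) \<Rightarrow> 'i set \<Rightarrow> ('i \<Rightarrow> 'k set) \<Rightarrow> (('i \<Rightarrow> 'k) \<Rightarrow> 'e) \<Rightarrow>
    ('i \<Rightarrow> 'k) \<Rightarrow> 'e" where
  "mdd smul J S f x = (\<Sum>s\<in>Pi\<^sub>E J S. smul (\<Prod>i\<in>J. node_weight (S i) (s i)) (f (override_on x s J)))"

context vector_space
begin

lemma point_dd_singleton [simp]: "point_dd scale {s} f = f s"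
  by (simp add: point_dd_def node_weight_def)

lemma point_dd_empty [simp]: "point_dd scale {} f = 0"
  by (simp add: point_dd_def)

lemma point_dd_cong: "(\<And>s. s \<in> A \<Longrightarrow> f s = g s) \<Longrightarrow> point_dd scale A f = point_dd scale A g"
  by (simp add: point_dd_def)

lemma point_dd_add: "point_dd scale A (\<lambda>x. f x + g x) = point_dd scale A f + point_dd scale A g"
  by (simp add: point_dd_def scale_right_distrib sum.distrib)

lemma point_dd_diff: "point_dd scale A (\<lambda>x. f x - g x) = point_dd scale A f - point_dd scale A g"
  by (simp add: point_dd_def scale_right_diff_distrib sum_subtractf)

lemma point_dd_scale: "point_dd scale A (\<lambda>x. scale c (f x)) = scale c (point_dd scale A f)"
  by (simp add: point_dd_def scale_sum_right mult.commute)

text \<open>The factor vanishes at \<open>u\<close> and cancels \<open>1 / (s - u)\<close> in all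
  other weights. Every recursion for divided differences below rests on this identity.\<close>

lemma point_dd_linear_factor:
  assumes "finite A" "u \<in> A"
  shows "point_dd scale A (\<lambda>x. scale (x - u) (f x)) = point_dd scale (A - {u}) f"
proof -
  have "point_dd scale A (\<lambda>x. scale (x - u) (f x)) =
      (\<Sum>s\<in>A - {u}. scale (node_weight A s) (scale (s - u) (f s)))"
    unfolding point_dd_def using assms by (subst sum.remove[of A u]) auto
  also have "\<dots> = point_dd scale (A - {u}) f"
    unfolding point_dd_def by (rule sum.cong) (use assms in \<open>auto simp: node_weight_remove\<close>)
  finally show ?thesis .
qed

text \<open>The constant \<open>u - v\<close> is written as \<open>(x - v) - (x - u)\<close>, and
  each linear factor removes its node.\<close>

lemma point_dd_remove:
  assumes "finite A" "u \<in> A" "v \<in> A"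
  shows "scale (u - v) (point_dd scale A f) = point_dd scale (A - {v}) f - point_dd scale (A - {u}) f"
proof -
  have "scale (u - v) (point_dd scale A f) =
      point_dd scale A (\<lambda>x. scale (x - v) (f x) - scale (x - u) (f x))"
    by (simp add: point_dd_scale [symmetric] scale_left_diff_distrib [symmetric])
  then show ?thesis using assms by (simp add: point_dd_diff point_dd_linear_factor)
qed

lemma mdd_empty [simp]: "mdd scale {} S f x = f x"
  by (simp add: mdd_def)

text \<open>Peeling off one coordinate exhibits \<open>mdd\<close> as an iterated one-variable
  difference; one-variable identities are transferred through it.\<close>

lemma mdd_insert:
  assumes "finite J" "i \<notin> J"
  shows "mdd scale (insert i J) S f x = point_dd scale (S i) (\<lambda>t. mdd scale J S f (x(i := t)))"
proof -
  have inj: "inj_on (\<lambda>(t, s). s(i := t)) (S i \<times> Pi\<^sub>E J S)"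
    using assms(2) by (rule inj_combinator)
  have "mdd scale (insert i J) S f x = (\<Sum>(t, s)\<in>S i \<times> Pi\<^sub>E J S.
      scale (\<Prod>k\<in>insert i J. node_weight (S k) ((s(i := t)) k))
        (f (override_on x (s(i := t)) (insert i J))))"
    unfolding mdd_def PiE_insert_eq by (subst sum.reindex[OF inj]) (auto simp: case_prod_unfold intro!: sum.cong)
  also have "\<dots> = (\<Sum>(t, s)\<in>S i \<times> Pi\<^sub>E J S. scale (node_weight (S i) t)
      (scale (\<Prod>k\<in>J. node_weight (S k) (s k)) (f (override_on (x(i := t)) s J))))"
  proof (rule sum.cong, goal_cases)
    case (2 z)
    obtain t s where [simp]: "z = (t, s)" by force
    have "override_on x (s(i := t)) (insert i J) = override_on (x(i := t)) s J"
      using assms(2) by (auto simp: override_on_def fun_eq_iff)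
    moreover have "(\<Prod>k\<in>J. node_weight (S k) ((s(i := t)) k)) = (\<Prod>k\<in>J. node_weight (S k) (s k))"
      using assms(2) by (intro prod.cong) auto
    ultimately show ?case using assms by simp
  qed simp
  finally show ?thesis
    by (simp add: point_dd_def mdd_def scale_sum_right sum.cartesian_product)
qed

text \<open>Only the grid of nodes through the base point matters. This allows replacing a function
  by a piecewise expression that is valid at the nodes only.\<close>

lemma mdd_cong:
  assumes "\<And>i. i \<in> J \<Longrightarrow> S i = S' i"
    and "\<And>y. \<lbrakk>\<And>i. i \<in> J \<Longrightarrow> y i \<in> S i; \<And>i. i \<notin> J \<Longrightarrow> y i = x i\<rbrakk> \<Longrightarrow> f y = g y"
  shows "mdd scale J S f x = mdd scale J S' g x"
  unfolding mdd_def
proof (rule sum.cong)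
  show "Pi\<^sub>E J S = Pi\<^sub>E J S'" using assms(1) by (rule PiE_cong)
  fix s assume "s \<in> Pi\<^sub>E J S'"
  with assms(1) have "f (override_on x s J) = g (override_on x s J)"
    by (intro assms(2)) (auto simp: PiE_def)
  with assms(1) show "scale (\<Prod>i\<in>J. node_weight (S i) (s i)) (f (override_on x s J)) =
      scale (\<Prod>i\<in>J. node_weight (S' i) (s i)) (g (override_on x s J))" by simp
qed

lemma mdd_base_cong:
  assumes "\<And>i. i \<notin> J \<Longrightarrow> x i = y i"
  shows "mdd scale J S f x = mdd scale J S f y"
proof -
  have "override_on x s J = override_on y s J" for s using assms by (auto simp: override_on_def)
  then show ?thesis by (simp add: mdd_def)
qed

lemma mdd_add: "mdd scale J S (\<lambda>x. f x + g x) x = mdd scale J S f x + mdd scale J S g x"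
  by (simp add: mdd_def scale_right_distrib sum.distrib)

lemma mdd_diff: "mdd scale J S (\<lambda>x. f x - g x) x = mdd scale J S f x - mdd scale J S g x"
  by (simp add: mdd_def scale_right_diff_distrib sum_subtractf)

lemma mdd_scale: "mdd scale J S (\<lambda>x. scale c (f x)) x = scale c (mdd scale J S f x)"
  by (simp add: mdd_def scale_sum_right mult.commute)

lemma mdd_zero [simp]: "mdd scale J S (\<lambda>x. 0) x = 0"
  by (simp add: mdd_def)

lemma mdd_sum: "mdd scale J S (\<lambda>x. \<Sum>z\<in>Z. f z x) x = (\<Sum>z\<in>Z. mdd scale J S (f z) x)"
  by (induction Z rule: infinite_finite_induct) (auto simp: mdd_add)

lemma mdd_Un:
  assumes "finite J" "finite J'" "J \<inter> J' = {}"
  shows "mdd scale (J \<union> J') S f x = mdd scale J S (mdd scale J' S f) x"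
  using assms(1,3)
proof (induction J arbitrary: x rule: finite_induct)
  case (insert i J)
  then have "mdd scale (insert i (J \<union> J')) S f x =
      point_dd scale (S i) (\<lambda>t. mdd scale (J \<union> J') S f (x(i := t)))"
    using assms(2) by (intro mdd_insert) auto
  with insert show ?case by (simp add: mdd_insert fun_upd_def)
qed simp

lemma mdd_remove:
  assumes "finite J" "i \<in> J" "finite (S i)" "u \<in> S i" "v \<in> S i"
  shows "scale (u - v) (mdd scale J S f x) =
    mdd scale J (S(i := S i - {v})) f x - mdd scale J (S(i := S i - {u})) f x"
proof -
  let ?J = "J - {i}"
  have J: "J = insert i ?J" using assms by auto
  have ins: "mdd scale J T f x = point_dd scale (T i) (\<lambda>t. mdd scale ?J T f (x(i := t)))" for T
    by (subst J, rule mdd_insert) (use assms in auto)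
  have "mdd scale ?J (S(i := A)) f y = mdd scale ?J S f y" for A y
    by (rule mdd_cong) auto
  then show ?thesis using assms by (simp add: ins point_dd_remove)
qed

text \<open>As \<open>h\<close> is constant along the coordinates in \<open>J\<close>, it acts as a
  fixed vector, and the sum over the grid factors into one-variable sums.\<close>

lemma mdd_tensor:
  assumes "finite J" "\<And>i. i \<in> J \<Longrightarrow> finite (S i)"
    and "\<And>y. (\<And>i. i \<notin> J \<Longrightarrow> y i = x i) \<Longrightarrow> h y = h x"
  shows "mdd scale J S (\<lambda>y. scale (\<Prod>i\<in>J. u i (y i)) (h y)) x =
    scale (\<Prod>i\<in>J. scalar_dd (S i) (u i)) (h x)"
proof -
  have "mdd scale J S (\<lambda>y. scale (\<Prod>i\<in>J. u i (y i)) (h y)) x =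
      (\<Sum>s\<in>Pi\<^sub>E J S. scale (\<Prod>i\<in>J. node_weight (S i) (s i) * u i (s i)) (h x))"
    unfolding mdd_def
  proof (rule sum.cong, goal_cases)
    case (2 s)
    have "h (override_on x s J) = h x" by (intro assms(3)) auto
    then show ?case by (simp add: prod.distrib)
  qed simp
  also have "\<dots> = scale (\<Sum>s\<in>Pi\<^sub>E J S. \<Prod>i\<in>J. node_weight (S i) (s i) * u i (s i)) (h x)"
    by (simp add: scale_sum_left)
  also have "(\<Sum>s\<in>Pi\<^sub>E J S. \<Prod>i\<in>J. node_weight (S i) (s i) * u i (s i)) =
      (\<Prod>i\<in>J. scalar_dd (S i) (u i))"
    using assms(1,2) by (simp add: point_dd_def prod_sum_PiE)
  finally show ?thesis .
qed

end

section \<open>Gluing over disjoint balls\<close>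

text \<open>The module carries no topology here, so the estimates also apply to the field as a space
  over itself.\<close>

locale ultrametric_vector_space = vector_space scale
  for scale :: "'k::ultrametric_field \<Rightarrow> 'e::ab_group_add \<Rightarrow> 'e"  (infixr \<open>\<odot>\<close> 75)

sublocale ultrametric_lcs \<subseteq> ultrametric_vector_space smul ..

lemma ultrametric_vector_space_mult: "ultrametric_vector_space (*)"
  by unfold_locales (auto simp: algebra_simps)

context ultrametric_vector_space
begin

section \<open>Arithmetic of submodules over the unit ball\<close>

lemma submodule_0: "unit_ball_submodule scale Q \<Longrightarrow> 0 \<in> Q"
  by (simp add: unit_ball_submodule_def)

lemma submodule_add: "\<lbrakk>unit_ball_submodule scale Q; x \<in> Q; y \<in> Q\<rbrakk> \<Longrightarrow> x + y \<in> Q"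
  by (simp add: unit_ball_submodule_def)

lemma submodule_scale: "\<lbrakk>unit_ball_submodule scale Q; abs_value c \<le> 1; x \<in> Q\<rbrakk> \<Longrightarrow> c \<odot> x \<in> Q"
  by (simp add: unit_ball_submodule_def)

lemma submodule_minus: "\<lbrakk>unit_ball_submodule scale Q; x \<in> Q\<rbrakk> \<Longrightarrow> - x \<in> Q"
  using submodule_scale[of Q "- 1" x] by simp

lemma submodule_diff: "\<lbrakk>unit_ball_submodule scale Q; x \<in> Q; y \<in> Q\<rbrakk> \<Longrightarrow> x - y \<in> Q"
  using submodule_add[of Q x "- y"] submodule_minus by simp

lemma submodule_sum:
  "\<lbrakk>unit_ball_submodule scale Q; \<And>z. z \<in> Z \<Longrightarrow> g z \<in> Q\<rbrakk> \<Longrightarrow> sum g Z \<in> Q"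
  by (induction Z rule: infinite_finite_induct) (auto simp: submodule_0 submodule_add)

lemma submodule_image:
  assumes "unit_ball_submodule scale Q"
  shows "unit_ball_submodule scale (scale c ` Q)"
  unfolding unit_ball_submodule_def
proof (intro conjI ballI allI impI)
  show "0 \<in> scale c ` Q" using submodule_0[OF assms] by force
next
  fix x y assume "x \<in> scale c ` Q" "y \<in> scale c ` Q"
  then obtain p q where "p \<in> Q" "q \<in> Q" "x = c \<odot> p" "y = c \<odot> q" by auto
  then show "x + y \<in> scale c ` Q"
    using submodule_add[OF assms, of p q] by (auto simp: scale_right_distrib [symmetric])
next
  fix d :: 'k and x assume "abs_value d \<le> 1" "x \<in> scale c ` Q"
  then obtain q where "q \<in> Q" "x = c \<odot> q" by auto
  then have "d \<odot> x = c \<odot> (d \<odot> q)" by simp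
  then show "d \<odot> x \<in> scale c ` Q"
    using submodule_scale[OF assms \<open>abs_value d \<le> 1\<close> \<open>q \<in> Q\<close>] by blast
qed

lemma submodule_vimage:
  assumes "unit_ball_submodule scale Q"
  shows "unit_ball_submodule scale {x. c \<odot> x \<in> Q}"
proof -
  have "c \<odot> (d \<odot> x) = d \<odot> (c \<odot> x)" for d x by simp
  then show ?thesis
    using assms unfolding unit_ball_submodule_def
    by (auto simp: scale_right_distrib simp del: scale_scale)
qed

text \<open>Turns a comparison of absolute values into membership, since \<open>d / c\<close> lies
  in the unit ball. This is how divisions by differences of nodes are estimated.\<close>

lemma submodule_scale_le:
  assumes "unit_ball_submodule scale Q" "c \<odot> x \<in> Q" "abs_value d \<le> abs_value c"
  shows "d \<odot> x \<in> Q"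
proof (cases "c = 0")
  case True
  then have "d = 0" using assms(3) abs_value_nonneg[of d] by (simp add: order_antisym_conv)
  then show ?thesis using assms(1) by (simp add: submodule_0)
next
  case False
  then have "d \<odot> x = (d / c) \<odot> (c \<odot> x)" by simp
  moreover have "abs_value (d / c) \<le> 1" using assms(3) False by (simp add: abs_value_divide)
  ultimately show ?thesis using submodule_scale[OF assms(1) _ assms(2)] by metis
qed

text \<open>Passing to nodes in the box \<open>D\<close> costs one factor \<open>\<pi>\<close> per node: the recursion in two nodes
  \<open>u \<in> D\<close> and \<open>t \<notin> D\<close> divides by \<open>u - t\<close>, which is at least as large as \<open>\<pi>\<close>.\<close>

lemma mdd_restrict_box:
  assumes "finite J" "unit_ball_submodule scale Q"
    and "\<And>i. i \<in> J \<Longrightarrow> finite (S i)"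
    and "\<And>i s t. \<lbrakk>i \<in> J; s \<in> S i; t \<in> S i; s \<in> D i; t \<notin> D i\<rbrakk> \<Longrightarrow> abs_value \<pi> \<le> abs_value (s - t)"
    and "\<And>S'. (\<And>i. i \<in> J \<Longrightarrow> S' i \<subseteq> S i \<inter> D i \<and> S' i \<noteq> {}) \<Longrightarrow>
      \<pi> ^ (\<Sum>i\<in>J. card (S' i)) \<odot> mdd scale J S' f x \<in> Q"
  shows "\<pi> ^ (\<Sum>i\<in>J. card (S i)) \<odot>
    mdd scale J S (\<lambda>y. if \<forall>i\<in>J. y i \<in> D i then f y else 0) x \<in> Q"
  using assms(3-5)
proof (induction "\<Sum>i\<in>J. card (S i)" arbitrary: S rule: less_induct)
  case less
  let ?f = "\<lambda>y. if \<forall>i\<in>J. y i \<in> D i then f y else 0"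
  \<comment> \<open>If some coordinate has no node in the box, in particular if it has no node at
    all, the cut-off function vanishes on the whole grid.\<close>
  consider (inside) "\<And>i. i \<in> J \<Longrightarrow> S i \<subseteq> D i" "\<And>i. i \<in> J \<Longrightarrow> S i \<noteq> {}"
    | (outside) i where "i \<in> J" "S i \<inter> D i = {}"
    | (mixed) i u t where "i \<in> J" "u \<in> S i" "u \<in> D i" "t \<in> S i" "t \<notin> D i"
    by blast
  then show ?case
  proof cases
    case inside
    then have "mdd scale J S ?f x = mdd scale J S f x"
      by (intro mdd_cong) auto
    with less.prems(3)[of S] inside show ?thesis by simp
  next
    case outside
    then have "mdd scale J S ?f x = mdd scale J S (\<lambda>_. 0) x"
      by (intro mdd_cong) auto
    then show ?thesis by (simp add: submodule_0[OF assms(2)])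
  next
    case mixed
    let ?T = "\<lambda>s. S(i := S i - {s})"
    have card_T: "(\<Sum>k\<in>J. card (S k)) = Suc (\<Sum>k\<in>J. card (?T s k))" if "s \<in> S i" for s
    proof -
      have "card (S i) = Suc (card (S i - {s}))"
        using less.prems(1)[OF mixed(1)] that by (metis card_Suc_Diff1)
      moreover have "(\<Sum>k\<in>J - {i}. card (?T s k)) = (\<Sum>k\<in>J - {i}. card (S k))"
        by (rule sum.cong) auto
      ultimately show ?thesis
        using sum.remove[OF assms(1) mixed(1), of "\<lambda>k. card (S k)"]
          sum.remove[OF assms(1) mixed(1), of "\<lambda>k. card (?T s k)"] by simp
    qed
    let ?n = "\<Sum>k\<in>J. card (S k)"
    have IH: "\<pi> ^ (?n - 1) \<odot> mdd scale J (?T s) ?f x \<in> Q" if s: "s \<in> S i" for s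
    proof -
      have "?T s k \<subseteq> S k" for k by auto
      then have "\<pi> ^ (\<Sum>k\<in>J. card (?T s k)) \<odot> mdd scale J (?T s) ?f x \<in> Q"
        using card_T[OF s] less.prems(1,2)
        by (intro less.hyps less.prems(3)) (auto split: if_splits, blast+)
      then show ?thesis using card_T[OF s] by simp
    qed
    have "u - t \<noteq> 0" using mixed by auto
    have "(u - t) \<odot> mdd scale J S ?f x = mdd scale J (?T t) ?f x - mdd scale J (?T u) ?f x"
      using mixed assms(1) less.prems(1) by (intro mdd_remove) auto
    then have "(u - t) \<odot> (\<pi> ^ (?n - 1) \<odot> mdd scale J S ?f x) =
        \<pi> ^ (?n - 1) \<odot> mdd scale J (?T t) ?f x - \<pi> ^ (?n - 1) \<odot> mdd scale J (?T u) ?f x"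
      by (metis scale_left_commute scale_right_diff_distrib)
    also have "\<dots> \<in> Q" using IH mixed by (intro submodule_diff[OF assms(2)]) auto
    finally have "\<pi> \<odot> (\<pi> ^ (?n - 1) \<odot> mdd scale J S ?f x) \<in> Q"
      using submodule_scale_le[OF assms(2)] less.prems(2)[OF mixed(1,2,4,3,5)] by blast
    moreover have "\<pi> * \<pi> ^ (?n - 1) = \<pi> ^ ?n"
      using card_T[OF mixed(2)] by simp
    ultimately show ?thesis by simp
  qed
qed

text \<open>Each piece is cut off to its own box and treated separately, \<open>Q\<close> being
  closed under sums; a point inside and a point outside a closed ball of radius |\<pi>| are more
  than |\<pi>| apart. The functions \<open>e c\<close> for different boxes need not be
  related.\<close>

lemma mdd_glue_boxes:
  assumes J: "finite J" and Q: "unit_ball_submodule scale Q" and C: "\<And>i. i \<in> J \<Longrightarrow> finite (C i)"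
    and S: "\<And>i. i \<in> J \<Longrightarrow> finite (S i)"
    and loc: "\<And>c S'. \<lbrakk>c \<in> Pi\<^sub>E J C; \<And>i. i \<in> J \<Longrightarrow> S' i \<subseteq> S i \<inter> cball (c i) (abs_value \<pi>) \<and> S' i \<noteq> {}\<rbrakk> \<Longrightarrow>
      \<pi> ^ (\<Sum>i\<in>J. card (S' i)) \<odot> mdd scale J S' (e c) x \<in> Q"
  shows "\<pi> ^ (\<Sum>i\<in>J. card (S i)) \<odot> mdd scale J S
      (\<lambda>y. \<Sum>c\<in>Pi\<^sub>E J C. if \<forall>i\<in>J. y i \<in> cball (c i) (abs_value \<pi>) then e c y else 0) x \<in> Q"
  unfolding mdd_sum scale_sum_right
proof (rule submodule_sum[OF Q])
  fix c assume c: "c \<in> Pi\<^sub>E J C"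
  show "\<pi> ^ (\<Sum>i\<in>J. card (S i)) \<odot> mdd scale J S
      (\<lambda>y. if \<forall>i\<in>J. y i \<in> cball (c i) (abs_value \<pi>) then e c y else 0) x \<in> Q"
  proof (rule mdd_restrict_box[OF J Q S])
    fix i s t assume "s \<in> cball (c i) (abs_value \<pi>)" "t \<notin> cball (c i) (abs_value \<pi>)"
    then have "\<not> dist s t \<le> abs_value \<pi>" using dist_ultrametric_le[of "c i" s "abs_value \<pi>" t] by auto
    then show "abs_value \<pi> \<le> abs_value (s - t)" by (simp add: dist_abs_value)
  qed (use c loc in auto)
qed

text \<open>Separated centres give disjoint balls, so exactly one box contains \<open>y\<close> and
  the cut-offs add up to one.\<close>

lemma sum_boxes_eq:
  fixes r :: real
  assumes J: "finite J" and C: "\<And>i. i \<in> J \<Longrightarrow> finite (C i)"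
    and sep: "\<And>i c d. \<lbrakk>i \<in> J; c \<in> C i; d \<in> C i; c \<noteq> d\<rbrakk> \<Longrightarrow> r < dist c (d::'k)"
    and y: "\<And>i. i \<in> J \<Longrightarrow> y i \<in> (\<Union>c\<in>C i. cball c r)"
  shows "(\<Sum>c\<in>Pi\<^sub>E J C. if \<forall>i\<in>J. y i \<in> cball (c i) r then g else 0) = (g::'e)"
proof -
  from y have "\<forall>i\<in>J. \<exists>c\<in>C i. y i \<in> cball c r" by blast
  then obtain d where d: "\<And>i. i \<in> J \<Longrightarrow> d i \<in> C i \<and> y i \<in> cball (d i) r" by metis
  have "(\<forall>i\<in>J. y i \<in> cball (c i) r) \<longleftrightarrow> c = restrict d J" if c: "c \<in> Pi\<^sub>E J C" for c
  proof
    assume *: "\<forall>i\<in>J. y i \<in> cball (c i) r"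
    have "c i = d i" if "i \<in> J" for i
    proof (rule ccontr)
      assume "c i \<noteq> d i"
      moreover have "dist (c i) (d i) \<le> r"
        using * d that dist_ultrametric_le[of "c i" "y i" r "d i"] by (auto simp: dist_commute)
      ultimately show False using sep[of i "c i" "d i"] c d that by fastforce
    qed
    then show "c = restrict d J" using c by (auto simp: PiE_def extensional_def fun_eq_iff)
  qed (use d in auto)
  then have "(\<Sum>c\<in>Pi\<^sub>E J C. if \<forall>i\<in>J. y i \<in> cball (c i) r then g else 0) =
      (\<Sum>c\<in>Pi\<^sub>E J C. if c = restrict d J then g else 0)"
    by (intro sum.cong) auto
  also have "\<dots> = g" using d J C by (subst sum.delta) (auto intro: finite_PiE)
  finally show ?thesis .
qed

end

section \<open>Newton interpolation\<close>

context vector_space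
begin

lemma point_dd_const:
  assumes "finite A" "A \<noteq> {}"
  shows "point_dd scale A (\<lambda>_. b) = (if card A = 1 then b else 0)"
  using assms
proof (induction "card A" arbitrary: A rule: less_induct)
  case less
  show ?case
  proof (cases "card A = 1")
    case True
    then show ?thesis by (auto simp: card_1_singleton_iff)
  next
    case False
    then have "\<not> card A \<le> Suc 0" using less.prems by (simp add: le_Suc_eq)
    then obtain u v where uv: "u \<in> A" "v \<in> A" "u \<noteq> v"
      using less.prems(1) by (auto simp: card_le_Suc0_iff_eq)
    then have card: "card (A - {u}) < card A" "card (A - {v}) < card A" "card (A - {v}) = card (A - {u})"
      using less.prems by (auto simp: card_Diff_singleton card_gt_0_iff)
    have "scale (u - v) (point_dd scale A (\<lambda>_. b)) =
        point_dd scale (A - {v}) (\<lambda>_. b) - point_dd scale (A - {u}) (\<lambda>_. b)"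
      using less.prems uv by (intro point_dd_remove) auto
    also have "\<dots> = 0" using less.hyps[OF card(1)] less.hyps[OF card(2)] less.prems uv card(3) by force
    finally show ?thesis using False uv by simp
  qed
qed

end

definition newton_basis :: "(nat \<Rightarrow> 'k::comm_ring_1) \<Rightarrow> nat \<Rightarrow> 'k \<Rightarrow> 'k" where
  "newton_basis z k t = (\<Prod>s<k. t - z s)"

text \<open>A monic polynomial of degree \<open>k\<close> has its leading coefficient as difference
  of order \<open>k\<close> and zero differences above. Rewriting the last factor
  \<open>t - z k\<close> as \<open>(t - u) + (u - z k)\<close> with a node \<open>u\<close> of
  \<open>A\<close> lowers the degree, wherever the points \<open>z\<close> lie.\<close>

lemma scalar_dd_newton_basis:
  fixes z :: "nat \<Rightarrow> 'k::field"
  assumes "finite A" "k < card A"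
  shows "scalar_dd A (newton_basis z k) = (if card A = Suc k then 1 else 0)"
  using assms
proof (induction k arbitrary: A)
  case 0
  have "newton_basis z 0 = (\<lambda>_. 1)" by (simp add: newton_basis_def fun_eq_iff)
  moreover have "A \<noteq> {}" using 0 by auto
  ultimately show ?case
    using vector_space_over_itself.point_dd_const[OF 0(1), of "1::'k"] by simp
next
  case (Suc k)
  then obtain u where u: "u \<in> A" by fastforce
  have eq: "newton_basis z (Suc k) = (\<lambda>t. (t - u) * newton_basis z k t + (u - z k) * newton_basis z k t)"
    by (simp add: newton_basis_def fun_eq_iff algebra_simps)
  have "scalar_dd A (newton_basis z (Suc k)) =
      scalar_dd (A - {u}) (newton_basis z k) + (u - z k) * scalar_dd A (newton_basis z k)"
    unfolding eq using Suc.prems u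
    by (simp only: vector_space_over_itself.point_dd_add vector_space_over_itself.point_dd_scale
        vector_space_over_itself.point_dd_linear_factor)
  then show ?case using Suc u by (auto simp: card_Diff_singleton)
qed

text \<open>Biorthogonality: for \<open>j < k\<close> all nodes are roots of the basis polynomial,
  and for \<open>j\<close> from \<open>k\<close> on the degree decides.\<close>

lemma scalar_dd_newton_basis_nodes:
  fixes z :: "nat \<Rightarrow> 'k::field"
  assumes "inj z"
  shows "scalar_dd (z ` {..j}) (newton_basis z k) = (if j = k then 1 else 0)"
proof (cases "k \<le> j")
  case True
  have "card (z ` {..j}) = Suc j" using assms by (simp add: card_image inj_on_subset)
  then show ?thesis using True by (subst scalar_dd_newton_basis) auto
next
  case False
  then have "scalar_dd (z ` {..j}) (newton_basis z k) = scalar_dd (z ` {..j}) (\<lambda>_. 0)"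
    by (intro vector_space_over_itself.point_dd_cong) (auto simp: newton_basis_def)
  then show ?thesis using False by (simp add: point_dd_def)
qed

definition multidegrees :: "'i set \<Rightarrow> nat \<Rightarrow> ('i \<Rightarrow> nat) set" where
  "multidegrees J a = {\<beta> \<in> J \<rightarrow>\<^sub>E UNIV. (\<Sum>i\<in>J. \<beta> i) \<le> a}"

lemma multidegrees_eq_restrict:
  "\<lbrakk>\<beta> \<in> multidegrees J a; \<And>i. i \<in> J \<Longrightarrow> \<beta> i = \<gamma> i\<rbrakk> \<Longrightarrow> \<beta> = restrict \<gamma> J"
  unfolding multidegrees_def by (rule extensionalityI[of _ J]) (auto simp: PiE_def)

lemma finite_multidegrees: assumes "finite J" shows "finite (multidegrees J a)"
proof (rule finite_subset)
  show "multidegrees J a \<subseteq> J \<rightarrow>\<^sub>E {..a}"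
  proof
    fix \<beta> assume b: "\<beta> \<in> multidegrees J a"
    then have "\<beta> i \<le> a" if "i \<in> J" for i
      using member_le_sum[of i J \<beta>] assms that by (auto simp: multidegrees_def)
    with b show "\<beta> \<in> J \<rightarrow>\<^sub>E {..a}" by (auto simp: multidegrees_def PiE_def)
  qed
qed (use assms in \<open>auto intro: finite_PiE\<close>)

text \<open>The coefficients are differences of \<open>f\<close> which still depend on the
  coordinates of \<open>y\<close> outside \<open>J\<close>; in the coordinates in \<open>J\<close>
  this is a polynomial of total degree at most \<open>a\<close>.\<close>

definition newton_interpolation ::
  "('k::field \<Rightarrow> 'e::ab_group_add \<Rightarrow> 'e) \<Rightarrow> 'i set \<Rightarrow> nat \<Rightarrow> ('i \<Rightarrow> nat \<Rightarrow> 'k) \<Rightarrow>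
    (('i \<Rightarrow> 'k) \<Rightarrow> 'e) \<Rightarrow> ('i \<Rightarrow> 'k) \<Rightarrow> 'e" where
  "newton_interpolation smul J a z f y = (\<Sum>\<beta>\<in>multidegrees J a.
     smul (\<Prod>i\<in>J. newton_basis (z i) (\<beta> i) (y i)) (mdd smul J (\<lambda>i. z i ` {..\<beta> i}) f y))"

context ultrametric_vector_space
begin

lemma mdd_newton_interpolation:
  assumes "finite J" "\<And>i. i \<in> J \<Longrightarrow> finite (S i)"
  shows "mdd scale J S (newton_interpolation scale J a z f) x = (\<Sum>\<beta>\<in>multidegrees J a.
    (\<Prod>i\<in>J. scalar_dd (S i) (newton_basis (z i) (\<beta> i))) \<odot> mdd scale J (\<lambda>i. z i ` {..\<beta> i}) f x)"
  unfolding newton_interpolation_def mdd_sum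
  by (intro sum.cong mdd_tensor mdd_base_cong refl assms) auto

text \<open>By biorthogonality only the term with \<beta> equal to \<gamma> on \<open>J\<close>
  survives. Hence the interpolation error has vanishing differences up to order \<open>a\<close> on
  initial segments of the nodes.\<close>

lemma mdd_newton_interpolation_nodes:
  assumes J: "finite J" and inj: "\<And>i. i \<in> J \<Longrightarrow> inj (z i)" and le: "(\<Sum>i\<in>J. \<gamma> i) \<le> a"
  shows "mdd scale J (\<lambda>i. z i ` {..\<gamma> i}) (newton_interpolation scale J a z f) x =
    mdd scale J (\<lambda>i. z i ` {..\<gamma> i}) f x"
proof -
  have *: "(\<Prod>i\<in>J. scalar_dd (z i ` {..\<gamma> i}) (newton_basis (z i) (\<beta> i))) =
      (if \<beta> = restrict \<gamma> J then 1 else 0)" if b: "\<beta> \<in> multidegrees J a" for \<beta>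
  proof (cases "\<beta> = restrict \<gamma> J")
    case True
    then show ?thesis using inj by (simp add: scalar_dd_newton_basis_nodes)
  next
    case False
    then obtain i where "i \<in> J" "\<beta> i \<noteq> \<gamma> i"
      using b multidegrees_eq_restrict by blast
    then show ?thesis using inj J False by (auto simp: scalar_dd_newton_basis_nodes)
  qed
  have mem: "restrict \<gamma> J \<in> multidegrees J a" using le by (auto simp: multidegrees_def)
  have "mdd scale J (\<lambda>i. z i ` {..\<gamma> i}) (newton_interpolation scale J a z f) x =
      (\<Sum>\<beta>\<in>multidegrees J a. if \<beta> = restrict \<gamma> J then mdd scale J (\<lambda>i. z i ` {..\<beta> i}) f x else 0)"
    using J by (subst mdd_newton_interpolation) (simp_all add: * if_distrib[of "\<lambda>c. c \<odot> _"] cong: sum.cong if_cong)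
  also have "\<dots> = mdd scale J (\<lambda>i. z i ` {..restrict \<gamma> J i}) f x"
    by (simp only: sum.delta[OF finite_multidegrees[OF J]] mem if_True)
  also have "\<dots> = mdd scale J (\<lambda>i. z i ` {..\<gamma> i}) f x"
    by (rule mdd_cong) auto
  finally show ?thesis .
qed

text \<open>In top order the position of \<open>S\<close> does not matter: a multidegree of total at
  most \<open>a\<close> that differs from \<gamma> is smaller than \<gamma> in some coordinate, and
  there the difference is of too high an order for the basis polynomial.\<close>

lemma mdd_newton_interpolation_top:
  assumes J: "finite J" and inj: "\<And>i. i \<in> J \<Longrightarrow> inj (z i)"
    and S: "\<And>i. i \<in> J \<Longrightarrow> finite (S i) \<and> card (S i) = Suc (\<gamma> i)"
    and eq: "(\<Sum>i\<in>J. \<gamma> i) = a"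
  shows "mdd scale J S (newton_interpolation scale J a z f) x = mdd scale J (\<lambda>i. z i ` {..\<gamma> i}) f x"
proof -
  have *: "(\<Prod>i\<in>J. scalar_dd (S i) (newton_basis (z i) (\<beta> i))) =
      (if \<beta> = restrict \<gamma> J then 1 else 0)" if b: "\<beta> \<in> multidegrees J a" for \<beta>
  proof (cases "\<beta> = restrict \<gamma> J")
    case True
    then show ?thesis using S by (simp add: scalar_dd_newton_basis)
  next
    case False
    have "\<exists>i\<in>J. \<beta> i < \<gamma> i"
    proof (rule ccontr)
      assume "\<not> (\<exists>i\<in>J. \<beta> i < \<gamma> i)"
      then have le: "\<And>i. i \<in> J \<Longrightarrow> \<gamma> i \<le> \<beta> i" by force
      moreover have "\<not> (\<exists>i\<in>J. \<gamma> i < \<beta> i)"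
        using sum_strict_mono2 sum_strict_mono_ex1[of J \<gamma> \<beta>] J le b eq by (force simp: multidegrees_def)
      ultimately have "\<beta> i = \<gamma> i" if "i \<in> J" for i using that by force
      then show False using False b multidegrees_eq_restrict by blast
    qed
    then obtain i where "i \<in> J" "\<beta> i < \<gamma> i" by blast
    then have "scalar_dd (S i) (newton_basis (z i) (\<beta> i)) = 0"
      using S[OF \<open>i \<in> J\<close>] by (simp add: scalar_dd_newton_basis)
    then show ?thesis using J \<open>i \<in> J\<close> False by auto
  qed
  have mem: "restrict \<gamma> J \<in> multidegrees J a" using eq by (auto simp: multidegrees_def)
  have "mdd scale J S (newton_interpolation scale J a z f) x =
      (\<Sum>\<beta>\<in>multidegrees J a. if \<beta> = restrict \<gamma> J then mdd scale J (\<lambda>i. z i ` {..\<beta> i}) f x else 0)"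
    using J S by (subst mdd_newton_interpolation) (simp_all add: * if_distrib[of "\<lambda>c. c \<odot> _"] cong: sum.cong if_cong)
  also have "\<dots> = mdd scale J (\<lambda>i. z i ` {..restrict \<gamma> J i}) f x"
    by (simp only: sum.delta[OF finite_multidegrees[OF J]] mem if_True)
  also have "\<dots> = mdd scale J (\<lambda>i. z i ` {..\<gamma> i}) f x"
    by (rule mdd_cong) auto
  finally show ?thesis .
qed

lemma sum_fun_upd_Suc:
  fixes g :: "'i \<Rightarrow> nat"
  assumes "finite J" "i \<in> J" "g' i = Suc (g i)" "\<And>k. \<lbrakk>k \<in> J; k \<noteq> i\<rbrakk> \<Longrightarrow> g' k = g k"
  shows "sum g' J = Suc (sum g J)"
  using assms by (subst (1 2) sum.remove[of J i]) (auto intro!: sum.cong)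

text \<open>Exchanging the nodes of \<open>T\<close> for those of \<open>T'\<close> one at a time.\<close>

lemma mdd_exchange:
  assumes J: "finite J" and Q: "unit_ball_submodule scale Q"
    and Y: "\<And>i u v. \<lbrakk>i \<in> J; u \<in> Y i; v \<in> Y i\<rbrakk> \<Longrightarrow> abs_value (u - v) \<le> abs_value \<pi>"
    and up: "\<And>T''. \<lbrakk>\<And>i. i \<in> J \<Longrightarrow> finite (T'' i) \<and> T'' i \<subseteq> Y i \<and> T'' i \<noteq> {};
        (\<Sum>i\<in>J. card (T'' i)) = Suc m\<rbrakk> \<Longrightarrow> \<pi> ^ Suc m \<odot> mdd scale J T'' f x \<in> Q"
    and T: "\<And>i. i \<in> J \<Longrightarrow> finite (T i) \<and> T i \<subseteq> Y i"
    and T': "\<And>i. i \<in> J \<Longrightarrow> finite (T' i) \<and> T' i \<subseteq> Y i \<and> T' i \<noteq> {} \<and> card (T' i) = card (T i)"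
    and m: "(\<Sum>i\<in>J. card (T i)) = m"
  shows "\<pi> ^ m \<odot> (mdd scale J T f x - mdd scale J T' f x) \<in> Q"
  using T T' m
proof (induction "\<Sum>i\<in>J. card (T i - T' i)" arbitrary: T rule: less_induct)
  case less
  show ?case
  proof (cases "\<forall>i\<in>J. T i \<subseteq> T' i")
    case True
    then have "T i = T' i" if "i \<in> J" for i using less.prems that by (metis card_subset_eq)
    then have "mdd scale J T f x = mdd scale J T' f x" by (intro mdd_cong) auto
    then show ?thesis by (simp add: submodule_0[OF Q])
  next
    case False
    then obtain i where i: "i \<in> J" "\<not> T i \<subseteq> T' i" by blast
    then have "\<not> T' i \<subseteq> T i" using less.prems by (metis card_subset_eq)
    then obtain u v where u: "u \<in> T i" "u \<notin> T' i" and v: "v \<in> T' i" "v \<notin> T i" using i by blast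
    note fin = less.prems(1)[OF i(1)] less.prems(2)[OF i(1)]
    \<comment> \<open>\<open>T2\<close> contains both \<open>u\<close> and \<open>v\<close>.
      Removing \<open>v\<close> gives back \<open>T\<close>, removing \<open>u\<close> gives
      \<open>T1\<close>, so one exchange costs \<open>u - v\<close> times a difference of the next
      order, and \<open>u - v\<close> is no larger than \<pi>.\<close>
    define T1 where "T1 = T(i := insert v (T i - {u}))"
    define T2 where "T2 = T(i := insert v (T i))"
    have card1: "card (T1 i) = card (T i)"
      using fin u v by (simp add: T1_def card.insert_remove card_Diff_singleton_if card_gt_0_iff)
        (metis Suc_pred card_gt_0_iff empty_iff)
    have "card (T1 i - T' i) < card (T i - T' i)"
      using fin u v by (intro psubset_card_mono) (auto simp: T1_def)
    moreover have "card (T1 k - T' k) = card (T k - T' k)" if "k \<noteq> i" for k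
      using that by (simp add: T1_def)
    ultimately have "(\<Sum>k\<in>J. card (T1 k - T' k)) < (\<Sum>k\<in>J. card (T k - T' k))"
      using J i by (intro sum_strict_mono_ex1) (auto, metis less_imp_le_nat order_refl)
    moreover have "\<And>k. k \<in> J \<Longrightarrow> card (T1 k) = card (T k)" using card1 by (auto simp: T1_def)
    moreover have "\<And>k. k \<in> J \<Longrightarrow> finite (T1 k) \<and> T1 k \<subseteq> Y k"
      using less.prems v i by (auto simp: T1_def)
    ultimately have IH: "\<pi> ^ m \<odot> (mdd scale J T1 f x - mdd scale J T' f x) \<in> Q"
      using less.prems by (intro less.hyps) auto
    have "(\<Sum>k\<in>J. card (T2 k)) = Suc m"
      using J i fin v less.prems(3) sum_fun_upd_Suc[of J i "\<lambda>k. card (T2 k)" "\<lambda>k. card (T k)"]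
      by (simp add: T2_def)
    moreover have "finite (T2 k) \<and> T2 k \<subseteq> Y k \<and> T2 k \<noteq> {}" if "k \<in> J" for k
      using less.prems(1,2)[OF that] v i by (auto simp: T2_def)
    ultimately have "\<pi> ^ Suc m \<odot> mdd scale J T2 f x \<in> Q" by (intro up) auto
    then have "\<pi> \<odot> (\<pi> ^ m \<odot> mdd scale J T2 f x) \<in> Q" by simp
    moreover have "abs_value (u - v) \<le> abs_value \<pi>"
      using Y[OF i(1), of u v] fin u v by auto
    ultimately have "(u - v) \<odot> (\<pi> ^ m \<odot> mdd scale J T2 f x) \<in> Q"
      using submodule_scale_le[OF Q] by blast
    moreover have "(u - v) \<odot> mdd scale J T2 f x = mdd scale J T f x - mdd scale J T1 f x"
    proof -
      have "T2(i := T2 i - {v}) = T" "T2(i := T2 i - {u}) = T1"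
        using u v by (auto simp: T1_def T2_def fun_eq_iff)
      moreover have "(u - v) \<odot> mdd scale J T2 f x =
          mdd scale J (T2(i := T2 i - {v})) f x - mdd scale J (T2(i := T2 i - {u})) f x"
        using J i fin u v by (intro mdd_remove) (auto simp: T2_def)
      ultimately show ?thesis by simp
    qed
    ultimately have "\<pi> ^ m \<odot> (mdd scale J T f x - mdd scale J T1 f x) \<in> Q"
      by (metis scale_left_commute)
    from submodule_add[OF Q this IH] show ?thesis by (simp add: scale_right_diff_distrib)
  qed
qed

text \<open>Descending induction on the order. In top order the difference of the error is an
  oscillation of the difference of \<open>f\<close>, because the interpolant contributes the
  difference of \<open>f\<close> at the interpolation nodes. Below, the difference of the error
  vanishes at those nodes, and moving from there to \<open>T\<close> brings in a factor \<pi> and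
  differences of the next order.\<close>

lemma newton_interpolation_error:
  assumes J: "finite J" and Q: "unit_ball_submodule scale Q"
    and Y: "\<And>i u v. \<lbrakk>i \<in> J; u \<in> Y i; v \<in> Y i\<rbrakk> \<Longrightarrow> abs_value (u - v) \<le> abs_value \<pi>"
    and z: "\<And>i. i \<in> J \<Longrightarrow> inj (z i) \<and> range (z i) \<subseteq> Y i"
    and osc: "\<And>T T'. \<lbrakk>\<And>i. i \<in> J \<Longrightarrow> finite (T i) \<and> T i \<subseteq> Y i \<and> T i \<noteq> {};
        \<And>i. i \<in> J \<Longrightarrow> finite (T' i) \<and> T' i \<subseteq> Y i \<and> card (T' i) = card (T i);
        (\<Sum>i\<in>J. card (T i)) = a + card J\<rbrakk> \<Longrightarrow> mdd scale J T f x - mdd scale J T' f x \<in> Q"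
    and T: "\<And>i. i \<in> J \<Longrightarrow> finite (T i) \<and> T i \<subseteq> Y i \<and> T i \<noteq> {}"
    and le: "(\<Sum>i\<in>J. card (T i)) \<le> a + card J"
  shows "\<pi> ^ (\<Sum>i\<in>J. card (T i)) \<odot>
      mdd scale J T (\<lambda>y. f y - newton_interpolation scale J a z f y) x \<in> scale (\<pi> ^ (a + card J)) ` Q"
  using T le
proof (induction "a + card J - (\<Sum>i\<in>J. card (T i))" arbitrary: T)
  case (0 T)
  let ?\<gamma> = "\<lambda>i. card (T i) - 1"
  have card: "card (T i) = Suc (?\<gamma> i)" if "i \<in> J" for i
    using 0 that by (metis Suc_pred' card_gt_0_iff One_nat_def)
  have tot: "(\<Sum>i\<in>J. card (T i)) = a + card J" using 0 by linarith
  have "(\<Sum>i\<in>J. card (T i)) = (\<Sum>i\<in>J. ?\<gamma> i) + card J"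
    using card by (simp only: sum_Suc [symmetric] cong: sum.cong)
  then have "(\<Sum>i\<in>J. ?\<gamma> i) = a" using tot by linarith
  then have "mdd scale J T (newton_interpolation scale J a z f) x = mdd scale J (\<lambda>i. z i ` {..?\<gamma> i}) f x"
    using J z card 0 by (intro mdd_newton_interpolation_top) auto
  moreover have "mdd scale J T f x - mdd scale J (\<lambda>i. z i ` {..?\<gamma> i}) f x \<in> Q"
  proof (rule osc)
    fix i assume i: "i \<in> J"
    then have "inj_on (z i) {..?\<gamma> i}" using z by (meson inj_on_subset subset_UNIV)
    then show "finite (z i ` {..?\<gamma> i}) \<and> z i ` {..?\<gamma> i} \<subseteq> Y i \<and> card (z i ` {..?\<gamma> i}) = card (T i)"
      using z[OF i] card[OF i] by (auto simp: card_image)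
  qed (use 0 tot in auto)
  ultimately show ?case unfolding tot mdd_diff by auto
next
  case (Suc n T)
  let ?e = "\<lambda>y. f y - newton_interpolation scale J a z f y"
  let ?m = "\<Sum>i\<in>J. card (T i)"
  let ?\<gamma> = "\<lambda>i. card (T i) - 1"
  let ?T' = "\<lambda>i. z i ` {..?\<gamma> i}"
  have card: "card (T i) = Suc (?\<gamma> i)" if "i \<in> J" for i
    using Suc.prems that by (metis Suc_pred' card_gt_0_iff One_nat_def)
  have "?m = (\<Sum>i\<in>J. ?\<gamma> i) + card J"
    using card by (simp only: sum_Suc [symmetric] cong: sum.cong)
  then have "(\<Sum>i\<in>J. ?\<gamma> i) \<le> a" using Suc.prems by linarith
  then have "mdd scale J ?T' ?e x = 0"
    using J z by (simp add: mdd_diff mdd_newton_interpolation_nodes)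
  moreover have "\<pi> ^ ?m \<odot> (mdd scale J T ?e x - mdd scale J ?T' ?e x) \<in> scale (\<pi> ^ (a + card J)) ` Q"
  proof (rule mdd_exchange[OF J submodule_image[OF Q], where Y = Y])
    fix T'' assume T'': "\<And>i. i \<in> J \<Longrightarrow> finite (T'' i) \<and> T'' i \<subseteq> Y i \<and> T'' i \<noteq> {}"
      "(\<Sum>i\<in>J. card (T'' i)) = Suc ?m"
    from Suc.hyps(1)[of T''] Suc.hyps(2) T''
    show "\<pi> ^ Suc ?m \<odot> mdd scale J T'' ?e x \<in> scale (\<pi> ^ (a + card J)) ` Q" by simp
  next
    fix i assume i: "i \<in> J"
    then have "inj_on (z i) {..?\<gamma> i}" using z by (meson inj_on_subset subset_UNIV)
    then show "finite (z i ` {..?\<gamma> i}) \<and> z i ` {..?\<gamma> i} \<subseteq> Y i \<and> z i ` {..?\<gamma> i} \<noteq> {} \<and>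
        card (z i ` {..?\<gamma> i}) = card (T i)"
      using z[OF i] card[OF i] by (auto simp: card_image)
  qed (use Y Suc.prems in auto)
  ultimately show ?case by simp
qed

end

section \<open>Uniformly locally polynomial functions\<close>

text \<open>One radius serves all centres, so such functions can be resolved on any cover by balls
  of a single small radius.\<close>

definition uniformly_locally_polynomial :: "('k::ultrametric_field \<Rightarrow> 'k) \<Rightarrow> bool" where
  "uniformly_locally_polynomial u \<longleftrightarrow> (\<exists>r>0. \<forall>c. \<exists>p. \<forall>x\<in>cball c r. u x = poly p x)"

lemma uniformly_locally_polynomial_mult:
  assumes "uniformly_locally_polynomial u" "uniformly_locally_polynomial v"
  shows "uniformly_locally_polynomial (\<lambda>x. u x * v x)"
proof -
  from assms obtain r s where "r > 0" "s > 0"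
    and r: "\<And>c. \<exists>p. \<forall>x\<in>cball c r. u x = poly p x" and s: "\<And>c. \<exists>p. \<forall>x\<in>cball c s. v x = poly p x"
    unfolding uniformly_locally_polynomial_def by metis
  have "\<exists>p. \<forall>x\<in>cball c (min r s). u x * v x = poly p x" for c
  proof -
    obtain p q where "\<forall>x\<in>cball c r. u x = poly p x" "\<forall>x\<in>cball c s. v x = poly q x"
      using r s by blast
    then have "\<forall>x\<in>cball c (min r s). u x * v x = poly (p * q) x" by simp
    then show ?thesis by blast
  qed
  then show ?thesis unfolding uniformly_locally_polynomial_def
    using \<open>r > 0\<close> \<open>s > 0\<close> by (intro exI[of _ "min r s"]) auto
qed

text \<open>Balls of equal radius coincide or are disjoint, so on each of them the cut-off is either
  \<open>p\<close> or zero.\<close>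

lemma uniformly_locally_polynomial_cutoff:
  assumes "r > 0"
  shows "uniformly_locally_polynomial (\<lambda>x. if x \<in> cball c r then poly p x else 0)"
proof -
  have "\<exists>q. \<forall>x\<in>cball d r. (if x \<in> cball c r then poly p x else 0) = poly q x" for d
  proof (cases "d \<in> cball c r")
    case True
    then have "cball d r \<subseteq> cball c r" using dist_ultrametric_le[of c d r] by auto
    then show ?thesis by (intro exI[of _ p]) auto
  next
    case False
    then have "x \<notin> cball c r" if "x \<in> cball d r" for x
      using that dist_ultrametric_le[of c x r d] by (auto simp: dist_commute)
    then show ?thesis by (intro exI[of _ 0]) auto
  qed
  then show ?thesis unfolding uniformly_locally_polynomial_def using assms by blast
qed

lemma newton_basis_eq_poly: "newton_basis z k = poly (\<Prod>s<k. [:- z s, 1:])"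
  by (simp add: newton_basis_def poly_prod fun_eq_iff)

lemma prod_if_zero:
  assumes "finite J"
  shows "(\<Prod>i\<in>J. if P i then u i else (0::'k::field)) = (if \<forall>i\<in>J. P i then \<Prod>i\<in>J. u i else 0)"
  using assms by (induction J rule: finite_induct) auto

context ultrametric_vector_space
begin

lemma submodule_cancel_power:
  assumes "unit_ball_submodule scale Q" "\<pi> \<noteq> 0" "abs_value \<pi> \<le> 1" "m \<le> n"
    and "\<pi> ^ m \<odot> x \<in> scale (\<pi> ^ n) ` Q"
  shows "x \<in> Q"
proof -
  obtain q where q: "q \<in> Q" "\<pi> ^ m \<odot> x = \<pi> ^ n \<odot> q" using assms(5) by blast
  note q(2)
  also have "\<pi> ^ n = \<pi> ^ m * \<pi> ^ (n - m)" using assms(4) by (simp flip: power_add)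
  finally have "\<pi> ^ m \<odot> x = \<pi> ^ m \<odot> (\<pi> ^ (n - m) \<odot> q)" by simp
  then have "x = \<pi> ^ (n - m) \<odot> q" using scale_left_imp_eq[of "\<pi> ^ m" x] assms(2) by simp
  moreover have "abs_value (\<pi> ^ (n - m)) \<le> 1" using assms(3) by (simp add: abs_value_power power_le_one)
  ultimately show ?thesis using submodule_scale[OF assms(1) _ q(1)] by blast
qed

text \<open>Piecewise Newton interpolation: gluing costs one factor \<pi> per node, and the local
  error supplies \<open>a + card J\<close> of them, enough for every order up to
  \<open>a\<close>.\<close>

lemma mdd_local_newton_error:
  fixes \<pi> :: 'k
  assumes J: "finite J" and Q: "unit_ball_submodule scale Q" and \<pi>: "\<pi> \<noteq> 0" "abs_value \<pi> \<le> 1"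
    and C: "\<And>i. i \<in> J \<Longrightarrow> finite (C i)"
    and sep: "\<And>i c d. \<lbrakk>i \<in> J; c \<in> C i; d \<in> C i; c \<noteq> d\<rbrakk> \<Longrightarrow> abs_value \<pi> < dist c d"
    and z: "\<And>i c. \<lbrakk>i \<in> J; c \<in> C i\<rbrakk> \<Longrightarrow> inj (z i c) \<and> range (z i c) \<subseteq> X i \<inter> cball c (abs_value \<pi>)"
    and osc: "\<And>c T T'. \<lbrakk>c \<in> Pi\<^sub>E J C;
        \<And>i. i \<in> J \<Longrightarrow> finite (T i) \<and> T i \<subseteq> X i \<inter> cball (c i) (abs_value \<pi>) \<and> T i \<noteq> {};
        \<And>i. i \<in> J \<Longrightarrow> finite (T' i) \<and> T' i \<subseteq> X i \<inter> cball (c i) (abs_value \<pi>) \<and> card (T' i) = card (T i);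
        (\<Sum>i\<in>J. card (T i)) = a + card J\<rbrakk> \<Longrightarrow> mdd scale J T f x - mdd scale J T' f x \<in> Q"
    and S: "\<And>i. i \<in> J \<Longrightarrow> finite (S i) \<and> S i \<noteq> {} \<and> S i \<subseteq> X i \<inter> (\<Union>c\<in>C i. cball c (abs_value \<pi>))"
    and le: "(\<Sum>i\<in>J. card (S i)) \<le> a + card J"
  shows "mdd scale J S (\<lambda>y. f y - (\<Sum>(c, \<beta>)\<in>Pi\<^sub>E J C \<times> multidegrees J a.
      (\<Prod>i\<in>J. if y i \<in> cball (c i) (abs_value \<pi>) then newton_basis (z i (c i)) (\<beta> i) (y i) else 0) \<odot>
      mdd scale J (\<lambda>i. z i (c i) ` {..\<beta> i}) f y)) x \<in> Q"
proof -
  let ?box = "\<lambda>c y. \<forall>i\<in>J. y i \<in> cball (c i) (abs_value \<pi>)"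
  let ?P = "\<lambda>c. newton_interpolation scale J a (\<lambda>i. z i (c i)) f"
  let ?e = "\<lambda>y. \<Sum>c\<in>Pi\<^sub>E J C. if ?box c y then f y - ?P c y else 0"
  have "mdd scale J S (\<lambda>y. f y - (\<Sum>(c, \<beta>)\<in>Pi\<^sub>E J C \<times> multidegrees J a.
      (\<Prod>i\<in>J. if y i \<in> cball (c i) (abs_value \<pi>) then newton_basis (z i (c i)) (\<beta> i) (y i) else 0) \<odot>
      mdd scale J (\<lambda>i. z i (c i) ` {..\<beta> i}) f y)) x = mdd scale J S ?e x"
  proof (rule mdd_cong, goal_cases)
    case (2 y)
    \<comment> \<open>At the nodes the boxes form a partition of unity, so \<open>f\<close> and the
      interpolant both split into their restrictions to boxes.\<close>
    have "(\<Sum>c\<in>Pi\<^sub>E J C. if ?box c y then f y else 0) = f y"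
    proof (rule sum_boxes_eq[OF J C sep])
      fix i assume i: "i \<in> J"
      with 2(1)[OF i] S[OF i] show "y i \<in> (\<Union>c\<in>C i. cball c (abs_value \<pi>))" by blast
    qed auto
    moreover have "(\<Sum>(c, \<beta>)\<in>Pi\<^sub>E J C \<times> multidegrees J a.
        (\<Prod>i\<in>J. if y i \<in> cball (c i) (abs_value \<pi>) then newton_basis (z i (c i)) (\<beta> i) (y i) else 0) \<odot>
        mdd scale J (\<lambda>i. z i (c i) ` {..\<beta> i}) f y) = (\<Sum>c\<in>Pi\<^sub>E J C. if ?box c y then ?P c y else 0)"
      unfolding sum.cartesian_product [symmetric]
    proof (rule sum.cong[OF refl])
      fix c
      show "(\<Sum>\<beta>\<in>multidegrees J a.
        (\<Prod>i\<in>J. if y i \<in> cball (c i) (abs_value \<pi>) then newton_basis (z i (c i)) (\<beta> i) (y i) else 0) \<odot>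
        mdd scale J (\<lambda>i. z i (c i) ` {..\<beta> i}) f y) = (if ?box c y then ?P c y else 0)"
        unfolding prod_if_zero[OF J] newton_interpolation_def
        by (rule case_split[of "?box c y"]) (simp_all only: if_P if_False scale_zero_left sum.neutral_const)
    qed
    moreover have "?e y = (\<Sum>c\<in>Pi\<^sub>E J C. if ?box c y then f y else 0) - (\<Sum>c\<in>Pi\<^sub>E J C. if ?box c y then ?P c y else 0)"
      by (simp flip: sum_subtractf add: if_distrib cong: if_cong)
    ultimately show ?case by simp
  qed simp
  moreover have "\<pi> ^ (\<Sum>i\<in>J. card (S i)) \<odot> mdd scale J S ?e x \<in> scale (\<pi> ^ (a + card J)) ` Q"
  proof (rule mdd_glue_boxes[OF J submodule_image[OF Q] C])
    fix c S' assume c: "c \<in> Pi\<^sub>E J C"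
      and S': "\<And>i. i \<in> J \<Longrightarrow> S' i \<subseteq> S i \<inter> cball (c i) (abs_value \<pi>) \<and> S' i \<noteq> {}"
    show "\<pi> ^ (\<Sum>i\<in>J. card (S' i)) \<odot> mdd scale J S' (\<lambda>y. f y - ?P c y) x \<in> scale (\<pi> ^ (a + card J)) ` Q"
    proof (rule newton_interpolation_error[OF J Q, where Y = "\<lambda>i. X i \<inter> cball (c i) (abs_value \<pi>)"])
      fix i u v assume "u \<in> X i \<inter> cball (c i) (abs_value \<pi>)" "v \<in> X i \<inter> cball (c i) (abs_value \<pi>)"
      then show "abs_value (u - v) \<le> abs_value \<pi>"
        using dist_ultrametric_le[of u "c i" "abs_value \<pi>" v] by (auto simp: dist_abs_value abs_value_minus_commute)
    next
      fix i assume i: "i \<in> J"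
      show "finite (S' i) \<and> S' i \<subseteq> X i \<inter> cball (c i) (abs_value \<pi>) \<and> S' i \<noteq> {}"
        using S'[OF i] S[OF i] by (meson finite_subset le_inf_iff order_trans)
    next
      have "card (S' i) \<le> card (S i)" if "i \<in> J" for i
        using S'[OF that] S[OF that] by (intro card_mono) auto
      then show "(\<Sum>i\<in>J. card (S' i)) \<le> a + card J"
        using le by (meson order_trans sum_mono)
    next
      fix i assume "i \<in> J"
      with c have "c i \<in> C i" by auto
      with z \<open>i \<in> J\<close> show "inj (z i (c i)) \<and> range (z i (c i)) \<subseteq> X i \<inter> cball (c i) (abs_value \<pi>)" by blast
    qed (rule osc[OF c])
  qed (use S in auto)
  ultimately show ?thesis using submodule_cancel_power[OF Q \<pi> le] by simp
qed

end

section \<open>Polynomials close to indicator functions of balls\<close>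

text \<open>In order \<open>m = card A - 1\<close> this says that \<open>r ^ m\<close> times the
  difference is at most \<delta>, for all orders at once; the extra factor \<open>r\<close> avoids
  the subtraction. With this weight the bounds are submultiplicative, and gluing over balls of
  radius \<open>r\<close> loses nothing.\<close>

definition dd_bounded :: "'k::ultrametric_field set \<Rightarrow> real \<Rightarrow> real \<Rightarrow> ('k \<Rightarrow> 'k) \<Rightarrow> bool" where
  "dd_bounded B r \<delta> q \<longleftrightarrow> (\<forall>A. finite A \<longrightarrow> A \<noteq> {} \<longrightarrow> A \<subseteq> B \<longrightarrow>
     abs_value (scalar_dd A q) * r ^ card A \<le> \<delta> * r)"

lemma dd_boundedD:
  "\<lbrakk>dd_bounded B r \<delta> q; finite A; A \<noteq> {}; A \<subseteq> B\<rbrakk> \<Longrightarrow>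
    abs_value (scalar_dd A q) * r ^ card A \<le> \<delta> * r"
  by (simp add: dd_bounded_def)

lemma dd_bounded_point:
  assumes "dd_bounded B r \<delta> q" "u \<in> B" "0 < r"
  shows "abs_value (q u) \<le> \<delta>"
  using dd_boundedD[OF assms(1), of "{u}"] assms(2,3) by simp

lemma dd_bounded_subset: "\<lbrakk>dd_bounded B r \<delta> q; B' \<subseteq> B\<rbrakk> \<Longrightarrow> dd_bounded B' r \<delta> q"
  unfolding dd_bounded_def by (meson order_trans)

lemma dd_bounded_mono: "\<lbrakk>dd_bounded B r \<delta> q; \<delta> \<le> \<delta>'; 0 \<le> r\<rbrakk> \<Longrightarrow> dd_bounded B r \<delta>' q"
  unfolding dd_bounded_def by (meson mult_right_mono order_trans)

lemma dd_bounded_diff: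
  assumes "dd_bounded B r \<delta> f" "dd_bounded B r \<delta> g" "0 \<le> r"
  shows "dd_bounded B r \<delta> (\<lambda>x. f x - g x)"
  unfolding dd_bounded_def vector_space_over_itself.point_dd_diff
proof (intro allI impI)
  fix A :: "'a set" assume "finite A" "A \<noteq> {}" "A \<subseteq> B"
  then have "abs_value (scalar_dd A f) * r ^ card A \<le> \<delta> * r" "abs_value (scalar_dd A g) * r ^ card A \<le> \<delta> * r"
    using assms(1,2) unfolding dd_bounded_def by blast+
  moreover have "abs_value (scalar_dd A f - scalar_dd A g) * r ^ card A \<le>
      max (abs_value (scalar_dd A f)) (abs_value (scalar_dd A g)) * r ^ card A"
    using assms(3) by (intro mult_right_mono abs_value_diff_le) auto
  ultimately show "abs_value (scalar_dd A f - scalar_dd A g) * r ^ card A \<le> \<delta> * r"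
    by (auto simp: max_def split: if_splits)
qed

lemma dd_bounded_const:
  assumes "abs_value b \<le> \<delta>" "0 \<le> r"
  shows "dd_bounded B r \<delta> (\<lambda>_. b)"
  unfolding dd_bounded_def
proof (intro allI impI)
  fix A :: "'a set" assume "finite A" "A \<noteq> {}"
  then show "abs_value (scalar_dd A (\<lambda>_. b)) * r ^ card A \<le> \<delta> * r"
    using assms order_trans[OF abs_value_nonneg[of b] assms(1)]
    by (simp add: vector_space_over_itself.point_dd_const mult_right_mono)
qed

lemma dd_bounded_add:
  assumes "dd_bounded B r \<delta> f" "dd_bounded B r \<delta> g" "0 \<le> r"
  shows "dd_bounded B r \<delta> (\<lambda>x. f x + g x)"
  unfolding dd_bounded_def vector_space_over_itself.point_dd_add
proof (intro allI impI)
  fix A :: "'a set" assume A: "finite A" "A \<noteq> {}" "A \<subseteq> B"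
  have "abs_value (scalar_dd A f + scalar_dd A g) * r ^ card A \<le>
      max (abs_value (scalar_dd A f)) (abs_value (scalar_dd A g)) * r ^ card A"
    using assms(3) by (intro mult_right_mono abs_value_ultrametric) auto
  then show "abs_value (scalar_dd A f + scalar_dd A g) * r ^ card A \<le> \<delta> * r"
    using dd_boundedD[OF assms(1) A] dd_boundedD[OF assms(2) A] by (auto simp: max_def split: if_splits)
qed

lemma dd_bounded_sum:
  assumes "\<And>z. z \<in> Z \<Longrightarrow> dd_bounded B r \<delta> (f z)" "0 \<le> r" "0 \<le> \<delta>"
  shows "dd_bounded B r \<delta> (\<lambda>x. \<Sum>z\<in>Z. f z x)"
  using assms(1)
  by (induction Z rule: infinite_finite_induct) (auto simp: dd_bounded_const assms intro!: dd_bounded_add)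

lemma dd_bounded_cong:
  assumes "dd_bounded B r \<delta> g" "\<And>x. x \<in> B \<Longrightarrow> f x = g x"
  shows "dd_bounded B r \<delta> f"
  unfolding dd_bounded_def
proof (intro allI impI)
  fix A :: "'a set" assume A: "finite A" "A \<noteq> {}" "A \<subseteq> B"
  have "scalar_dd A f = scalar_dd A g"
    using A assms(2) by (intro vector_space_over_itself.point_dd_cong) blast
  then show "abs_value (scalar_dd A f) * r ^ card A \<le> \<delta> * r"
    using dd_boundedD[OF assms(1) A] by simp
qed

text \<open>Splitting off one node \<open>u\<close>: with \<open>f x = f u + (x - u) f\<^sub>1 x\<close> one has
  \<open>f\<^sub>1[A] = f[A \<union> {u}]\<close> and \<open>(f g)[A \<union> {u}] = f u \<cdot> g[A \<union> {u}] + (f\<^sub>1 g)[A]\<close>.\<close>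

lemma abs_scalar_dd_mult_le:
  fixes f g :: "'k::ultrametric_field \<Rightarrow> 'k"
  assumes "0 < r" "finite A" "A \<noteq> {}"
    and "dd_bounded A r \<delta> f" "dd_bounded A r \<epsilon> g" "0 \<le> \<delta>" "0 \<le> \<epsilon>"
  shows "abs_value (scalar_dd A (\<lambda>x. f x * g x)) * r ^ card A \<le> \<delta> * \<epsilon> * r"
  using assms(2-)
proof (induction A arbitrary: f \<delta> rule: finite_psubset_induct)
  case (psubset A)
  then obtain u where u: "u \<in> A" by blast
  have fu: "abs_value (f u) \<le> \<delta>" and gu: "abs_value (g u) \<le> \<epsilon>"
    using dd_bounded_point psubset.prems u assms(1) by blast+
  show ?case
  proof (cases "A = {u}")
    case True
    then show ?thesis using fu gu assms(1) psubset.prems(4) by (simp add: abs_value_mult mult_mono)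
  next
    case False
    define f1 where "f1 x = (f x - f u) / (x - u)" for x
    have f: "f x = f u + (x - u) * f1 x" if "x \<in> A" for x
      by (cases "x = u") (auto simp: f1_def)
    have f1: "scalar_dd A' f1 = scalar_dd (insert u A') f" if A': "A' \<subseteq> A - {u}" "A' \<noteq> {}" for A'
    proof -
      have fin: "finite A'" using A' psubset.hyps by (meson finite_Diff finite_subset)
      then have "card (insert u A') \<noteq> 1" using A' by (auto simp: card_insert_if)
      moreover have "scalar_dd (insert u A') f = scalar_dd (insert u A') (\<lambda>x. f u + (x - u) * f1 x)"
        using A' u f by (intro vector_space_over_itself.point_dd_cong) blast
      moreover have "insert u A' - {u} = A'" using A' by blast
      ultimately show ?thesis using fin
        by (simp add: vector_space_over_itself.point_dd_add vector_space_over_itself.point_dd_const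
            vector_space_over_itself.point_dd_linear_factor)
    qed
    have "dd_bounded (A - {u}) r (\<delta> / r) f1"
      unfolding dd_bounded_def
    proof (intro allI impI)
      fix A' assume A': "finite A'" "A' \<noteq> {}" "A' \<subseteq> A - {u}"
      then have "abs_value (scalar_dd (insert u A') f) * r ^ card (insert u A') \<le> \<delta> * r"
        using u by (intro dd_boundedD[OF psubset.prems(2)]) auto
      moreover have "card (insert u A') = Suc (card A')" using A' by (auto simp: card_insert_if)
      ultimately show "abs_value (scalar_dd A' f1) * r ^ card A' \<le> \<delta> / r * r"
        using A' assms(1) by (simp add: f1 mult.assoc[symmetric] mult.commute[of r])
    qed
    moreover have "dd_bounded (A - {u}) r \<epsilon> g"
      using psubset.prems(3) by (rule dd_bounded_subset) auto
    ultimately have IH: "abs_value (scalar_dd (A - {u}) (\<lambda>x. f1 x * g x)) * r ^ card (A - {u}) \<le> \<delta> / r * \<epsilon> * r"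
      using psubset False u assms(1) by (intro psubset.IH) auto
    have card: "r ^ card A = r * r ^ card (A - {u})"
      using psubset.hyps u by (metis card_Suc_Diff1 power_Suc)
    have b1: "abs_value (scalar_dd (A - {u}) (\<lambda>x. f1 x * g x)) * r ^ card A \<le> \<delta> * \<epsilon> * r"
      using mult_left_mono[OF IH, of r] assms(1) by (simp add: card mult_ac)
    have "abs_value (scalar_dd A g) * r ^ card A \<le> \<epsilon> * r"
      using psubset.hyps psubset.prems(1) by (intro dd_boundedD[OF psubset.prems(3)]) auto
    then have b2: "abs_value (f u * scalar_dd A g) * r ^ card A \<le> \<delta> * \<epsilon> * r"
      using mult_mono[OF fu] psubset.prems(4) assms(1) by (simp only: abs_value_mult mult.assoc) simp
    have "scalar_dd A (\<lambda>x. f x * g x) = scalar_dd A (\<lambda>x. f u * g x + (x - u) * (f1 x * g x))"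
      by (intro vector_space_over_itself.point_dd_cong) (simp add: f algebra_simps)
    also have "\<dots> = f u * scalar_dd A g + scalar_dd (A - {u}) (\<lambda>x. f1 x * g x)"
      using psubset.hyps u
      by (simp only: vector_space_over_itself.point_dd_add vector_space_over_itself.point_dd_scale
          vector_space_over_itself.point_dd_linear_factor)
    finally have "abs_value (scalar_dd A (\<lambda>x. f x * g x)) * r ^ card A \<le>
        max (abs_value (f u * scalar_dd A g)) (abs_value (scalar_dd (A - {u}) (\<lambda>x. f1 x * g x))) * r ^ card A"
      using assms(1) by (auto intro!: mult_right_mono abs_value_ultrametric)
    then show ?thesis using b1 b2 by (auto simp: max_def split: if_splits)
  qed
qed

lemma dd_bounded_mult:
  assumes "0 < r" "dd_bounded B r \<delta> f" "dd_bounded B r \<epsilon> g" "0 \<le> \<delta>" "0 \<le> \<epsilon>"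
  shows "dd_bounded B r (\<delta> * \<epsilon>) (\<lambda>x. f x * g x)"
  unfolding dd_bounded_def
proof (intro allI impI)
  fix A :: "'a set" assume A: "finite A" "A \<noteq> {}" "A \<subseteq> B"
  then have "dd_bounded A r \<delta> f" "dd_bounded A r \<epsilon> g"
    using assms(2,3) dd_bounded_subset by blast+
  then show "abs_value (scalar_dd A (\<lambda>x. f x * g x)) * r ^ card A \<le> \<delta> * \<epsilon> * r"
    using A assms by (intro abs_scalar_dd_mult_le) auto
qed

text \<open>Only the orders 0 and 1 contribute. In order 1 the difference is 1 and its weight is
  \<open>r\<close>, whence the condition \<open>r \<le> \<delta>\<close>.\<close>

lemma dd_bounded_linear:
  assumes "0 < r" "r \<le> \<delta>" "\<And>x. x \<in> B \<Longrightarrow> abs_value (x - c) \<le> \<delta>"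
  shows "dd_bounded B r \<delta> (\<lambda>x. x - c)"
  unfolding dd_bounded_def
proof (intro allI impI)
  fix A :: "'a set" assume A: "finite A" "A \<noteq> {}" "A \<subseteq> B"
  then obtain u where u: "u \<in> A" by blast
  have "scalar_dd A (\<lambda>x. x - c) = scalar_dd A (\<lambda>x. (x - u) * 1 + (u - c))"
    by (intro vector_space_over_itself.point_dd_cong) simp
  also have "\<dots> = scalar_dd (A - {u}) (\<lambda>_. 1) + scalar_dd A (\<lambda>_. u - c)"
    using A u by (simp only: vector_space_over_itself.point_dd_add vector_space_over_itself.point_dd_linear_factor)
  finally have eq: "scalar_dd A (\<lambda>x. x - c) = scalar_dd (A - {u}) (\<lambda>_. 1) + scalar_dd A (\<lambda>_. u - c)" .
  show "abs_value (scalar_dd A (\<lambda>x. x - c)) * r ^ card A \<le> \<delta> * r"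
  proof (cases "A = {u}")
    case True
    then show ?thesis using assms A by (simp add: mult_right_mono)
  next
    case False
    then have "scalar_dd A (\<lambda>_. u - c) = 0" "card A \<noteq> 1"
      using A u by (auto simp: vector_space_over_itself.point_dd_const card_1_singleton_iff)
    moreover have "scalar_dd (A - {u}) (\<lambda>_. 1) = (if card A = 2 then 1 else 0)"
      using A u False by (subst vector_space_over_itself.point_dd_const) (auto simp: card_Diff_singleton)
    ultimately show ?thesis using eq assms by (auto simp: power2_eq_square mult_right_mono)
  qed
qed

text \<open>Horner's scheme combined with submultiplicativity of the bounds.\<close>

lemma dd_bounded_poly:
  assumes "0 < r" "\<And>x. x \<in> B \<Longrightarrow> abs_value x \<le> R"
  shows "\<exists>\<delta>\<ge>0. dd_bounded B r \<delta> (poly p)"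
proof (induction p)
  case 0
  then show ?case using assms(1) dd_bounded_const[of 0 0 r B] by (auto intro!: exI[of _ 0])
next
  case (pCons b p)
  then obtain \<delta> where \<delta>: "\<delta> \<ge> 0" "dd_bounded B r \<delta> (poly p)" by blast
  have "dd_bounded B r (max r R) (\<lambda>x. x - 0)"
    by (rule dd_bounded_linear) (use assms in \<open>auto simp: le_max_iff_disj\<close>)
  from dd_bounded_mult[OF assms(1) this \<delta>(2) _ \<delta>(1)] assms(1)
  have "dd_bounded B r (max r R * \<delta>) (\<lambda>x. x * poly p x)" by (auto simp: le_max_iff_disj)
  from dd_bounded_add[OF dd_bounded_mono[OF this, of "max (abs_value b) (max r R * \<delta>)"]
      dd_bounded_const[of b "max (abs_value b) (max r R * \<delta>)"]]
  have "dd_bounded B r (max (abs_value b) (max r R * \<delta>)) (\<lambda>x. x * poly p x + b)"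
    using assms(1) by simp
  moreover have "poly (pCons b p) = (\<lambda>x. x * poly p x + b)" by (simp add: fun_eq_iff)
  ultimately have "dd_bounded B r (max (abs_value b) (max r R * \<delta>)) (poly (pCons b p))" by metis
  moreover have "0 \<le> max (abs_value b) (max r R * \<delta>)" by (simp add: le_max_iff_disj)
  ultimately show ?case by blast
qed

lemma abs_value_cball:
  fixes c :: "'k::ultrametric_field"
  assumes "x \<in> cball c r" shows "abs_value x \<le> max (abs_value c) r"
proof -
  have "abs_value (x - c) \<le> r" using assms by (simp add: dist_abs_value abs_value_minus_commute)
  then show ?thesis using abs_value_ultrametric[of c "x - c"] by auto
qed

lemma poly_mult_fun: "poly (p * q) = (\<lambda>x. poly p x * poly q x)"
  by (simp add: fun_eq_iff)

text \<open>The substitution \<open>q \<mapsto> q\<^sup>2 (3 - 2 q)\<close> squares both the distance to \<open>0\<close> and the distance to \<open>1\<close>.\<close>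

lemma sharpen_idempotent:
  fixes q :: "'k::ultrametric_field poly"
  assumes r: "0 < r" and \<theta>: "0 \<le> \<theta>" "\<theta> < 1" and \<epsilon>: "0 < \<epsilon>"
    and q: "dd_bounded B0 r \<theta> (poly (1 - q))" "dd_bounded B1 r \<theta> (poly q)"
      "\<And>B. B \<in> \<B> \<Longrightarrow> dd_bounded B r 1 (poly q)"
  shows "\<exists>p. dd_bounded B0 r \<epsilon> (poly (1 - p)) \<and> dd_bounded B1 r \<epsilon> (poly p) \<and>
    (\<forall>B\<in>\<B>. dd_bounded B r 1 (poly p))"
proof -
  have step: "\<exists>p. dd_bounded B0 r (\<theta> ^ Suc m) (poly (1 - p)) \<and> dd_bounded B1 r (\<theta> ^ Suc m) (poly p) \<and>
    (\<forall>B\<in>\<B>. dd_bounded B r 1 (poly p))" for m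
  proof (induction m)
    case 0
    show ?case using q by (simp only: power_Suc0_right) blast
  next
    case (Suc m)
    then obtain p where p: "dd_bounded B0 r (\<theta> ^ Suc m) (poly (1 - p))"
      "dd_bounded B1 r (\<theta> ^ Suc m) (poly p)" "\<forall>B\<in>\<B>. dd_bounded B r 1 (poly p)" by blast
    have const: "dd_bounded B r 1 (\<lambda>_. b)" if "abs_value b \<le> 1" for B and b :: 'k
      using that r by (intro dd_bounded_const) auto
    have le1: "\<theta> ^ Suc m \<le> 1" "0 \<le> \<theta> ^ Suc m" using \<theta> by (auto simp del: power_Suc intro: power_le_one)
    \<comment> \<open>Squaring even doubles the exponent, but one further power per round
      suffices.\<close>
    have small: "\<theta> ^ Suc m * \<theta> ^ Suc m \<le> \<theta> ^ Suc (Suc m)"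
      using \<theta> power_decreasing[of "Suc (Suc m)" "Suc m + Suc m" \<theta>] by (simp only: power_add [symmetric])
    \<comment> \<open>With \<open>b = 3\<close> the last factor is \<open>3 - 2 v\<close>. It is
      bounded by 1 because integers lie in the unit ball.\<close>
    have sq: "dd_bounded B r (\<delta> * \<delta> * 1) (\<lambda>x. poly w x * poly w x * (b - (b - 1) * poly v x))"
      if "dd_bounded B r \<delta> (poly w)" "dd_bounded B r 1 (poly v)" "0 \<le> \<delta>" "abs_value b \<le> 1" "abs_value (b - 1) \<le> 1"
      for B \<delta> w v and b :: 'k
    proof (rule dd_bounded_mult[OF r dd_bounded_mult[OF r that(1) that(1) that(3,3)]])
      have "dd_bounded B r (1 * 1) (\<lambda>x. (b - 1) * poly v x)"
        by (rule dd_bounded_mult[OF r const[OF that(5)] that(2)]) auto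
      then show "dd_bounded B r 1 (\<lambda>x. b - (b - 1) * poly v x)"
        using r by (intro dd_bounded_diff const that) auto
    qed (use that in auto)
    have b: "abs_value (3::'k) \<le> 1" "abs_value (3 - 1 :: 'k) \<le> 1"
      using abs_value_numeral_le_1[of "Num.num.Bit1 num.One", where 'k = 'k]
        abs_value_numeral_le_1[of "Num.num.Bit0 num.One", where 'k = 'k] by auto
    define p' where "p' = p * p * (3 - 2 * p)"
    have p': "poly p' = (\<lambda>x. poly p x * poly p x * (3 - (3 - 1) * poly p x))"
      by (simp add: p'_def fun_eq_iff)
    \<comment> \<open>The substitution commutes with exchanging \<open>p\<close> and
      \<open>1 - p\<close>, so one estimate serves both balls.\<close>
    have p'1: "poly (1 - p') = (\<lambda>x. poly (1 - p) x * poly (1 - p) x * (3 - (3 - 1) * poly (1 - p) x))"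
      by (simp add: p'_def fun_eq_iff) (simp add: algebra_simps)
    have "dd_bounded B0 r (\<theta> ^ Suc (Suc m)) (poly (1 - p'))"
      using dd_bounded_mono[OF sq[OF p(1) dd_bounded_mono[OF p(1) le1(1)] le1(2) b]] small r p'1 by simp
    moreover have "dd_bounded B1 r (\<theta> ^ Suc (Suc m)) (poly p')"
      using dd_bounded_mono[OF sq[OF p(2) dd_bounded_mono[OF p(2) le1(1)] le1(2) b]] small r p' by simp
    moreover have "\<forall>B\<in>\<B>. dd_bounded B r 1 (poly p')"
      using sq[of _ 1 p p 3] p(3) b p' by simp
    ultimately show ?case by blast
  qed
  obtain m where "\<theta> ^ m < \<epsilon>" using real_arch_pow_inv[OF \<epsilon> \<theta>(2)] by blast
  then have "\<theta> ^ Suc m \<le> \<epsilon>" using \<theta> power_decreasing[of m "Suc m" \<theta>] by linarith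
  with step[of m] show ?thesis using dd_bounded_mono r by (metis less_imp_le)
qed

text \<open>The Kaplansky argument: adding the centres in order of increasing distance from \<open>b\<close>, the linear
  factor \<open>(c - x) / (c - b)\<close> that separates \<open>b\<close> from the new centre \<open>c\<close> is bounded by \<open>1\<close> near all
  earlier centres.\<close>

lemma ex_poly_near_indicator:
  fixes b :: "'k::ultrametric_field"
  assumes r: "0 < r" and "finite C" "\<And>c. c \<in> C \<Longrightarrow> r < dist b c" and \<delta>: "0 < \<delta>" "\<delta> \<le> 1"
  shows "\<exists>p. dd_bounded (cball b r) r \<delta> (poly (1 - p)) \<and> (\<forall>c\<in>C. dd_bounded (cball c r) r \<delta> (poly p))"
  using assms(2,3)
proof (induction C rule: finite_ranking_induct[where f = "dist b"])
  case empty
  have "dd_bounded (cball b r) r \<delta> (\<lambda>_. 0)" using r \<delta> by (intro dd_bounded_const) auto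
  moreover have "poly (1 - 1) = (\<lambda>_::'k. 0)" by (simp add: fun_eq_iff)
  ultimately have "dd_bounded (cball b r) r \<delta> (poly (1 - 1))" by metis
  then show ?case by blast
next
  case (insert c C)
  then obtain p where p: "dd_bounded (cball b r) r \<delta> (poly (1 - p))"
    "\<forall>c\<in>C. dd_bounded (cball c r) r \<delta> (poly p)" by blast
  let ?d = "dist b c"
  have d: "r < ?d" "c - b \<noteq> 0" using insert.prems[of c] r by auto
  \<comment> \<open>The linear polynomial with value 1 at \<open>b\<close> and 0 at
    \<open>c\<close>. On the balls around these two points its error is at most
    \<open>r / dist b c\<close>, which is less than 1, so it can be sharpened.\<close>
  define q where "q = smult (1 / (c - b)) [:c, -1:]"
  have absd: "abs_value (1 / (c - b)) = 1 / ?d"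
    by (simp add: abs_value_divide dist_abs_value abs_value_minus_commute)
  have lin: "dd_bounded B r (s / ?d) (\<lambda>x. 1 / (c - b) * (x - e))"
    if "r \<le> s" "\<And>x. x \<in> B \<Longrightarrow> abs_value (x - e) \<le> s" for B s and e :: 'k
  proof -
    have "dd_bounded B r (1 / ?d * s) (\<lambda>x. 1 / (c - b) * (x - e))"
      using r that d by (intro dd_bounded_mult dd_bounded_const dd_bounded_linear) (auto simp: absd)
    then show ?thesis by simp
  qed
  have q: "poly (1 - q) = (\<lambda>x. 1 / (c - b) * (x - b))" "poly q = (\<lambda>x. 0 - 1 / (c - b) * (x - c))"
  proof -
    define a where "a = 1 / (c - b)"
    have "a * (c - b) = 1" using d(2) by (simp add: a_def)
    then have "a * c - a * b = 1" by (simp only: right_diff_distrib)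
    then show "poly (1 - q) = (\<lambda>x. 1 / (c - b) * (x - b))" "poly q = (\<lambda>x. 0 - 1 / (c - b) * (x - c))"
      unfolding q_def a_def [symmetric] by (auto simp: fun_eq_iff algebra_simps)
  qed
  have q': "dd_bounded B r s (poly q)" if "dd_bounded B r s (\<lambda>x. 1 / (c - b) * (x - c))" "0 \<le> s" for B s
    unfolding q(2) using that r by (intro dd_bounded_diff dd_bounded_const) auto
  have "dd_bounded (cball b r) r (r / ?d) (poly (1 - q))"
    unfolding q by (rule lin) (auto simp: dist_abs_value abs_value_minus_commute)
  moreover have "dd_bounded (cball c r) r (r / ?d) (poly q)"
    using r by (intro q' lin) (auto simp: dist_abs_value abs_value_minus_commute)
  moreover have "dd_bounded B r 1 (poly q)" if B: "B \<in> (\<lambda>e. cball e r) ` insert b C" for B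
  proof -
    obtain e where e: "B = cball e r" "e \<in> insert b C" using B by blast
    have "dist b e \<le> ?d" using e(2) insert.hyps(2) by auto
    then have "abs_value (x - c) \<le> ?d" if "x \<in> B" for x
    proof -
      have "dist x e \<le> ?d" using that e d by (auto simp: dist_commute)
      then have "dist x b \<le> ?d" using \<open>dist b e \<le> ?d\<close> dist_ultrametric_le[of x e ?d b] by (simp add: dist_commute)
      then show ?thesis using dist_ultrametric_le[of x b ?d c] by (simp add: dist_abs_value)
    qed
    then have "dd_bounded B r (?d / ?d) (\<lambda>x. 1 / (c - b) * (x - c))" using d by (intro lin) auto
    then show ?thesis using d r by (intro q') auto
  qed
  \<comment> \<open>Near the new centre nothing is known about \<open>p\<close> except some bound
    \<open>M\<close>; the new factor \<open>w\<close> has to be small enough there to compensate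
    it.\<close>
  moreover obtain M where M: "M \<ge> 0" "dd_bounded (cball c r) r M (poly p)"
    using dd_bounded_poly[OF r abs_value_cball] by blast
  moreover define \<epsilon> where "\<epsilon> = \<delta> / (M + 1)"
  moreover have \<epsilon>: "0 < \<epsilon>" "M * \<epsilon> \<le> \<delta>" "\<epsilon> \<le> \<delta>"
    using M(1) \<delta> by (auto simp: \<epsilon>_def field_simps)
  ultimately obtain w where w: "dd_bounded (cball b r) r \<epsilon> (poly (1 - w))" "dd_bounded (cball c r) r \<epsilon> (poly w)"
    "\<And>e. e \<in> insert b C \<Longrightarrow> dd_bounded (cball e r) r 1 (poly w)"
    using sharpen_idempotent[OF r, of "r / ?d" \<epsilon> "cball b r" q "cball c r" "(\<lambda>e. cball e r) ` insert b C"] d r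
    by (auto simp: divide_less_eq)
  \<comment> \<open>The decomposition \<open>1 - p w = (1 - p) w + (1 - w)\<close> uses only the
    bound 1 for \<open>w\<close>, so the precision near \<open>b\<close> does not
    deteriorate.\<close>
  have "dd_bounded (cball b r) r \<delta> (\<lambda>x. poly (1 - p) x * poly w x + poly (1 - w) x)"
  proof (rule dd_bounded_add[OF _ dd_bounded_mono[OF w(1) \<epsilon>(3)]])
    show "dd_bounded (cball b r) r \<delta> (\<lambda>x. poly (1 - p) x * poly w x)"
      using dd_bounded_mult[OF r p(1) w(3)[OF insertI1]] \<delta>(1) by simp
  qed (use r in auto)
  moreover have "(\<lambda>x. poly (1 - p) x * poly w x + poly (1 - w) x) = poly (1 - p * w)"
    by (auto simp: algebra_simps)
  moreover have "dd_bounded (cball e r) r \<delta> (poly (p * w))" if "e \<in> C" for e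
    unfolding poly_mult_fun using dd_bounded_mult[OF r bspec[OF p(2) that] w(3)] \<delta> that by simp
  moreover have "dd_bounded (cball c r) r \<delta> (poly (p * w))"
    unfolding poly_mult_fun using dd_bounded_mono[OF dd_bounded_mult[OF r M(2) w(2)] \<epsilon>(2)] M(1) \<epsilon>(1) r by simp
  ultimately show ?case by (metis insertE)
qed

section \<open>Approximation and bounds near compact sets in one variable\<close>

definition near :: "'a::metric_space set \<Rightarrow> real \<Rightarrow> 'a set" where
  "near K \<epsilon> = {x. \<exists>k\<in>K. dist x k < \<epsilon>}"

lemma near_mono: "\<lbrakk>K \<subseteq> K'; \<epsilon> \<le> \<epsilon>'\<rbrakk> \<Longrightarrow> near K \<epsilon> \<subseteq> near K' \<epsilon>'"
  unfolding near_def by force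

lemma near_subset_cballs:
  fixes \<Lambda> :: "'k::ultrametric_field set"
  assumes "\<Lambda> \<subseteq> (\<Union>c\<in>C. cball c r)" "\<epsilon> \<le> r"
  shows "near \<Lambda> \<epsilon> \<subseteq> (\<Union>c\<in>C. cball c r)"
proof
  fix x assume "x \<in> near \<Lambda> \<epsilon>"
  then obtain k where k: "k \<in> \<Lambda>" "dist k x \<le> r"
    using assms(2) by (auto simp: near_def dist_commute)
  then obtain c where "c \<in> C" "dist c k \<le> r" using assms(1) by auto
  then show "x \<in> (\<Union>c\<in>C. cball c r)" using dist_ultrametric_le[of c k r x] k(2) by auto
qed

lemma compact_abs_value_bounded:
  fixes \<Lambda> :: "'k::ultrametric_field set"
  assumes "compact \<Lambda>"
  obtains R where "0 \<le> R" "\<And>x. x \<in> \<Lambda> \<Longrightarrow> abs_value x \<le> R"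
proof -
  obtain R where "\<And>x. x \<in> \<Lambda> \<Longrightarrow> dist 0 x \<le> R"
    using compact_imp_bounded[OF assms] by (auto simp: bounded_any_center[of _ 0])
  then show ?thesis using that[of "max 0 R"] by (force simp: dist_abs_value)
qed

text \<open>The one-variable case of \<open>mdd_glue_boxes\<close>, with a single coordinate
  \<open>()\<close> and with a ball of the field itself as submodule. The factors of \<pi> there are
  exactly the weights in \<open>dd_bounded\<close>, so the same \<delta> comes out.\<close>

lemma scalar_dd_glue:
  fixes w :: "'k::ultrametric_field \<Rightarrow> 'k" and \<pi> :: 'k
  assumes C: "finite C" "\<And>c d. \<lbrakk>c \<in> C; d \<in> C; c \<noteq> d\<rbrakk> \<Longrightarrow> abs_value \<pi> < dist c d" and "\<pi> \<noteq> 0"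
    and w: "\<And>c. c \<in> C \<Longrightarrow> dd_bounded (cball c (abs_value \<pi>)) (abs_value \<pi>) \<delta> w" and "0 \<le> \<delta>"
  shows "dd_bounded (\<Union>c\<in>C. cball c (abs_value \<pi>)) (abs_value \<pi>) \<delta> w"
  unfolding dd_bounded_def
proof (intro allI impI)
  let ?r = "abs_value \<pi>"
  fix A assume A: "finite A" "A \<noteq> {}" "A \<subseteq> (\<Union>c\<in>C. cball c ?r)"
  interpret K: ultrametric_vector_space "(*) :: 'k \<Rightarrow> 'k \<Rightarrow> 'k" by (rule ultrametric_vector_space_mult)
  have single: "mdd (*) {()} S f x = scalar_dd (S ()) (\<lambda>t. f (\<lambda>_. t))" for S f and x :: "unit \<Rightarrow> 'k"
    by (simp add: vector_space_over_itself.mdd_insert fun_upd_def)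
  let ?Q = "{x::'k. abs_value x \<le> \<delta> * ?r}"
  have Q: "unit_ball_submodule (*) ?Q"
    unfolding unit_ball_submodule_def
    using assms(3,5)
    by (auto simp: abs_value_mult intro: order_trans[OF mult_left_le_one_le] order_trans[OF abs_value_ultrametric])
  have "\<pi> ^ (\<Sum>i\<in>{()}. card A) * mdd (*) {()} (\<lambda>_. A)
      (\<lambda>y. \<Sum>c\<in>Pi\<^sub>E {()} (\<lambda>_. C). if \<forall>i\<in>{()}. y i \<in> cball (c i) ?r then w (y ()) else 0) (\<lambda>_. 0) \<in> ?Q"
  proof (rule K.mdd_glue_boxes[OF _ Q])
    fix c :: "unit \<Rightarrow> 'k" and S'
    assume c: "c \<in> Pi\<^sub>E {()} (\<lambda>_. C)"
      and "\<And>i. i \<in> {()} \<Longrightarrow> S' i \<subseteq> A \<inter> cball (c i) ?r \<and> S' i \<noteq> {}"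
    then have S': "S' () \<subseteq> A" "S' () \<subseteq> cball (c ()) ?r" "S' () \<noteq> {}" and "c () \<in> C" by auto
    from dd_boundedD[OF w[OF \<open>c () \<in> C\<close>] finite_subset[OF S'(1) A(1)] S'(3,2)]
    show "\<pi> ^ (\<Sum>i\<in>{()}. card (S' i)) * mdd (*) {()} S' (\<lambda>y. w (y ())) (\<lambda>_. 0) \<in> ?Q"
      by (simp add: single abs_value_mult abs_value_power mult.commute)
  qed (use C A in auto)
  also have "mdd (*) {()} (\<lambda>_. A)
      (\<lambda>y. \<Sum>c\<in>Pi\<^sub>E {()} (\<lambda>_. C). if \<forall>i\<in>{()}. y i \<in> cball (c i) ?r then w (y ()) else 0) (\<lambda>_. 0) =
      mdd (*) {()} (\<lambda>_. A) (\<lambda>y. w (y ())) (\<lambda>_. 0)"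
  proof (rule vector_space_over_itself.mdd_cong[OF refl])
    fix y :: "unit \<Rightarrow> 'k" assume y: "\<And>i. i \<in> {()} \<Longrightarrow> y i \<in> A"
    have "y i \<in> (\<Union>c\<in>C. cball c ?r)" for i using subsetD[OF A(3) y[of i]] by simp
    then show "(\<Sum>c\<in>Pi\<^sub>E {()} (\<lambda>_. C). if \<forall>i\<in>{()}. y i \<in> cball (c i) ?r then w (y ()) else 0) = w (y ())"
      by (intro K.sum_boxes_eq C) simp_all
  qed
  finally show "abs_value (scalar_dd A w) * ?r ^ card A \<le> \<delta> * ?r"
    by (simp add: single abs_value_mult abs_value_power mult.commute)
qed

text \<open>On a separated cover \<open>u\<close> is a sum of polynomials cut off to balls, and each
  cut-off is replaced by multiplication with a polynomial close to the indicator function. Gluing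
  takes care of nodes lying in different balls.\<close>

lemma uniformly_locally_polynomial_approx:
  fixes u :: "'k::ultrametric_field \<Rightarrow> 'k"
  assumes "uniformly_locally_polynomial u" "compact \<Lambda>" "0 < \<delta>"
  obtains p \<epsilon> where "0 < \<epsilon>" "\<And>A. \<lbrakk>finite A; A \<noteq> {}; card A \<le> N; A \<subseteq> near \<Lambda> \<epsilon>\<rbrakk> \<Longrightarrow>
    abs_value (scalar_dd A (\<lambda>x. u x - poly p x)) \<le> \<delta>"
proof -
  obtain r where r: "r > 0" "\<And>c. \<exists>p. \<forall>x\<in>cball c r. u x = poly p x"
    using assms(1) unfolding uniformly_locally_polynomial_def by metis
  then obtain P where P: "\<And>c x. x \<in> cball c r \<Longrightarrow> u x = poly (P c) x" by metis
  obtain \<pi> :: 'k where \<pi>: "\<pi> \<noteq> 0" "abs_value \<pi> < min r 1" using r(1) by (rule_tac ex_small_scalar[of "min r 1"]) auto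
  let ?\<rho> = "abs_value \<pi>"
  have \<rho>: "0 < ?\<rho>" "?\<rho> \<le> 1" "?\<rho> \<le> r" using \<pi> by auto
  obtain C where C: "finite C" "C \<subseteq> \<Lambda>" "\<Lambda> \<subseteq> (\<Union>c\<in>C. cball c ?\<rho>)"
    "\<And>c d. \<lbrakk>c \<in> C; d \<in> C; c \<noteq> d\<rbrakk> \<Longrightarrow> ?\<rho> < dist c d"
    using compact_separated_cover[OF assms(2) \<rho>(1)] by blast
  obtain R where R: "\<And>x. x \<in> \<Lambda> \<Longrightarrow> abs_value x \<le> R" using compact_abs_value_bounded[OF assms(2)] by blast
  let ?B = "\<Union>c\<in>C. cball c ?\<rho>"
  have "abs_value x \<le> max R ?\<rho>" if "x \<in> ?B" for x
  proof -
    obtain c where c: "c \<in> C" "x \<in> cball c ?\<rho>" using \<open>x \<in> ?B\<close> by blast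
    then show ?thesis using abs_value_cball[OF c(2)] R[of c] C(2) by auto
  qed
  then have "\<exists>m\<ge>0. dd_bounded ?B ?\<rho> m (poly p)" for p
    by (rule dd_bounded_poly[OF \<rho>(1)])
  then obtain m where m: "\<And>p. m p \<ge> 0" "\<And>p. dd_bounded ?B ?\<rho> (m p) (poly p)" by metis
  define M where "M = 1 + (\<Sum>d\<in>C. m (P d))"
  have M: "1 \<le> M" using m(1) by (simp add: M_def sum_nonneg)
  have bM: "dd_bounded (cball c ?\<rho>) ?\<rho> M (poly (P d))" if "c \<in> C" "d \<in> C" for c d
  proof -
    have "m (P d) \<le> M" using member_le_sum[of d C "\<lambda>d. m (P d)"] m(1) C(1) that by (simp add: M_def)
    then have "dd_bounded ?B ?\<rho> M (poly (P d))" using dd_bounded_mono[OF m(2)] by simp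
    then show ?thesis by (rule dd_bounded_subset) (use that in auto)
  qed
  \<comment> \<open>\<open>M\<close> absorbs the polynomial pieces, and \<open>?\<rho> ^ N\<close>
    turns the weighted bound into an unweighted one for up to \<open>N\<close> nodes.\<close>
  define \<delta>1 where "\<delta>1 = min 1 (\<delta> * ?\<rho> ^ N / M)"
  have \<delta>1: "0 < \<delta>1" "\<delta>1 \<le> 1" "\<delta>1 * M \<le> \<delta> * ?\<rho> ^ N"
    using assms(3) \<rho>(1) M by (auto simp: \<delta>1_def min_def field_simps)
  have "\<exists>p. dd_bounded (cball c ?\<rho>) ?\<rho> \<delta>1 (poly (1 - p)) \<and>
      (\<forall>d\<in>C - {c}. dd_bounded (cball d ?\<rho>) ?\<rho> \<delta>1 (poly p))" if "c \<in> C" for c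
    using that C by (intro ex_poly_near_indicator \<rho> \<delta>1) auto
  then obtain \<kappa> where \<kappa>: "\<And>c. c \<in> C \<Longrightarrow> dd_bounded (cball c ?\<rho>) ?\<rho> \<delta>1 (poly (1 - \<kappa> c))"
    "\<And>c d. \<lbrakk>c \<in> C; d \<in> C; d \<noteq> c\<rbrakk> \<Longrightarrow> dd_bounded (cball d ?\<rho>) ?\<rho> \<delta>1 (poly (\<kappa> c))" by (metis DiffI singletonD)
  define v where "v = (\<Sum>c\<in>C. \<kappa> c * P c)"
  \<comment> \<open>On the ball around \<open>c\<close> the factor \<open>\<kappa> c\<close> nearly
    preserves the right piece, and all other pieces are nearly annihilated.\<close>
  have "dd_bounded (cball c ?\<rho>) ?\<rho> (\<delta>1 * M) (\<lambda>x. u x - poly v x)" if c: "c \<in> C" for c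
  proof (rule dd_bounded_cong)
    show "dd_bounded (cball c ?\<rho>) ?\<rho> (\<delta>1 * M)
        (\<lambda>x. poly (1 - \<kappa> c) x * poly (P c) x - (\<Sum>d\<in>C - {c}. poly (\<kappa> d) x * poly (P d) x))"
      using \<rho>(1) \<delta>1(1) M c \<kappa> bM
      by (intro dd_bounded_diff dd_bounded_sum dd_bounded_mult) (auto simp del: poly_diff)
    fix x assume "x \<in> cball c ?\<rho>"
    then have "u x = poly (P c) x" using P[of x c] \<rho>(3) by auto
    moreover have "poly v x = poly (\<kappa> c) x * poly (P c) x + (\<Sum>d\<in>C - {c}. poly (\<kappa> d) x * poly (P d) x)"
      using C(1) c by (simp add: v_def poly_sum sum.remove[of C c])
    ultimately show "u x - poly v x = poly (1 - \<kappa> c) x * poly (P c) x -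
        (\<Sum>d\<in>C - {c}. poly (\<kappa> d) x * poly (P d) x)" by (simp add: algebra_simps)
  qed
  then have glue: "dd_bounded ?B ?\<rho> (\<delta>1 * M) (\<lambda>x. u x - poly v x)"
    using C(1,4) \<pi>(1) \<delta>1(1) M by (intro scalar_dd_glue) auto
  show ?thesis
  proof (rule that[OF \<rho>(1)])
    fix A assume A: "finite A" "A \<noteq> {}" "card A \<le> N" "A \<subseteq> near \<Lambda> ?\<rho>"
    let ?d = "abs_value (scalar_dd A (\<lambda>x. u x - poly v x))"
    have "A \<subseteq> ?B" using A(4) near_subset_cballs[OF C(3) order_refl] by blast
    then have "?d * ?\<rho> ^ card A \<le> \<delta>1 * M * ?\<rho>" using dd_boundedD[OF glue] A by blast
    moreover have "?d * ?\<rho> ^ N \<le> ?d * ?\<rho> ^ card A"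
      using A(3) \<rho> by (intro mult_left_mono power_decreasing) auto
    moreover have "\<delta>1 * M * ?\<rho> \<le> \<delta>1 * M" using \<rho> \<delta>1(1) M by (intro mult_left_le) auto
    ultimately have "?d * ?\<rho> ^ N \<le> \<delta> * ?\<rho> ^ N" using \<delta>1(3) by linarith
    then show "?d \<le> \<delta>" using \<rho>(1) by simp
  qed
qed

text \<open>Nodes may lie in different balls, so the bound cannot be read off from the pieces of
  \<open>u\<close>. It is obtained by comparison with an approximating polynomial, whose differences
  are bounded on bounded sets.\<close>

lemma uniformly_locally_polynomial_bounded:
  fixes u :: "'k::ultrametric_field \<Rightarrow> 'k"
  assumes "uniformly_locally_polynomial u" "compact \<Lambda>"
  obtains M \<epsilon> where "0 < \<epsilon>" "1 \<le> M" "\<And>A. \<lbrakk>finite A; A \<noteq> {}; card A \<le> N; A \<subseteq> near \<Lambda> \<epsilon>\<rbrakk> \<Longrightarrow>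
    abs_value (scalar_dd A u) \<le> M"
proof -
  obtain p \<epsilon> where p: "0 < \<epsilon>" "\<And>A. \<lbrakk>finite A; A \<noteq> {}; card A \<le> N; A \<subseteq> near \<Lambda> \<epsilon>\<rbrakk> \<Longrightarrow>
      abs_value (scalar_dd A (\<lambda>x. u x - poly p x)) \<le> 1"
    using uniformly_locally_polynomial_approx[OF assms, of 1 N] by (metis zero_less_one)
  obtain R where R: "\<And>x. x \<in> \<Lambda> \<Longrightarrow> abs_value x \<le> R" using compact_abs_value_bounded[OF assms(2)] by blast
  have "abs_value x \<le> max R \<epsilon>" if "x \<in> near \<Lambda> \<epsilon>" for x
  proof -
    obtain k where "k \<in> \<Lambda>" "dist x k < \<epsilon>" using \<open>x \<in> near \<Lambda> \<epsilon>\<close> by (auto simp: near_def)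
    then show ?thesis using abs_value_cball[of x k \<epsilon>] R[of k] by (auto simp: dist_commute)
  qed
  then obtain m where m: "dd_bounded (near \<Lambda> \<epsilon>) 1 m (poly p)"
    using dd_bounded_poly[of 1] by (metis zero_less_one)
  show ?thesis
  proof (rule that[OF p(1)])
    show "1 \<le> max 1 m" by simp
    fix A assume A: "finite A" "A \<noteq> {}" "card A \<le> N" "A \<subseteq> near \<Lambda> \<epsilon>"
    have "scalar_dd A u = scalar_dd A (\<lambda>x. u x - poly p x) + scalar_dd A (poly p)"
      by (simp add: vector_space_over_itself.point_dd_add [symmetric])
    then have "abs_value (scalar_dd A u) \<le>
        max (abs_value (scalar_dd A (\<lambda>x. u x - poly p x))) (abs_value (scalar_dd A (poly p)))"
      using abs_value_ultrametric by metis
    then show "abs_value (scalar_dd A u) \<le> max 1 m"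
      using p(2)[OF A] dd_boundedD[OF m A(1,2,4)] by (auto simp: max_def split: if_splits)
  qed
qed

lemma finite_ex_positive_lower_bound:
  assumes "finite Z" "\<And>z. z \<in> Z \<Longrightarrow> 0 < (e z :: real)"
  shows "\<exists>\<epsilon>>0. \<forall>z\<in>Z. \<epsilon> \<le> e z"
  using assms
proof (induction Z rule: finite_induct)
  case empty
  show ?case by (auto intro: exI[of _ 1])
next
  case (insert z Z)
  then obtain \<epsilon> where "\<epsilon> > 0" "\<forall>z\<in>Z. \<epsilon> \<le> e z" by auto
  with insert.prems[of z] show ?case by (intro exI[of _ "min \<epsilon> (e z)"]) auto
qed

text \<open>The bound is the absolute value of a scalar \<open>b\<close>, so that it can be traded
  for replacing a submodule by its preimage under multiplication by \<open>b\<close>.\<close>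

lemma uniformly_locally_polynomial_prod_bounded:
  fixes u :: "'i \<Rightarrow> 'k::ultrametric_field \<Rightarrow> 'k"
  assumes "finite J" "\<And>i. i \<in> J \<Longrightarrow> uniformly_locally_polynomial (u i)" "\<And>i. i \<in> J \<Longrightarrow> compact (K i)"
  shows "\<exists>b \<epsilon>. 0 < \<epsilon> \<and> (\<forall>S. (\<forall>i\<in>J. finite (S i) \<and> S i \<noteq> {} \<and> card (S i) \<le> N \<and> S i \<subseteq> near (K i) \<epsilon>) \<longrightarrow>
    abs_value (\<Prod>i\<in>J. scalar_dd (S i) (u i)) \<le> abs_value (b::'k))"
proof -
  have "\<exists>M \<epsilon>. 0 < \<epsilon> \<and> (\<forall>A. finite A \<longrightarrow> A \<noteq> {} \<longrightarrow> card A \<le> N \<longrightarrow> A \<subseteq> near (K i) \<epsilon> \<longrightarrow>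
      abs_value (scalar_dd A (u i)) \<le> M)" if "i \<in> J" for i
    by (rule uniformly_locally_polynomial_bounded[OF assms(2,3)[OF that], where N = N]) blast
  then obtain M e where e: "\<And>i. i \<in> J \<Longrightarrow> 0 < e i"
    and M: "\<And>i A. \<lbrakk>i \<in> J; finite A; A \<noteq> {}; card A \<le> N; A \<subseteq> near (K i) (e i)\<rbrakk> \<Longrightarrow>
      abs_value (scalar_dd A (u i)) \<le> M i"
    by metis
  obtain \<epsilon> where \<epsilon>: "\<epsilon> > 0" "\<forall>i\<in>J. \<epsilon> \<le> e i"
    using finite_ex_positive_lower_bound[OF assms(1), of e] e by blast
  obtain b :: 'k where b: "(\<Prod>i\<in>J. M i) < abs_value b" by (rule ex_large_scalar)
  have "abs_value (\<Prod>i\<in>J. scalar_dd (S i) (u i)) \<le> abs_value b"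
    if S: "\<forall>i\<in>J. finite (S i) \<and> S i \<noteq> {} \<and> card (S i) \<le> N \<and> S i \<subseteq> near (K i) \<epsilon>" for S
  proof -
    have "abs_value (scalar_dd (S i) (u i)) \<le> M i" if "i \<in> J" for i
    proof (rule M[OF that])
      show "S i \<subseteq> near (K i) (e i)" using S \<epsilon>(2) that near_mono[OF order_refl] by blast
    qed (use S that in auto)
    then have "abs_value (\<Prod>i\<in>J. scalar_dd (S i) (u i)) \<le> (\<Prod>i\<in>J. M i)"
      unfolding abs_value_prod by (intro prod_mono) auto
    with b show ?thesis by linarith
  qed
  with \<epsilon>(1) show ?thesis by blast
qed

section \<open>Composing differences in disjoint sets of coordinates\<close>

context vector_space
begin

lemma mdd_override:
  assumes "finite J" "finite I" "J \<inter> I = {}"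
  shows "mdd scale J T (mdd scale I S f) x = mdd scale (J \<union> I) (\<lambda>i. if i \<in> J then T i else S i) f x"
proof -
  have "mdd scale I S f y = mdd scale I (\<lambda>i. if i \<in> J then T i else S i) f y" for y
    by (rule mdd_cong) (use assms(3) in auto)
  then have "mdd scale J T (mdd scale I S f) x =
      mdd scale J (\<lambda>i. if i \<in> J then T i else S i) (mdd scale I (\<lambda>i. if i \<in> J then T i else S i) f) x"
    by (rule_tac mdd_cong) simp_all
  then show ?thesis using assms by (simp add: mdd_Un)
qed

lemma mdd_commute:
  assumes "finite J" "finite I" "J \<inter> I = {}"
  shows "mdd scale J T (mdd scale I S f) x = mdd scale I S (mdd scale J T f) x"
proof -
  have "mdd scale (J \<union> I) (\<lambda>i. if i \<in> J then T i else S i) f x =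
      mdd scale (I \<union> J) (\<lambda>i. if i \<in> I then S i else T i) f x"
    unfolding Un_commute[of I J] by (rule mdd_cong) (use assms(3) in auto)
  then show ?thesis using assms by (simp add: mdd_override Int_commute)
qed


end

section \<open>Tensor products of uniformly locally polynomial functions\<close>

context ultrametric_vector_space
begin

text \<open>Finite sums of elementary tensors. The functions are defined on all tuples but depend
  only on the coordinates in \<open>I\<close>; adding one summand at a time provides the induction
  rule.\<close>

inductive_set locpoly_tensors :: "'i set \<Rightarrow> (('i \<Rightarrow> 'k) \<Rightarrow> 'e) set" for I where
  zero: "(\<lambda>_. 0) \<in> locpoly_tensors I"
| add_tensor: "\<lbrakk>\<And>i. i \<in> I \<Longrightarrow> uniformly_locally_polynomial (u i); t \<in> locpoly_tensors I\<rbrakk> \<Longrightarrow>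
    (\<lambda>x. (\<Prod>i\<in>I. u i (x i)) \<odot> e + t x) \<in> locpoly_tensors I"

lemma locpoly_tensors_add:
  assumes "s \<in> locpoly_tensors I" "t \<in> locpoly_tensors I"
  shows "(\<lambda>x. s x + t x) \<in> locpoly_tensors I"
  using assms(1)
proof induction
  case zero
  then show ?case using assms(2) by simp
next
  case (add_tensor u s e)
  from locpoly_tensors.add_tensor[of I u, OF add_tensor.hyps(1) add_tensor.IH, of e]
  show ?case by (simp add: add.assoc)
qed

lemma locpoly_tensors_sum:
  "(\<And>z. z \<in> Z \<Longrightarrow> t z \<in> locpoly_tensors I) \<Longrightarrow> (\<lambda>x. \<Sum>z\<in>Z. t z x) \<in> locpoly_tensors I"
  by (induction Z rule: infinite_finite_induct)
    (auto intro: locpoly_tensors.zero locpoly_tensors_add)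

text \<open>The two families of factors are joined into one. This attaches the factors of one block
  to a tensor in the remaining blocks.\<close>

lemma locpoly_tensors_mult:
  assumes "finite J" "finite I" "J \<inter> I = {}" "\<And>i. i \<in> J \<Longrightarrow> uniformly_locally_polynomial (u i)"
    and "t \<in> locpoly_tensors I"
  shows "(\<lambda>x. (\<Prod>i\<in>J. u i (x i)) \<odot> t x) \<in> locpoly_tensors (J \<union> I)"
  using assms(5)
proof induction
  case zero
  show ?case by (simp add: locpoly_tensors.zero)
next
  case (add_tensor v t e)
  let ?w = "\<lambda>i. if i \<in> J then u i else v i"
  have w: "(\<Prod>i\<in>J \<union> I. ?w i (x i)) = (\<Prod>i\<in>J. u i (x i)) * (\<Prod>i\<in>I. v i (x i))" for x
  proof -
    have "(\<Prod>i\<in>I. ?w i (x i)) = (\<Prod>i\<in>I. v i (x i))" by (rule prod.cong) (use assms(3) in auto)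
    then show ?thesis using assms(1-3) by (simp add: prod.union_disjoint)
  qed
  have "(\<lambda>x. (\<Prod>i\<in>J \<union> I. ?w i (x i)) \<odot> e + (\<Prod>i\<in>J. u i (x i)) \<odot> t x) \<in> locpoly_tensors (J \<union> I)"
    by (rule locpoly_tensors.add_tensor) (use assms(4) add_tensor in auto)
  then show ?case by (simp add: w scale_right_distrib)
qed

lemma locpoly_tensors_mult_same:
  assumes "\<And>i. i \<in> I \<Longrightarrow> uniformly_locally_polynomial (u i)" "t \<in> locpoly_tensors I"
  shows "(\<lambda>x. (\<Prod>i\<in>I. u i (x i)) \<odot> t x) \<in> locpoly_tensors I"
  using assms(2)
proof induction
  case zero
  show ?case by (simp add: locpoly_tensors.zero)
next
  case (add_tensor v t e)
  have "(\<lambda>x. (\<Prod>i\<in>I. u i (x i) * v i (x i)) \<odot> e + (\<Prod>i\<in>I. u i (x i)) \<odot> t x) \<in> locpoly_tensors I"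
    by (rule locpoly_tensors.add_tensor) (use assms(1) add_tensor in \<open>auto intro: uniformly_locally_polynomial_mult\<close>)
  then show ?case by (simp add: prod.distrib scale_right_distrib)
qed

lemma locpoly_tensors_cong:
  assumes "t \<in> locpoly_tensors I" "\<And>i. i \<in> I \<Longrightarrow> x i = y i"
  shows "t x = t y"
  using assms(1) by induction (use assms(2) in auto)

end

section \<open>Uniform continuity of differences and interpolation in one block\<close>

context ultrametric_lcs
begin

lemma open_scale_vimage:
  assumes "open Q"
  shows "open {x. smul c x \<in> Q}"
proof -
  have "continuous_on UNIV (\<lambda>x. (\<lambda>(c, x). smul c x) (c, x))"
    by (rule continuous_on_compose2[OF continuous_smul]) (auto intro!: continuous_intros)
  then show ?thesis using open_vimage[OF assms] by (simp add: vimage_def)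
qed

text \<open>Only coordinates whose nodes change have to lie in a common \<open>\<epsilon>\<close>-ball; the others act as
  parameters. The predicate \<open>P\<close> bounds the orders.\<close>

definition dd_oscillation_within ::
  "'i set \<Rightarrow> ('i \<Rightarrow> 'k set) \<Rightarrow> (('i \<Rightarrow> 'k set) \<Rightarrow> bool) \<Rightarrow> (('i \<Rightarrow> 'k) \<Rightarrow> 'e) \<Rightarrow> ('i \<Rightarrow> 'k) \<Rightarrow>
    ('i \<Rightarrow> 'k set) \<Rightarrow> 'e set \<Rightarrow> real \<Rightarrow> bool" where
  "dd_oscillation_within I X P f x K Q \<epsilon> \<longleftrightarrow>
    (\<forall>S S'. (\<forall>i\<in>I. finite (S i) \<and> S i \<noteq> {} \<and> S i \<subseteq> X i \<inter> near (K i) \<epsilon> \<and>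
        finite (S' i) \<and> S' i \<subseteq> X i \<and> card (S' i) = card (S i) \<and>
        (S i = S' i \<or> (\<forall>s\<in>S i. \<forall>s'\<in>S' i. dist s s' < \<epsilon>))) \<longrightarrow>
      P S \<longrightarrow> mdd smul I S f x - mdd smul I S' f x \<in> Q)"

definition dd_uniformly_continuous ::
  "'i set \<Rightarrow> ('i \<Rightarrow> 'k set) \<Rightarrow> (('i \<Rightarrow> 'k set) \<Rightarrow> bool) \<Rightarrow> (('i \<Rightarrow> 'k) \<Rightarrow> 'e) \<Rightarrow> ('i \<Rightarrow> 'k) \<Rightarrow> bool" where
  "dd_uniformly_continuous I X P f x \<longleftrightarrow>
    (\<forall>K Q. (\<forall>i\<in>I. compact (K i) \<and> K i \<subseteq> X i) \<longrightarrow> unit_ball_submodule smul Q \<longrightarrow> open Q \<longrightarrow>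
      (\<exists>\<epsilon>>0. dd_oscillation_within I X P f x K Q \<epsilon>))"

lemma dd_uniformly_continuousD:
  assumes "dd_uniformly_continuous I X P f x" "\<forall>i\<in>I. compact (K i) \<and> K i \<subseteq> X i"
    "unit_ball_submodule smul Q" "open Q"
  shows "\<exists>\<epsilon>>0. dd_oscillation_within I X P f x K Q \<epsilon>"
  using assms(1)[unfolded dd_uniformly_continuous_def, THEN spec[of _ K], THEN spec[of _ Q]] assms(2-4)
  by (simp only: simp_thms)

text \<open>The balls are chosen smaller than the oscillation radius for \<open>Q\<close>, so
  piecewise Newton interpolation in the block \<open>J\<close> has its error in \<open>Q\<close>.
  Its coefficients are differences at the fixed nodes \<open>A z\<close>, and hence functions of the
  coordinates outside \<open>J\<close> only.\<close>

lemma block_newton_approximation: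
  fixes J I :: "'i set" and X K :: "'i \<Rightarrow> 'k set"
  assumes fin: "finite J" "finite I" "J \<inter> I = {}"
    and uc: "dd_uniformly_continuous (J \<union> I) X P f x"
    and P: "\<And>S S'. \<lbrakk>P S; \<And>i. i \<in> I \<Longrightarrow> S' i = S i; (\<Sum>i\<in>J. card (S' i)) \<le> a + card J\<rbrakk> \<Longrightarrow> P S'"
    and PJ: "\<And>S. P S \<Longrightarrow> (\<Sum>i\<in>J. card (S i)) \<le> a + card J"
    and X: "\<And>i c. i \<in> J \<Longrightarrow> \<not> c isolated_in X i"
    and K: "\<And>i. i \<in> J \<union> I \<Longrightarrow> compact (K i) \<and> K i \<subseteq> X i"
    and Q: "unit_ball_submodule smul Q" "open Q"
  shows "\<exists>(Z :: (('i \<Rightarrow> 'k) \<times> ('i \<Rightarrow> nat)) set) u A \<epsilon>. finite Z \<and> 0 < \<epsilon> \<and>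
    (\<forall>z\<in>Z. \<forall>i\<in>J. uniformly_locally_polynomial (u z i) \<and> finite (A z i) \<and> A z i \<noteq> {} \<and> A z i \<subseteq> X i) \<and>
    (\<forall>z\<in>Z. (\<Sum>i\<in>J. card (A z i)) \<le> a + card J) \<and>
    (\<forall>S. (\<forall>i\<in>J \<union> I. finite (S i) \<and> S i \<noteq> {} \<and> S i \<subseteq> X i \<inter> near (K i) \<epsilon>) \<longrightarrow> P S \<longrightarrow>
      mdd smul (J \<union> I) S (\<lambda>y. f y - (\<Sum>z\<in>Z. smul (\<Prod>i\<in>J. u z i (y i)) (mdd smul J (A z) f y))) x \<in> Q)"
proof -
  have K': "\<forall>i\<in>J \<union> I. compact (K i) \<and> K i \<subseteq> X i" by (simp add: K)
  obtain \<epsilon> where \<epsilon>: "\<epsilon> > 0" and osc: "dd_oscillation_within (J \<union> I) X P f x K Q \<epsilon>"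
    using dd_uniformly_continuousD[OF uc K' Q] by auto
  obtain \<pi> :: 'k where \<pi>: "\<pi> \<noteq> 0" "abs_value \<pi> < min \<epsilon> 1"
    by (rule ex_small_scalar[of "min \<epsilon> 1"]) (use \<epsilon> in auto)
  let ?r = "abs_value \<pi>"
  have r: "0 < ?r" "?r \<le> 1" "?r < \<epsilon>" using \<pi> by auto
  define separated_cover where "separated_cover i C \<longleftrightarrow> finite C \<and> C \<subseteq> K i \<and>
    K i \<subseteq> (\<Union>c\<in>C. cball c ?r) \<and> (\<forall>c\<in>C. \<forall>d\<in>C. c \<noteq> d \<longrightarrow> ?r < dist c d)" for i C
  have "\<exists>C. separated_cover i C" if i: "i \<in> J" for i
  proof -
    have "compact (K i)" using K i by blast
    from compact_separated_cover[OF this r(1)] show ?thesis unfolding separated_cover_def by metis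
  qed
  then obtain C where sep: "\<And>i. i \<in> J \<Longrightarrow> separated_cover i (C i)" by metis
  have C: "\<And>i. i \<in> J \<Longrightarrow> finite (C i)" "\<And>i. i \<in> J \<Longrightarrow> C i \<subseteq> K i"
    "\<And>i. i \<in> J \<Longrightarrow> K i \<subseteq> (\<Union>c\<in>C i. cball c ?r)"
    "\<And>i c d. \<lbrakk>i \<in> J; c \<in> C i; d \<in> C i; c \<noteq> d\<rbrakk> \<Longrightarrow> ?r < dist c d"
    using sep unfolding separated_cover_def by simp_all
  have "\<exists>z::nat \<Rightarrow> 'k. inj z \<and> range z \<subseteq> X i \<inter> cball c ?r" if i: "i \<in> J" "c \<in> C i" for i c
  proof -
    have "c \<in> X i" using C(2) K i by blast
    \<comment> \<open>A non-isolated point provides infinitely many interpolation nodes inside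
      \<open>X i\<close>, the set where the oscillation of the differences is controlled.\<close>
    then have "c islimpt X i" using X[OF i(1), of c] unfolding isolated_in_islimpt_iff by blast
    then have "infinite (X i \<inter> ball c ?r)" using r(1) by (simp add: islimpt_eq_infinite_ball)
    then obtain z :: "nat \<Rightarrow> 'k" where "inj z" "range z \<subseteq> X i \<inter> ball c ?r"
      using infinite_countable_subset by blast
    then show ?thesis using ball_subset_cball by blast
  qed
  then obtain z :: "'i \<Rightarrow> 'k \<Rightarrow> nat \<Rightarrow> 'k" where
    z: "\<And>i c. \<lbrakk>i \<in> J; c \<in> C i\<rbrakk> \<Longrightarrow> inj (z i c) \<and> range (z i c) \<subseteq> X i \<inter> cball c ?r" by metis
  define Z where "Z = Pi\<^sub>E J C \<times> multidegrees J a"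
  define u where "u w i t = (if t \<in> cball (fst w i) ?r then newton_basis (z i (fst w i)) (snd w i) t else 0)"
    for w :: "('i \<Rightarrow> 'k) \<times> ('i \<Rightarrow> nat)" and i t
  define A where "A w i = z i (fst w i) ` {..snd w i}" for w :: "('i \<Rightarrow> 'k) \<times> ('i \<Rightarrow> nat)" and i
  have Z: "finite Z" using C(1) fin by (auto simp: Z_def finite_multidegrees intro!: finite_PiE)
  have ulp: "uniformly_locally_polynomial (u w i)" for w i
    unfolding u_def newton_basis_eq_poly by (rule uniformly_locally_polynomial_cutoff[OF r(1)])
  have mem: "fst w i \<in> C i" if "w \<in> Z" "i \<in> J" for w i using that by (auto simp: Z_def)
  have cardA: "card (A w i) = Suc (snd w i)" if "w \<in> Z" "i \<in> J" for w i
  proof -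
    have "inj_on (z i (fst w i)) {..snd w i}" using z mem that by (meson inj_on_subset subset_UNIV)
    then show ?thesis by (simp add: A_def card_image)
  qed
  have ordA: "(\<Sum>i\<in>J. card (A w i)) \<le> a + card J" if "w \<in> Z" for w
  proof -
    have "(\<Sum>i\<in>J. card (A w i)) = (\<Sum>i\<in>J. snd w i) + card J"
      using cardA[OF that] by (simp only: sum_Suc [symmetric] cong: sum.cong)
    then show ?thesis using that by (auto simp: Z_def multidegrees_def)
  qed
  have A: "finite (A w i) \<and> A w i \<noteq> {} \<and> A w i \<subseteq> X i" if "w \<in> Z" "i \<in> J" for w i
    using z[OF that(2) mem[OF that]] by (auto simp: A_def)
  have main: "mdd smul (J \<union> I) S (\<lambda>y. f y - (\<Sum>w\<in>Z. smul (\<Prod>i\<in>J. u w i (y i)) (mdd smul J (A w) f y))) x \<in> Q"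
    if S: "\<forall>i\<in>J \<union> I. finite (S i) \<and> S i \<noteq> {} \<and> S i \<subseteq> X i \<inter> near (K i) ?r" and "P S" for S
  proof -
    \<comment> \<open>Differences in \<open>I\<close> commute with those in \<open>J\<close> and do
      not see the factors \<open>u\<close>. The one-block estimate is therefore applied to
      \<open>?g\<close>, in which the nodes \<open>S i\<close> with \<open>i\<close> in
      \<open>I\<close> are parameters.\<close>
    let ?g = "mdd smul I S f"
    have "mdd smul I S (\<lambda>y. smul (\<Prod>i\<in>J. u w i (y i)) (mdd smul J (A w) f y)) y =
        smul (\<Prod>i\<in>J. u w i (y i)) (mdd smul J (A w) ?g y)" for w y
    proof -
      have "mdd smul I S (\<lambda>y. smul (\<Prod>i\<in>J. u w i (y i)) (mdd smul J (A w) f y)) y =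
          mdd smul I S (\<lambda>y'. smul (\<Prod>i\<in>J. u w i (y i)) (mdd smul J (A w) f y')) y"
      proof (rule mdd_cong[OF refl])
        fix y' assume y': "\<And>i. i \<notin> I \<Longrightarrow> y' i = y i"
        have "(\<Prod>i\<in>J. u w i (y' i)) = (\<Prod>i\<in>J. u w i (y i))"
          by (rule prod.cong) (use y' fin(3) in \<open>simp_all add: disjoint_iff\<close>)
        then show "smul (\<Prod>i\<in>J. u w i (y' i)) (mdd smul J (A w) f y') =
          smul (\<Prod>i\<in>J. u w i (y i)) (mdd smul J (A w) f y')" by simp
      qed
      then show ?thesis using mdd_commute[OF fin] by (simp add: mdd_scale)
    qed
    then have inner: "mdd smul I S (\<lambda>y. f y - (\<Sum>w\<in>Z. smul (\<Prod>i\<in>J. u w i (y i)) (mdd smul J (A w) f y))) =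
        (\<lambda>y. ?g y - (\<Sum>w\<in>Z. smul (\<Prod>i\<in>J. u w i (y i)) (mdd smul J (A w) ?g y)))"
      by (simp add: mdd_diff mdd_sum fun_eq_iff)
    have "mdd smul J S (\<lambda>y. ?g y - (\<Sum>(c, \<beta>)\<in>Pi\<^sub>E J C \<times> multidegrees J a.
      smul (\<Prod>i\<in>J. if y i \<in> cball (c i) ?r then newton_basis (z i (c i)) (\<beta> i) (y i) else 0)
      (mdd smul J (\<lambda>i. z i (c i) ` {..\<beta> i}) ?g y))) x \<in> Q"
    proof (rule mdd_local_newton_error[OF fin(1) Q(1) \<pi>(1) r(2) C(1,4) z])
      show "(\<Sum>i\<in>J. card (S i)) \<le> a + card J" using PJ \<open>P S\<close> by blast
    next
      fix i assume i: "i \<in> J"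
      have "near (K i) ?r \<subseteq> (\<Union>c\<in>C i. cball c ?r)" using near_subset_cballs[OF C(3)[OF i]] by simp
      with S i show "finite (S i) \<and> S i \<noteq> {} \<and> S i \<subseteq> X i \<inter> (\<Union>c\<in>C i. cball c ?r)" by blast
    next
      fix c T T'
      assume c: "c \<in> Pi\<^sub>E J C"
        and T: "\<And>i. i \<in> J \<Longrightarrow> finite (T i) \<and> T i \<subseteq> X i \<inter> cball (c i) ?r \<and> T i \<noteq> {}"
        and T': "\<And>i. i \<in> J \<Longrightarrow> finite (T' i) \<and> T' i \<subseteq> X i \<inter> cball (c i) ?r \<and> card (T' i) = card (T i)"
        and sum: "(\<Sum>i\<in>J. card (T i)) = a + card J"
      show "mdd smul J T ?g x - mdd smul J T' ?g x \<in> Q"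
        unfolding mdd_override[OF fin]
      proof (rule osc[unfolded dd_oscillation_within_def, rule_format])
        fix i assume i: "i \<in> J \<union> I"
        let ?T = "if i \<in> J then T i else S i" and ?T' = "if i \<in> J then T' i else S i"
        show "finite ?T \<and> ?T \<noteq> {} \<and> ?T \<subseteq> X i \<inter> near (K i) \<epsilon> \<and> finite ?T' \<and> ?T' \<subseteq> X i \<and>
          card ?T' = card ?T \<and> (?T = ?T' \<or> (\<forall>s\<in>?T. \<forall>s'\<in>?T'. dist s s' < \<epsilon>))"
        proof (cases "i \<in> J")
          case True
          have "c i \<in> K i" using c C(2) True by blast
          have "dist s (c i) \<le> ?r" if "s \<in> T i" for s using T[OF True] that by (auto simp: dist_commute)
          then have "T i \<subseteq> near (K i) \<epsilon>" using \<open>c i \<in> K i\<close> r(3) by (force simp: near_def)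
          moreover have "dist s s' < \<epsilon>" if "s \<in> T i" "s' \<in> T' i" for s s'
          proof -
            have "dist s (c i) \<le> ?r" "dist (c i) s' \<le> ?r"
              using T[OF True] T'[OF True] that by (auto simp: dist_commute)
            then show ?thesis using dist_ultrametric_le r(3) by (meson le_less_trans)
          qed
          ultimately show ?thesis using T[OF True] T'[OF True] True by auto
        next
          case False
          then have "S i \<subseteq> near (K i) \<epsilon>" using S i near_mono[OF order_refl, of ?r \<epsilon> "K i"] r(3) by force
          then show ?thesis using False S i by auto
        qed
      next
        \<comment> \<open>The admissible orders in \<open>J\<close> do not depend on those used in
          \<open>I\<close>, so the top order in \<open>J\<close> may be combined with the given
          \<open>S\<close>.\<close>
        show "P (\<lambda>i. if i \<in> J then T i else S i)"
          by (rule P[OF \<open>P S\<close>]) (use fin(3) sum in auto)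
      qed
    qed
    then have "mdd smul J S (\<lambda>y. ?g y - (\<Sum>w\<in>Z. smul (\<Prod>i\<in>J. u w i (y i)) (mdd smul J (A w) ?g y))) x \<in> Q"
      by (simp add: Z_def u_def A_def[abs_def] case_prod_unfold)
    then show ?thesis unfolding mdd_Un[OF fin] inner .
  qed
  show ?thesis
    by (intro exI[of _ Z] exI[of _ u] exI[of _ A] exI[of _ ?r] conjI ballI allI impI)
      (simp_all add: Z \<pi>(1) ulp A ordA main)
qed

end

text \<open>A divided difference over \<open>S\<close> has order \<open>card (S i) - 1\<close> in the coordinate \<open>i\<close>; the bound
  \<open>a j\<close> on the total order in block \<open>j\<close> is stated without subtraction.\<close>

definition block_order :: "'j set \<Rightarrow> ('j \<Rightarrow> 'i set) \<Rightarrow> ('j \<Rightarrow> nat) \<Rightarrow> ('i \<Rightarrow> 'k set) \<Rightarrow> bool" where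
  "block_order R B a S \<longleftrightarrow> (\<forall>j\<in>R. (\<Sum>i\<in>B j. card (S i)) \<le> a j + card (B j))"

lemma block_order_cong:
  assumes "\<And>j i. \<lbrakk>j \<in> R; i \<in> B j\<rbrakk> \<Longrightarrow> S' i = S i" "block_order R B a S"
  shows "block_order R B a S'"
  using assms by (simp add: block_order_def cong: sum.cong)

lemma near_self: "0 < \<epsilon> \<Longrightarrow> K \<subseteq> near K \<epsilon>"
  by (force simp: near_def)

context ultrametric_lcs
begin

definition dd_close ::
  "'i set \<Rightarrow> ('i \<Rightarrow> 'k set) \<Rightarrow> (('i \<Rightarrow> 'k set) \<Rightarrow> bool) \<Rightarrow> ('i \<Rightarrow> 'k) \<Rightarrow> ('i \<Rightarrow> 'k set) \<Rightarrow> 'e set \<Rightarrow>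
    (('i \<Rightarrow> 'k) \<Rightarrow> 'e) \<Rightarrow> (('i \<Rightarrow> 'k) \<Rightarrow> 'e) \<Rightarrow> real \<Rightarrow> bool" where
  "dd_close I X P x K Q f t \<epsilon> \<longleftrightarrow>
    (\<forall>S. (\<forall>i\<in>I. finite (S i) \<and> S i \<noteq> {} \<and> S i \<subseteq> X i \<inter> near (K i) \<epsilon>) \<longrightarrow> P S \<longrightarrow>
      mdd smul I S (\<lambda>y. f y - t y) x \<in> Q)"

text \<open>The fixed nodes are finite, hence compact, and can be added to the family
  \<open>K\<close>. As they do not move, the alternative \<open>S i = S' i\<close> of the
  oscillation condition covers them.\<close>

lemma dd_uniformly_continuous_mdd:
  assumes fin: "finite J" "finite I" "J \<inter> I = {}"
    and uc: "dd_uniformly_continuous (J \<union> I) X P f x"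
    and A: "\<And>i. i \<in> J \<Longrightarrow> finite (A i) \<and> A i \<noteq> {} \<and> A i \<subseteq> X i"
    and P: "\<And>S. P' S \<Longrightarrow> P (\<lambda>i. if i \<in> J then A i else S i)"
  shows "dd_uniformly_continuous I X P' (mdd smul J A f) x"
  unfolding dd_uniformly_continuous_def
proof (intro allI impI)
  fix K Q assume K: "\<forall>i\<in>I. compact (K i) \<and> K i \<subseteq> X i" and Q: "unit_ball_submodule smul Q" "open Q"
  let ?K = "\<lambda>i. if i \<in> J then A i else K i"
  have "\<forall>i\<in>J \<union> I. compact (?K i) \<and> ?K i \<subseteq> X i"
    using K A by (auto intro: finite_imp_compact)
  from dd_uniformly_continuousD[OF uc this Q]
  obtain \<epsilon> where \<epsilon>: "\<epsilon> > 0" and osc: "dd_oscillation_within (J \<union> I) X P f x ?K Q \<epsilon>" by blast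
  have eq: "mdd smul I S (mdd smul J A f) x = mdd smul (J \<union> I) (\<lambda>i. if i \<in> J then A i else S i) f x" for S
    using mdd_commute[OF fin] mdd_override[OF fin] by metis
  have "dd_oscillation_within I X P' (mdd smul J A f) x K Q \<epsilon>"
    unfolding dd_oscillation_within_def eq
  proof (intro allI impI)
    fix S S' assume S: "\<forall>i\<in>I. finite (S i) \<and> S i \<noteq> {} \<and> S i \<subseteq> X i \<inter> near (K i) \<epsilon> \<and>
        finite (S' i) \<and> S' i \<subseteq> X i \<and> card (S' i) = card (S i) \<and>
        (S i = S' i \<or> (\<forall>s\<in>S i. \<forall>s'\<in>S' i. dist s s' < \<epsilon>))" and "P' S"
    show "mdd smul (J \<union> I) (\<lambda>i. if i \<in> J then A i else S i) f x -
        mdd smul (J \<union> I) (\<lambda>i. if i \<in> J then A i else S' i) f x \<in> Q"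
    proof (rule osc[unfolded dd_oscillation_within_def, rule_format])
      fix i assume i: "i \<in> J \<union> I"
      let ?T = "if i \<in> J then A i else S i" and ?T' = "if i \<in> J then A i else S' i"
      show "finite ?T \<and> ?T \<noteq> {} \<and> ?T \<subseteq> X i \<inter> near (?K i) \<epsilon> \<and> finite ?T' \<and> ?T' \<subseteq> X i \<and>
        card ?T' = card ?T \<and> (?T = ?T' \<or> (\<forall>s\<in>?T. \<forall>s'\<in>?T'. dist s s' < \<epsilon>))"
      proof (cases "i \<in> J")
        case True
        then show ?thesis using A[OF True] near_self[OF \<epsilon>, of "A i"] by simp
      next
        case False
        then have "i \<in> I" using i by blast
        with S have "finite (S i) \<and> S i \<noteq> {} \<and> S i \<subseteq> X i \<inter> near (K i) \<epsilon> \<and>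
          finite (S' i) \<and> S' i \<subseteq> X i \<and> card (S' i) = card (S i) \<and>
          (S i = S' i \<or> (\<forall>s\<in>S i. \<forall>s'\<in>S' i. dist s s' < \<epsilon>))" by (rule bspec)
        then show ?thesis unfolding if_not_P[OF False] .
      qed
    next
      show "P (\<lambda>i. if i \<in> J then A i else S i)" by (rule P[OF \<open>P' S\<close>])
    qed
  qed
  with \<epsilon> show "\<exists>\<epsilon>>0. dd_oscillation_within I X P' (mdd smul J A f) x K Q \<epsilon>" by (intro exI conjI)
qed

text \<open>One block at a time: the Newton coefficients of \<open>f\<close> in the block \<open>j\<close> are divided differences
  of \<open>f\<close> at fixed nodes, hence functions of the remaining blocks to which the induction hypothesis
  applies.\<close>

theorem locpoly_tensors_dense:
  fixes B :: "'j \<Rightarrow> 'i set"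
  assumes "finite R" "\<And>j. j \<in> R \<Longrightarrow> finite (B j)" "disjoint_family_on B R"
    and "\<And>j i c. \<lbrakk>j \<in> R; i \<in> B j\<rbrakk> \<Longrightarrow> \<not> c isolated_in X i"
    and "dd_uniformly_continuous (\<Union>j\<in>R. B j) X (block_order R B a) f x"
    and "\<And>j i. \<lbrakk>j \<in> R; i \<in> B j\<rbrakk> \<Longrightarrow> compact (K i) \<and> K i \<subseteq> X i"
    and "unit_ball_submodule smul Q" "open Q"
  shows "\<exists>t\<in>locpoly_tensors (\<Union>j\<in>R. B j). \<exists>\<epsilon>>0.
    dd_close (\<Union>j\<in>R. B j) X (block_order R B a) x K Q f t \<epsilon>"
  using assms
proof (induction R arbitrary: f Q rule: finite_induct)
  case empty
  \<comment> \<open>Without coordinates only the value \<open>f x\<close> is seen, and it is a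
    tensor with an empty product.\<close>
  have "(\<lambda>_. f x) \<in> locpoly_tensors {}"
    using locpoly_tensors.add_tensor[OF _ locpoly_tensors.zero, of "{}" "\<lambda>_ _. 0" "f x"] by simp
  moreover have "dd_close {} X (block_order {} B a) x K Q f (\<lambda>_. f x) 1"
    using submodule_0[OF empty.prems(6)] by (simp add: dd_close_def)
  ultimately have "\<exists>t\<in>locpoly_tensors {}. \<exists>\<epsilon>>0. dd_close {} X (block_order {} B a) x K Q f t \<epsilon>"
    by (intro bexI exI conjI) auto
  then show ?case by simp
next
  case (insert j R)
  define J where "J = B j"
  define I where "I = (\<Union>j\<in>R. B j)"
  define P :: "('i \<Rightarrow> 'k set) \<Rightarrow> bool" where "P = block_order (insert j R) B a"
  have un: "(\<Union>j\<in>insert j R. B j) = J \<union> I" by (simp add: J_def I_def)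
  have fin: "finite J" "finite I" using insert.hyps insert.prems(1) by (auto simp: J_def I_def)
  have disj: "J \<inter> I = {}"
    using insert.prems(2) insert.hyps(2) by (fastforce simp: J_def I_def disjoint_family_on_def)
  have memI: "i \<in> I" if "j' \<in> R" "i \<in> B j'" for j' i using that by (auto simp: I_def)
  have P_iff: "P S \<longleftrightarrow> (\<Sum>i\<in>J. card (S i)) \<le> a j + card J \<and> block_order R B a S" for S :: "'i \<Rightarrow> 'k set"
    by (auto simp: P_def block_order_def J_def)
  have uc: "dd_uniformly_continuous (J \<union> I) X P f x" using insert.prems(4) unfolding un P_def .
  have KX: "compact (K i) \<and> K i \<subseteq> X i" if "i \<in> J \<union> I" for i
    using insert.prems(5) that by (auto simp: J_def I_def)
  have "\<exists>(Z :: (('i \<Rightarrow> 'k) \<times> ('i \<Rightarrow> nat)) set) u A \<epsilon>. finite Z \<and> 0 < \<epsilon> \<and>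
    (\<forall>z\<in>Z. \<forall>i\<in>J. uniformly_locally_polynomial (u z i) \<and> finite (A z i) \<and> A z i \<noteq> {} \<and> A z i \<subseteq> X i) \<and>
    (\<forall>z\<in>Z. (\<Sum>i\<in>J. card (A z i)) \<le> a j + card J) \<and>
    (\<forall>S. (\<forall>i\<in>J \<union> I. finite (S i) \<and> S i \<noteq> {} \<and> S i \<subseteq> X i \<inter> near (K i) \<epsilon>) \<longrightarrow> P S \<longrightarrow>
      mdd smul (J \<union> I) S (\<lambda>y. f y - (\<Sum>z\<in>Z. smul (\<Prod>i\<in>J. u z i (y i)) (mdd smul J (A z) f y))) x \<in> Q)"
  proof (rule block_newton_approximation[OF fin disj uc])
    fix S S' assume "P S" "\<And>i. i \<in> I \<Longrightarrow> S' i = S i" "(\<Sum>i\<in>J. card (S' i)) \<le> a j + card J"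
    then show "P S'" using block_order_cong[of R B S' S a] memI by (auto simp: P_iff)
  next
    show "\<not> c isolated_in X i" if "i \<in> J" for i c using insert.prems(3) that by (auto simp: J_def)
  qed (use KX insert.prems(6,7) P_iff in auto)
  then obtain Z :: "(('i \<Rightarrow> 'k) \<times> ('i \<Rightarrow> nat)) set" and u A \<epsilon>0 where Z: "finite Z" and \<epsilon>0: "0 < \<epsilon>0"
    and uA: "\<forall>z\<in>Z. \<forall>i\<in>J. uniformly_locally_polynomial (u z i) \<and> finite (A z i) \<and> A z i \<noteq> {} \<and> A z i \<subseteq> X i"
    and ordA: "\<forall>z\<in>Z. (\<Sum>i\<in>J. card (A z i)) \<le> a j + card J"
    and newton: "\<forall>S. (\<forall>i\<in>J \<union> I. finite (S i) \<and> S i \<noteq> {} \<and> S i \<subseteq> X i \<inter> near (K i) \<epsilon>0) \<longrightarrow> P S \<longrightarrow>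
      mdd smul (J \<union> I) S (\<lambda>y. f y - (\<Sum>z\<in>Z. smul (\<Prod>i\<in>J. u z i (y i)) (mdd smul J (A z) f y))) x \<in> Q"
    by (elim exE conjE) (rule that)
  let ?h = "\<lambda>z. mdd smul J (A z) f"
  have bnd: "\<exists>b \<epsilon>. 0 < \<epsilon> \<and> (\<forall>S. (\<forall>i\<in>J. finite (S i) \<and> S i \<noteq> {} \<and> card (S i) \<le> a j + card J \<and>
      S i \<subseteq> near (K i) \<epsilon>) \<longrightarrow> abs_value (\<Prod>i\<in>J. scalar_dd (S i) (u z i)) \<le> abs_value (b::'k))"
    if "z \<in> Z" for z
    by (rule uniformly_locally_polynomial_prod_bounded) (use fin uA KX that in auto)
  \<comment> \<open>The coefficient is approximated up to \<open>{v. smul b v \<in> Q}\<close>,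
    where \<open>b\<close> dominates the differences of its factors in block \<open>j\<close>; after
    multiplication with these factors the error is back in \<open>Q\<close>.\<close>
  have ex: "\<exists>t \<epsilon> b. t \<in> locpoly_tensors I \<and> 0 < \<epsilon> \<and>
      dd_close I X (block_order R B a) x K {v. smul b v \<in> Q} (?h z) t \<epsilon> \<and>
      (\<forall>S. (\<forall>i\<in>J. finite (S i) \<and> S i \<noteq> {} \<and> card (S i) \<le> a j + card J \<and>
        S i \<subseteq> near (K i) \<epsilon>) \<longrightarrow> abs_value (\<Prod>i\<in>J. scalar_dd (S i) (u z i)) \<le> abs_value (b::'k))"
    if z: "z \<in> Z" for z
  proof -
    obtain b \<epsilon>1 where b: "0 < \<epsilon>1" "\<forall>S. (\<forall>i\<in>J. finite (S i) \<and> S i \<noteq> {} \<and> card (S i) \<le> a j + card J \<and>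
      S i \<subseteq> near (K i) \<epsilon>1) \<longrightarrow> abs_value (\<Prod>i\<in>J. scalar_dd (S i) (u z i)) \<le> abs_value (b::'k)"
      using bnd[OF z] by (elim exE conjE) (rule that)
    have "dd_uniformly_continuous I X (block_order R B a) (?h z) x"
    proof (rule dd_uniformly_continuous_mdd[OF fin disj uc])
      show "finite (A z i) \<and> A z i \<noteq> {} \<and> A z i \<subseteq> X i" if "i \<in> J" for i using uA z that by auto
      fix S :: "'i \<Rightarrow> 'k set" assume "block_order R B a S"
      moreover have "(if i \<in> J then A z i else S i) = S i" if "j' \<in> R" "i \<in> B j'" for j' i
        using memI[OF that] disj by auto
      ultimately show "P (\<lambda>i. if i \<in> J then A z i else S i)"
        unfolding P_iff using ordA z by (auto intro: block_order_cong)
    qed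
    moreover have "disjoint_family_on B R"
      using insert.prems(2) by (rule disjoint_family_on_mono[rotated]) auto
    ultimately have "\<exists>t\<in>locpoly_tensors I. \<exists>\<epsilon>>0.
        dd_close I X (block_order R B a) x K {v. smul b v \<in> Q} (?h z) t \<epsilon>"
      unfolding I_def
      by (intro insert.IH submodule_vimage open_scale_vimage insert.prems) (use insert.prems in auto)
    then obtain t \<epsilon>2 where t: "t \<in> locpoly_tensors I" "0 < \<epsilon>2"
      "dd_close I X (block_order R B a) x K {v. smul b v \<in> Q} (?h z) t \<epsilon>2" by blast
    have near: "near (K i) (min \<epsilon>1 \<epsilon>2) \<subseteq> near (K i) \<epsilon>1" "near (K i) (min \<epsilon>1 \<epsilon>2) \<subseteq> near (K i) \<epsilon>2" for i
      by (simp_all add: near_mono)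
    have "dd_close I X (block_order R B a) x K {v. smul b v \<in> Q} (?h z) t (min \<epsilon>1 \<epsilon>2)"
      using t(3) near(2) unfolding dd_close_def by (meson le_inf_iff order_trans)
    moreover have "\<forall>S. (\<forall>i\<in>J. finite (S i) \<and> S i \<noteq> {} \<and> card (S i) \<le> a j + card J \<and>
        S i \<subseteq> near (K i) (min \<epsilon>1 \<epsilon>2)) \<longrightarrow> abs_value (\<Prod>i\<in>J. scalar_dd (S i) (u z i)) \<le> abs_value b"
      using b(2) near(1) by (meson order_trans)
    ultimately show ?thesis using t(1,2) b(1)
      by (intro exI[of _ t] exI[of _ "min \<epsilon>1 \<epsilon>2"] exI[of _ b] conjI) auto
  qed
  define good where "good z t \<epsilon> b \<longleftrightarrow> t \<in> locpoly_tensors I \<and> 0 < \<epsilon> \<and>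
      dd_close I X (block_order R B a) x K {v. smul b v \<in> Q} (?h z) t \<epsilon> \<and>
      (\<forall>S. (\<forall>i\<in>J. finite (S i) \<and> S i \<noteq> {} \<and> card (S i) \<le> a j + card J \<and>
        S i \<subseteq> near (K i) \<epsilon>) \<longrightarrow> abs_value (\<Prod>i\<in>J. scalar_dd (S i) (u z i)) \<le> abs_value (b::'k))"
    for z t \<epsilon> b
  have "\<exists>t \<epsilon> b. good z t \<epsilon> b" if "z \<in> Z" for z using ex[OF that] unfolding good_def .
  then obtain t e b where good: "\<And>z. z \<in> Z \<Longrightarrow> good z (t z) (e z) (b z)" by metis
  have e_pos: "0 < e z" if "z \<in> Z" for z using good[OF that] by (simp add: good_def)
  obtain \<epsilon>1 where \<epsilon>1: "\<epsilon>1 > 0" "\<forall>z\<in>Z. \<epsilon>1 \<le> e z"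
    using finite_ex_positive_lower_bound[OF Z, of e] e_pos by blast
  define \<epsilon> where "\<epsilon> = min \<epsilon>0 \<epsilon>1"
  have \<epsilon>: "0 < \<epsilon>" "\<epsilon> \<le> \<epsilon>0" "\<And>z. z \<in> Z \<Longrightarrow> \<epsilon> \<le> e z" using \<epsilon>0 \<epsilon>1 by (force simp: \<epsilon>_def)+
  define T where "T y = (\<Sum>z\<in>Z. smul (\<Prod>i\<in>J. u z i (y i)) (t z y))" for y
  have "T \<in> locpoly_tensors (J \<union> I)"
    unfolding T_def[abs_def]
  proof (rule locpoly_tensors_sum)
    fix z assume z: "z \<in> Z"
    show "(\<lambda>y. smul (\<Prod>i\<in>J. u z i (y i)) (t z y)) \<in> locpoly_tensors (J \<union> I)"
      by (rule locpoly_tensors_mult[OF fin disj]) (use uA z good[OF z] in \<open>auto simp: good_def\<close>)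
  qed
  moreover have "dd_close (J \<union> I) X P x K Q f T \<epsilon>"
    unfolding dd_close_def
  proof (intro allI impI)
    fix S assume S: "\<forall>i\<in>J \<union> I. finite (S i) \<and> S i \<noteq> {} \<and> S i \<subseteq> X i \<inter> near (K i) \<epsilon>" and "P S"
    have near: "S i \<subseteq> near (K i) \<epsilon>'" if "i \<in> J \<union> I" "\<epsilon> \<le> \<epsilon>'" for i \<epsilon>'
      using S that near_mono[OF order_refl, of \<epsilon> \<epsilon>' "K i"] by blast
    have "mdd smul (J \<union> I) S (\<lambda>y. f y - (\<Sum>z\<in>Z. smul (\<Prod>i\<in>J. u z i (y i)) (?h z y))) x \<in> Q"
      using newton[rule_format, of S] S near[OF _ \<epsilon>(2)] \<open>P S\<close> by simp
    moreover have "mdd smul (J \<union> I) S (\<lambda>y. smul (\<Prod>i\<in>J. u z i (y i)) (?h z y - t z y)) x \<in> Q" if z: "z \<in> Z" for z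
    proof -
      have t: "t z \<in> locpoly_tensors I"
        and close: "dd_close I X (block_order R B a) x K {v. smul (b z) v \<in> Q} (?h z) (t z) (e z)"
        and bound: "\<forall>S. (\<forall>i\<in>J. finite (S i) \<and> S i \<noteq> {} \<and> card (S i) \<le> a j + card J \<and>
          S i \<subseteq> near (K i) (e z)) \<longrightarrow> abs_value (\<Prod>i\<in>J. scalar_dd (S i) (u z i)) \<le> abs_value (b z)"
        using good[OF z] unfolding good_def by simp_all
      have "mdd smul J S (\<lambda>y. smul (\<Prod>i\<in>J. u z i (y i)) (?h z y - t z y)) y =
          smul (\<Prod>i\<in>J. scalar_dd (S i) (u z i)) (?h z y - t z y)" for y
      proof (rule mdd_tensor[OF fin(1)])
        fix y' assume y': "\<And>i. i \<notin> J \<Longrightarrow> y' i = y i"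
        have "?h z y' = ?h z y" by (rule mdd_base_cong) (rule y')
        moreover have "t z y' = t z y"
          by (rule locpoly_tensors_cong[OF t], rule y') (use disj in blast)
        ultimately show "?h z y' - t z y' = ?h z y - t z y" by simp
      qed (use S in simp)
      then have "mdd smul J S (\<lambda>y. smul (\<Prod>i\<in>J. u z i (y i)) (?h z y - t z y)) =
          (\<lambda>y. smul (\<Prod>i\<in>J. scalar_dd (S i) (u z i)) (?h z y - t z y))" by (rule ext)
      then have "mdd smul (I \<union> J) S (\<lambda>y. smul (\<Prod>i\<in>J. u z i (y i)) (?h z y - t z y)) x =
          smul (\<Prod>i\<in>J. scalar_dd (S i) (u z i)) (mdd smul I S (\<lambda>y. ?h z y - t z y) x)"
        using mdd_Un[OF fin(2,1)] disj by (simp add: Int_commute mdd_scale)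
      moreover have "smul (b z) (mdd smul I S (\<lambda>y. ?h z y - t z y) x) \<in> Q"
        using close[unfolded dd_close_def, rule_format, of S] S near[OF _ \<epsilon>(3)[OF z]] \<open>P S\<close> P_iff by simp
      moreover have "abs_value (\<Prod>i\<in>J. scalar_dd (S i) (u z i)) \<le> abs_value (b z)"
      proof (rule bound[rule_format])
        fix i assume i: "i \<in> J"
        have "card (S i) \<le> (\<Sum>i\<in>J. card (S i))" using member_le_sum[OF i, of "\<lambda>i. card (S i)"] fin(1) by simp
        also have "\<dots> \<le> a j + card J" using \<open>P S\<close> P_iff by blast
        finally show "finite (S i) \<and> S i \<noteq> {} \<and> card (S i) \<le> a j + card J \<and> S i \<subseteq> near (K i) (e z)"
          using S near[OF _ \<epsilon>(3)[OF z]] i by simp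
      qed
      ultimately show ?thesis
        using submodule_scale_le[OF insert.prems(6)] by (simp add: Un_commute)
    qed
    then have "(\<Sum>z\<in>Z. mdd smul (J \<union> I) S (\<lambda>y. smul (\<Prod>i\<in>J. u z i (y i)) (?h z y - t z y)) x) \<in> Q"
      by (rule submodule_sum[OF insert.prems(6)])
    \<comment> \<open>The two summands are the Newton error and the effect of replacing the
      coefficients; together they give \<open>f - T\<close>.\<close>
    ultimately have "mdd smul (J \<union> I) S (\<lambda>y. (f y - (\<Sum>z\<in>Z. smul (\<Prod>i\<in>J. u z i (y i)) (?h z y))) +
        (\<Sum>z\<in>Z. smul (\<Prod>i\<in>J. u z i (y i)) (?h z y - t z y))) x \<in> Q"
      unfolding mdd_add mdd_sum by (rule submodule_add[OF insert.prems(6)])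
    then show "mdd smul (J \<union> I) S (\<lambda>y. f y - T y) x \<in> Q"
      by (simp add: T_def scale_right_diff_distrib sum_subtractf)
  qed
  ultimately show ?case unfolding un P_def [symmetric] using \<epsilon>(1) by blast
qed

end

section \<open>Approximating tensors by polynomials\<close>

text \<open>Telescoping, one factor at a time; \<delta> \<le> 1 \<le> \<open>M\<close> keeps the
  factors \<open>b i\<close> below \<open>M\<close> as well.\<close>

lemma abs_prod_diff_le:
  fixes a b :: "'i \<Rightarrow> 'k::ultrametric_field"
  assumes "finite J" "\<And>i. i \<in> J \<Longrightarrow> abs_value (a i) \<le> M" "\<And>i. i \<in> J \<Longrightarrow> abs_value (a i - b i) \<le> \<delta>"
    and "1 \<le> M" "0 \<le> \<delta>" "\<delta> \<le> 1"
  shows "abs_value (prod a J - prod b J) \<le> \<delta> * M ^ card J"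
  using assms(1-3)
proof (induction J rule: finite_induct)
  case empty
  then show ?case using assms(5) by simp
next
  case (insert i J)
  have "abs_value (b k) \<le> M" if "k \<in> insert i J" for k
    using abs_value_diff_le[of "a k" "a k - b k"] insert.prems[OF that] assms(4,6) by auto
  then have "abs_value (prod b J) \<le> (\<Prod>k\<in>J. M)"
    unfolding abs_value_prod by (intro prod_mono) auto
  then have "abs_value ((a i - b i) * prod b J) \<le> \<delta> * M ^ card J"
    using insert.prems assms(5) by (auto simp: abs_value_mult intro!: mult_mono)
  moreover have "abs_value (a i * (prod a J - prod b J)) \<le> M * (\<delta> * M ^ card J)"
    using insert assms(4) by (auto simp: abs_value_mult intro!: mult_mono)
  moreover have "\<delta> * M ^ card J \<le> M * (\<delta> * M ^ card J)"
    using assms(4,5) mult_right_mono[of 1 M "\<delta> * M ^ card J"] by simp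
  moreover have "prod a (insert i J) - prod b (insert i J) = a i * (prod a J - prod b J) + (a i - b i) * prod b J"
    using insert.hyps by (simp add: algebra_simps)
  ultimately show ?case
    using abs_value_ultrametric[of "a i * (prod a J - prod b J)" "(a i - b i) * prod b J"] insert.hyps
    by (simp add: mult.left_commute)
qed

context ultrametric_lcs
begin

text \<open>Continuity of scalar multiplication at 0 for one fixed vector; it converts scalar
  estimates into membership in \<open>Q\<close>.\<close>

lemma ex_absorbing_radius:
  assumes "unit_ball_submodule smul Q" "open Q"
  shows "\<exists>\<delta>>0. \<forall>c. abs_value c \<le> \<delta> \<longrightarrow> smul c e \<in> Q"
proof -
  have "continuous_on UNIV (\<lambda>c. (\<lambda>(c, x). smul c x) (c, e))"
    by (rule continuous_on_compose2[OF continuous_smul]) (auto intro!: continuous_intros)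
  then have "open {c. smul c e \<in> Q}" using open_vimage[OF assms(2)] by (simp add: vimage_def)
  moreover have "0 \<in> {c. smul c e \<in> Q}" using submodule_0[OF assms(1)] by simp
  ultimately obtain r where r: "r > 0" "cball 0 r \<subseteq> {c. smul c e \<in> Q}"
    unfolding open_contains_cball by blast
  have "smul c e \<in> Q" if "abs_value c \<le> r" for c
  proof -
    have "c \<in> cball 0 r" using that by (simp add: dist_abs_value)
    then show ?thesis using r(2) by blast
  qed
  with r(1) show ?thesis by blast
qed

text \<open>The members of \<open>Pol\<close> before restriction to \<open>U\<close>; being defined
  on all tuples, they admit divided differences at arbitrary nodes.\<close>

definition polynomial_functions :: "'i set \<Rightarrow> (('i \<Rightarrow> 'k) \<Rightarrow> 'e) set" where
  "polynomial_functions I = {\<lambda>x. \<Sum>\<beta>\<in>B. smul (\<Prod>i\<in>I. x i ^ \<beta> i) (a \<beta>) | B a.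
     finite B \<and> B \<subseteq> (I \<rightarrow>\<^sub>E UNIV)}"

lemma polynomial_functions_add:
  assumes "p \<in> polynomial_functions I" "q \<in> polynomial_functions I"
  shows "(\<lambda>x. p x + q x) \<in> polynomial_functions I"
proof -
  let ?m = "\<lambda>x \<beta>. \<Prod>i\<in>I. x i ^ \<beta> i"
  from assms obtain B a C b where B: "finite B" "B \<subseteq> I \<rightarrow>\<^sub>E UNIV" "p = (\<lambda>x. \<Sum>\<beta>\<in>B. smul (?m x \<beta>) (a \<beta>))"
    and C: "finite C" "C \<subseteq> I \<rightarrow>\<^sub>E UNIV" "q = (\<lambda>x. \<Sum>\<beta>\<in>C. smul (?m x \<beta>) (b \<beta>))"
    unfolding polynomial_functions_def by blast
  define a' where "a' \<beta> = (if \<beta> \<in> B then a \<beta> else 0)" for \<beta>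
  define b' where "b' \<beta> = (if \<beta> \<in> C then b \<beta> else 0)" for \<beta>
  have "p x = (\<Sum>\<beta>\<in>B \<union> C. smul (?m x \<beta>) (a' \<beta>))" for x
    unfolding B(3) using B(1) C(1) by (intro sum.mono_neutral_cong_left) (auto simp: a'_def)
  moreover have "q x = (\<Sum>\<beta>\<in>B \<union> C. smul (?m x \<beta>) (b' \<beta>))" for x
    unfolding C(3) using B(1) C(1) by (intro sum.mono_neutral_cong_left) (auto simp: b'_def)
  ultimately have "(\<lambda>x. p x + q x) = (\<lambda>x. \<Sum>\<beta>\<in>B \<union> C. smul (?m x \<beta>) (a' \<beta> + b' \<beta>))"
    by (simp add: scale_right_distrib sum.distrib)
  then show ?thesis unfolding polynomial_functions_def using B(1,2) C(1,2)
    by (intro CollectI exI[of _ "B \<union> C"] exI[of _ "\<lambda>\<beta>. a' \<beta> + b' \<beta>"]) auto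
qed

lemma polynomial_functions_tensor:
  assumes "finite I"
  shows "(\<lambda>x. smul (\<Prod>i\<in>I. poly (p i) (x i)) e) \<in> polynomial_functions I"
proof -
  let ?B = "\<Pi>\<^sub>E i\<in>I. {..degree (p i)}"
  have "smul (\<Prod>i\<in>I. poly (p i) (x i)) e =
      (\<Sum>\<beta>\<in>?B. smul (\<Prod>i\<in>I. x i ^ \<beta> i) (smul (\<Prod>i\<in>I. coeff (p i) (\<beta> i)) e))" for x
    using assms by (simp add: poly_altdef prod_sum_PiE scale_sum_left prod.distrib mult.commute)
  moreover have "finite ?B" using assms by (auto intro: finite_PiE)
  ultimately show ?thesis unfolding polynomial_functions_def
    by (intro CollectI exI[of _ ?B] exI[of _ "\<lambda>\<beta>. smul (\<Prod>i\<in>I. coeff (p i) (\<beta> i)) e"]) auto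
qed

text \<open>Differences of an elementary tensor are products of one-variable differences. So each
  factor is approximated separately, closely enough that the difference of the two products carries
  \<open>e\<close> into \<open>Q\<close>.\<close>

lemma elementary_tensor_approx:
  fixes K :: "'i \<Rightarrow> 'k set"
  assumes I: "finite I" and u: "\<And>i. i \<in> I \<Longrightarrow> uniformly_locally_polynomial (u i)"
    and K: "\<And>i. i \<in> I \<Longrightarrow> compact (K i)"
    and Q: "unit_ball_submodule smul Q" "open Q"
  shows "\<exists>p\<in>polynomial_functions I. \<exists>\<epsilon>>0. \<forall>S.
    (\<forall>i\<in>I. finite (S i) \<and> S i \<noteq> {} \<and> card (S i) \<le> N \<and> S i \<subseteq> near (K i) \<epsilon>) \<longrightarrow>
    mdd smul I S (\<lambda>y. smul (\<Prod>i\<in>I. u i (y i)) e - p y) x \<in> Q"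
proof -
  obtain \<delta>0 where \<delta>0: "\<delta>0 > 0" "\<And>c. abs_value c \<le> \<delta>0 \<Longrightarrow> smul c e \<in> Q"
    using ex_absorbing_radius[OF Q] by blast
  define bdd where "bdd i \<epsilon> M \<longleftrightarrow> (\<forall>A. finite A \<longrightarrow> A \<noteq> {} \<longrightarrow> card A \<le> N \<longrightarrow> A \<subseteq> near (K i) \<epsilon> \<longrightarrow>
      abs_value (scalar_dd A (u i)) \<le> M)" for i \<epsilon> M
  have "\<exists>\<epsilon> M. 0 < \<epsilon> \<and> 1 \<le> M \<and> bdd i \<epsilon> M" if "i \<in> I" for i
    by (rule uniformly_locally_polynomial_bounded[OF u[OF that] K[OF that], where N = N])
      (unfold bdd_def, blast)
  then obtain e1 m where e1: "\<And>i. i \<in> I \<Longrightarrow> 0 < e1 i" and m1: "\<And>i. i \<in> I \<Longrightarrow> 1 \<le> m i"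
    and m: "\<And>i. i \<in> I \<Longrightarrow> bdd i (e1 i) (m i)" by metis
  define M where "M = 1 + (\<Sum>i\<in>I. m i)"
  have m0: "0 \<le> m i" if "i \<in> I" for i using m1[OF that] by linarith
  have M: "1 \<le> M" using m0 by (simp add: M_def sum_nonneg)
  have mM: "m i \<le> M" if "i \<in> I" for i
    using member_le_sum[of i I m] m0 that I by (simp add: M_def)
  \<comment> \<open>\<open>M ^ card I\<close> is the loss in comparing the two products.\<close>
  define \<delta> where "\<delta> = min 1 (\<delta>0 / M ^ card I)"
  have \<delta>: "0 < \<delta>" "\<delta> \<le> 1" "\<delta> * M ^ card I \<le> \<delta>0"
    using \<delta>0(1) M by (auto simp: \<delta>_def min_def field_simps)
  define appr where "appr i \<epsilon> p \<longleftrightarrow> (\<forall>A. finite A \<longrightarrow> A \<noteq> {} \<longrightarrow> card A \<le> N \<longrightarrow> A \<subseteq> near (K i) \<epsilon> \<longrightarrow>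
      abs_value (scalar_dd A (\<lambda>x. u i x - poly p x)) \<le> \<delta>)" for i \<epsilon> p
  have "\<exists>\<epsilon> p. 0 < \<epsilon> \<and> appr i \<epsilon> p" if "i \<in> I" for i
    by (rule uniformly_locally_polynomial_approx[OF u[OF that] K[OF that] \<delta>(1), where N = N])
      (unfold appr_def, blast)
  then obtain e2 p where e2: "\<And>i. i \<in> I \<Longrightarrow> 0 < e2 i" and p: "\<And>i. i \<in> I \<Longrightarrow> appr i (e2 i) (p i)" by metis
  obtain \<epsilon> where \<epsilon>: "0 < \<epsilon>" "\<forall>i\<in>I. \<epsilon> \<le> min (e1 i) (e2 i)"
    using finite_ex_positive_lower_bound[OF I, of "\<lambda>i. min (e1 i) (e2 i)"] e1 e2 by auto
  have close: "mdd smul I S (\<lambda>y. smul (\<Prod>i\<in>I. u i (y i)) e - smul (\<Prod>i\<in>I. poly (p i) (y i)) e) x \<in> Q"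
    if S: "\<forall>i\<in>I. finite (S i) \<and> S i \<noteq> {} \<and> card (S i) \<le> N \<and> S i \<subseteq> near (K i) \<epsilon>" for S
  proof -
    have near: "S i \<subseteq> near (K i) (e1 i)" "S i \<subseteq> near (K i) (e2 i)" if "i \<in> I" for i
    proof -
      have "S i \<subseteq> near (K i) \<epsilon>" "\<epsilon> \<le> e1 i" "\<epsilon> \<le> e2 i" using S \<epsilon>(2) that by simp_all
      then show "S i \<subseteq> near (K i) (e1 i)" "S i \<subseteq> near (K i) (e2 i)"
        using near_mono[OF order_refl, of \<epsilon> "e1 i" "K i"] near_mono[OF order_refl, of \<epsilon> "e2 i" "K i"] by simp_all
    qed
    have tensor: "mdd smul I S (\<lambda>y. smul (\<Prod>i\<in>I. v i (y i)) e) x = smul (\<Prod>i\<in>I. scalar_dd (S i) (v i)) e" for v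
      using mdd_tensor[OF I, of S x "\<lambda>_. e" v] S by simp
    have "mdd smul I S (\<lambda>y. smul (\<Prod>i\<in>I. u i (y i)) e - smul (\<Prod>i\<in>I. poly (p i) (y i)) e) x =
        smul ((\<Prod>i\<in>I. scalar_dd (S i) (u i)) - (\<Prod>i\<in>I. scalar_dd (S i) (poly (p i)))) e"
      unfolding mdd_diff scale_left_diff_distrib tensor tensor[of "\<lambda>i. poly (p i)"] ..
    moreover have "abs_value ((\<Prod>i\<in>I. scalar_dd (S i) (u i)) - (\<Prod>i\<in>I. scalar_dd (S i) (poly (p i)))) \<le>
        \<delta> * M ^ card I"
    proof (rule abs_prod_diff_le[OF I _ _ M])
      fix i assume i: "i \<in> I"
      show "abs_value (scalar_dd (S i) (u i)) \<le> M"
        by (rule order_trans[OF m[OF i, unfolded bdd_def, rule_format] mM[OF i]]) (use S i near(1)[OF i] in simp_all)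
      show "abs_value (scalar_dd (S i) (u i) - scalar_dd (S i) (poly (p i))) \<le> \<delta>"
        unfolding vector_space_over_itself.point_dd_diff [symmetric]
        by (rule p[OF i, unfolded appr_def, rule_format]) (use S i near(2)[OF i] in simp_all)
    qed (use \<delta> in auto)
    ultimately show ?thesis using \<delta>0(2) \<delta>(3) by simp
  qed
  show ?thesis
    by (rule bexI[OF _ polynomial_functions_tensor[OF I, of p e]], rule exI[of _ \<epsilon>])
      (intro conjI allI impI \<epsilon>(1) close)
qed

lemma locpoly_tensor_approx:
  fixes K :: "'i \<Rightarrow> 'k set"
  assumes I: "finite I" and K: "\<And>i. i \<in> I \<Longrightarrow> compact (K i)"
    and Q: "unit_ball_submodule smul Q" "open Q" and "t \<in> locpoly_tensors I"
  shows "\<exists>p\<in>polynomial_functions I. \<exists>\<epsilon>>0. \<forall>S.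
    (\<forall>i\<in>I. finite (S i) \<and> S i \<noteq> {} \<and> card (S i) \<le> N \<and> S i \<subseteq> near (K i) \<epsilon>) \<longrightarrow>
    mdd smul I S (\<lambda>y. t y - p y) x \<in> Q"
  using assms(5)
proof induction
  case zero
  have "(\<lambda>x. \<Sum>\<beta>\<in>{}. smul (\<Prod>i\<in>I. x i ^ \<beta> i) 0) \<in> polynomial_functions I"
    unfolding polynomial_functions_def by (intro CollectI exI[of _ "{}"] exI[of _ "\<lambda>_. 0"]) simp
  then have "(\<lambda>_. 0) \<in> polynomial_functions I" by simp
  then show ?case using submodule_0[OF Q(1)] by (intro bexI[of _ "\<lambda>_. 0"] exI[of _ 1]) auto
next
  case (add_tensor u t e)
  obtain q \<epsilon>1 where q: "q \<in> polynomial_functions I" "\<epsilon>1 > 0"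
    "\<forall>S. (\<forall>i\<in>I. finite (S i) \<and> S i \<noteq> {} \<and> card (S i) \<le> N \<and> S i \<subseteq> near (K i) \<epsilon>1) \<longrightarrow>
      mdd smul I S (\<lambda>y. t y - q y) x \<in> Q" using add_tensor.IH by blast
  have "\<exists>p\<in>polynomial_functions I. \<exists>\<epsilon>>0. \<forall>S.
    (\<forall>i\<in>I. finite (S i) \<and> S i \<noteq> {} \<and> card (S i) \<le> N \<and> S i \<subseteq> near (K i) \<epsilon>) \<longrightarrow>
    mdd smul I S (\<lambda>y. smul (\<Prod>i\<in>I. u i (y i)) e - p y) x \<in> Q"
    by (rule elementary_tensor_approx[OF I add_tensor.hyps(1) K Q])
  then obtain p \<epsilon>2 where p: "p \<in> polynomial_functions I" "\<epsilon>2 > 0"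
    "\<forall>S. (\<forall>i\<in>I. finite (S i) \<and> S i \<noteq> {} \<and> card (S i) \<le> N \<and> S i \<subseteq> near (K i) \<epsilon>2) \<longrightarrow>
      mdd smul I S (\<lambda>y. smul (\<Prod>i\<in>I. u i (y i)) e - p y) x \<in> Q" by blast
  have "mdd smul I S (\<lambda>y. smul (\<Prod>i\<in>I. u i (y i)) e + t y - (p y + q y)) x \<in> Q"
    if S: "\<forall>i\<in>I. finite (S i) \<and> S i \<noteq> {} \<and> card (S i) \<le> N \<and> S i \<subseteq> near (K i) (min \<epsilon>1 \<epsilon>2)" for S
  proof -
    have near: "S i \<subseteq> near (K i) \<epsilon>1" "S i \<subseteq> near (K i) \<epsilon>2" if "i \<in> I" for i
    proof -
      have "S i \<subseteq> near (K i) (min \<epsilon>1 \<epsilon>2)" using S that by simp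
      then show "S i \<subseteq> near (K i) \<epsilon>1" "S i \<subseteq> near (K i) \<epsilon>2"
        using near_mono[OF order_refl, of "min \<epsilon>1 \<epsilon>2" \<epsilon>1 "K i"]
          near_mono[OF order_refl, of "min \<epsilon>1 \<epsilon>2" \<epsilon>2 "K i"] by simp_all
    qed
    have "mdd smul I S (\<lambda>y. t y - q y) x \<in> Q" using q(3)[rule_format, of S] S near by simp
    moreover have "mdd smul I S (\<lambda>y. smul (\<Prod>i\<in>I. u i (y i)) e - p y) x \<in> Q"
      using p(3)[rule_format, of S] S near by simp
    ultimately have "mdd smul I S (\<lambda>y. (smul (\<Prod>i\<in>I. u i (y i)) e - p y) + (t y - q y)) x \<in> Q"
      unfolding mdd_add using submodule_add[OF Q(1)] by blast
    then show ?thesis by (simp add: algebra_simps)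
  qed
  moreover have "0 < min \<epsilon>1 \<epsilon>2" using p(2) q(2) by simp
  ultimately show ?case
    by (intro bexI[OF _ polynomial_functions_add[OF p(1) q(1)]] exI[of _ "min \<epsilon>1 \<epsilon>2"] conjI allI impI)
qed

end

section \<open>Extended divided differences\<close>

lemma ex_distinct_choice:
  assumes "finite T" "\<And>t. t \<in> T \<Longrightarrow> infinite (U t)"
  shows "\<exists>x\<in>Pi\<^sub>E T U. inj_on x T"
  using assms
proof (induction T rule: finite_induct)
  case (insert t T)
  then obtain x where x: "x \<in> Pi\<^sub>E T U" "inj_on x T" by auto
  have "infinite (U t - x ` T)" using insert by (simp add: Diff_infinite_finite)
  then obtain v where v: "v \<in> U t" "v \<notin> x ` T" by (metis Diff_iff finite.emptyI ex_in_conv)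
  have "x(t := v) \<in> Pi\<^sub>E (insert t T) U" by (intro PiE_fun_upd x(1) v(1))
  moreover have "inj_on (x(t := v)) (insert t T)"
    using x(2) v(2) insert.hyps(2) by (auto simp: inj_on_def)
  ultimately show ?case by blast
qed auto

lemma topspace_multi_space:
  "topspace (multi_space I V \<gamma>) = Pi\<^sub>E (SIGMA i:I. {..\<gamma> i}) (\<lambda>(i, j). V i)"
  by (simp add: multi_space_def case_prod_unfold)

text \<open>A nonempty open set contains a box whose factors are relatively open in sets without
  isolated points and hence infinite, which leaves room to choose all entries distinct.\<close>

lemma multi_space_nonisolated_dense:
  fixes V :: "'i \<Rightarrow> 'k::metric_space set"
  assumes "finite I" "cartesian_factors I V" "openin (multi_space I V \<gamma>) W" "W \<noteq> {}"
  shows "W \<inter> distinct_points I V \<gamma> \<noteq> {}"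
proof -
  let ?\<Sigma> = "SIGMA i:I. {..\<gamma> i}"
  obtain y where "y \<in> W" using assms(4) by blast
  then obtain U where U: "\<And>z. z \<in> ?\<Sigma> \<Longrightarrow> openin (subtopology euclidean (V (fst z))) (U z)"
    "y \<in> Pi\<^sub>E ?\<Sigma> U" "Pi\<^sub>E ?\<Sigma> U \<subseteq> W"
    using assms(3) unfolding multi_space_def openin_product_topology_alt case_prod_unfold by meson
  have fin: "finite ?\<Sigma>" using assms(1) by auto
  have "infinite (U z)" if z: "z \<in> ?\<Sigma>" for z
  proof -
    obtain T where T: "open T" "U z = T \<inter> V (fst z)" using U(1)[OF z] by (auto simp: openin_subtopology)
    have y: "y z \<in> T" "y z \<in> V (fst z)" using U(2) z T(2) by (auto dest: PiE_mem)
    then obtain e where e: "e > 0" "ball (y z) e \<subseteq> T" using T(1) open_contains_ball by blast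
    have "\<not> y z isolated_in V (fst z)" using assms(2) z by (auto simp: cartesian_factors_def)
    then have "y z islimpt V (fst z)" using y(2) unfolding isolated_in_islimpt_iff by blast
    then have "infinite (V (fst z) \<inter> ball (y z) e)" using e(1) by (simp add: islimpt_eq_infinite_ball)
    moreover have "V (fst z) \<inter> ball (y z) e \<subseteq> U z" using e(2) T(2) by auto
    ultimately show ?thesis using finite_subset by blast
  qed
  then obtain x where x: "x \<in> Pi\<^sub>E ?\<Sigma> U" "inj_on x ?\<Sigma>" using ex_distinct_choice[OF fin] by blast
  have "x \<in> W" using x(1) U(3) by blast
  moreover have "x \<in> distinct_points I V \<gamma>"
    unfolding distinct_points_def
  proof (intro CollectI conjI ballI allI impI)
    show "x \<in> topspace (multi_space I V \<gamma>)" using \<open>x \<in> W\<close> openin_subset[OF assms(3)] by blast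
    fix i j k assume "i \<in> I" "j < k \<and> k \<le> \<gamma> i"
    then show "x (i, j) \<noteq> x (i, k)" using inj_onD[OF x(2), of "(i, j)" "(i, k)"] by auto
  qed
  ultimately show ?thesis by blast
qed

lemma product_topology_box:
  fixes V :: "'z \<Rightarrow> 'k::metric_space set"
  assumes "finite Z" "openin (product_topology (\<lambda>z. subtopology euclidean (V z)) Z) W" "k \<in> W"
  shows "\<exists>\<epsilon>>0. \<forall>y\<in>Pi\<^sub>E Z V. (\<forall>z\<in>Z. dist (y z) (k z) < \<epsilon>) \<longrightarrow> y \<in> W"
proof -
  obtain U where U: "\<And>z. z \<in> Z \<Longrightarrow> openin (subtopology euclidean (V z)) (U z)"
    "k \<in> Pi\<^sub>E Z U" "Pi\<^sub>E Z U \<subseteq> W"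
    using assms(2,3) unfolding openin_product_topology_alt by meson
  have "\<exists>e>0. \<forall>v\<in>V z. dist v (k z) < e \<longrightarrow> v \<in> U z" if z: "z \<in> Z" for z
  proof -
    have "k z \<in> U z" using U(2) z by (rule PiE_mem)
    then show ?thesis using U(1)[OF z] by (auto simp: openin_euclidean_subtopology_iff)
  qed
  then obtain e where e: "\<And>z. z \<in> Z \<Longrightarrow> 0 < e z"
    "\<And>z v. \<lbrakk>z \<in> Z; v \<in> V z; dist v (k z) < e z\<rbrakk> \<Longrightarrow> v \<in> U z" by metis
  obtain \<epsilon> where \<epsilon>: "\<epsilon> > 0" "\<forall>z\<in>Z. \<epsilon> \<le> e z"
    using finite_ex_positive_lower_bound[OF assms(1), of e] e(1) by blast
  have "y \<in> W" if y: "y \<in> Pi\<^sub>E Z V" "\<forall>z\<in>Z. dist (y z) (k z) < \<epsilon>" for y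
  proof -
    have "y \<in> Pi\<^sub>E Z U"
    proof (rule PiE_I)
      fix z assume z: "z \<in> Z"
      show "y z \<in> U z" using e(2)[OF z PiE_mem[OF y(1) z]] y(2) \<epsilon>(2) z by force
    qed (rule PiE_arb[OF y(1)])
    then show ?thesis using U(3) by blast
  qed
  with \<epsilon>(1) show ?thesis by blast
qed

lemma openin_product_topology_box:
  fixes V :: "'z \<Rightarrow> 'k::metric_space set"
  assumes "finite Z"
  shows "openin (product_topology (\<lambda>z. subtopology euclidean (V z)) Z)
    {y \<in> Pi\<^sub>E Z V. \<forall>z\<in>Z. dist (y z) (k z) < \<epsilon>}"
proof -
  have eq: "{y \<in> Pi\<^sub>E Z V. \<forall>z\<in>Z. dist (y z) (k z) < \<epsilon>} = Pi\<^sub>E Z (\<lambda>z. V z \<inter> ball (k z) \<epsilon>)"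
    by (rule set_eqI) (simp only: mem_Collect_eq PiE_iff Int_iff mem_ball dist_commute[of "k _"], blast)
  have "openin (subtopology euclidean (V z)) (V z \<inter> ball (k z) \<epsilon>)" for z
    by (auto simp: openin_subtopology intro!: exI[of _ "ball (k z) \<epsilon>"])
  then show ?thesis
    unfolding eq using assms by (subst openin_PiE) auto
qed

text \<open>A Lebesgue number for radii prescribed point by point: a finite subcover has a positive
  least radius.\<close>

lemma product_topology_box_cover:
  fixes V :: "'z \<Rightarrow> 'k::metric_space set"
  assumes Z: "finite Z" and C: "compactin (product_topology (\<lambda>z. subtopology euclidean (V z)) Z) C"
    and e: "\<And>k. k \<in> C \<Longrightarrow> (0::real) < e k"
  shows "\<exists>\<epsilon>>0. \<forall>x\<in>C. \<exists>k\<in>C. \<epsilon> \<le> e k \<and> (\<forall>z\<in>Z. dist (x z) (k z) < e k)"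
proof -
  let ?X = "product_topology (\<lambda>z. subtopology euclidean (V z)) Z"
  let ?N = "\<lambda>k. {y \<in> Pi\<^sub>E Z V. \<forall>z\<in>Z. dist (y z) (k z) < e k}"
  have CV: "C \<subseteq> Pi\<^sub>E Z V" using compactin_subset_topspace[OF C] by simp
  have cover: "C \<subseteq> \<Union> (?N ` C)"
  proof
    fix k assume k: "k \<in> C"
    then have "k \<in> ?N k" using e[OF k] CV by auto
    then show "k \<in> \<Union> (?N ` C)" using k by blast
  qed
  have box: "openin ?X W" if "W \<in> ?N ` C" for W using that openin_product_topology_box[OF Z] by blast
  have "\<exists>\<F>. finite \<F> \<and> \<F> \<subseteq> ?N ` C \<and> C \<subseteq> \<Union> \<F>"
    by (rule compactinD[OF C _ cover]) (rule box)
  then obtain \<F> where \<F>: "finite \<F>" "\<F> \<subseteq> ?N ` C" "C \<subseteq> \<Union> \<F>"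
    by (elim exE conjE) (rule that)
  obtain F where F: "F \<subseteq> C" "finite F" "\<F> = ?N ` F"
    using finite_subset_image[OF \<F>(1,2)] by blast
  obtain \<epsilon> where \<epsilon>: "\<epsilon> > 0" "\<forall>k\<in>F. \<epsilon> \<le> e k"
    using finite_ex_positive_lower_bound[OF F(2), of e] e F(1) by blast
  have "\<exists>k\<in>C. \<epsilon> \<le> e k \<and> (\<forall>z\<in>Z. dist (x z) (k z) < e k)" if "x \<in> C" for x
  proof -
    have "x \<in> \<Union> (?N ` F)" using that \<F>(3) F(3) by (simp only: subsetD)
    then obtain k where "k \<in> F" "x \<in> ?N k" by blast
    then show ?thesis using F(1) \<epsilon>(2) by (intro bexI[of _ k]) auto
  qed
  with \<epsilon>(1) show ?thesis by (intro exI[of _ \<epsilon>] conjI ballI)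
qed

lemma distinct_points_inj:
  assumes "x \<in> distinct_points I V \<gamma>" "i \<in> I"
  shows "inj_on (\<lambda>j. x (i, j)) {..\<gamma> i}"
proof (rule inj_onI)
  fix j k assume jk: "j \<in> {..\<gamma> i}" "k \<in> {..\<gamma> i}" "x (i, j) = x (i, k)"
  have ne: "x (i, j) \<noteq> x (i, k)" if "j < k" "k \<le> \<gamma> i" for j k
    using assms that by (simp add: distinct_points_def)
  show "j = k"
  proof (rule ccontr)
    assume "j \<noteq> k"
    then show False using ne[of j k] ne[of k j] jk by (cases "j < k") auto
  qed
qed

text \<open>The bridge from tuples of nodes to sets of nodes. The base point has no influence,
  because the coordinates in \<open>I\<close> are overridden and all others are cut off by
  \<open>restrict\<close>.\<close>

lemma divided_difference_eq_mdd:
  assumes "finite I" and inj: "\<And>i. i \<in> I \<Longrightarrow> inj_on (\<lambda>j. x (i, j)) {..\<gamma> i}"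
  shows "divided_difference smul I \<gamma> f x =
    mdd smul I (\<lambda>i. (\<lambda>j. x (i, j)) ` {..\<gamma> i}) (\<lambda>y. f (restrict y I)) (\<lambda>_. undefined)"
proof -
  let ?S = "\<lambda>i. (\<lambda>j. x (i, j)) ` {..\<gamma> i}"
  let ?h = "\<lambda>j. \<lambda>i\<in>I. x (i, j i)"
  have img: "Pi\<^sub>E I ?S = ?h ` (\<Pi>\<^sub>E i\<in>I. {..\<gamma> i})"
  proof (intro equalityI subsetI)
    fix s assume s: "s \<in> Pi\<^sub>E I ?S"
    then have "\<forall>i\<in>I. \<exists>j. j \<in> {..\<gamma> i} \<and> s i = x (i, j)" by (auto dest!: PiE_mem)
    then obtain j where j: "\<And>i. i \<in> I \<Longrightarrow> j i \<in> {..\<gamma> i} \<and> s i = x (i, j i)" by metis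
    have "s = ?h (restrict j I)"
      by (rule extensionalityI[of _ I]) (use s j in \<open>auto simp: PiE_def\<close>)
    then show "s \<in> ?h ` (\<Pi>\<^sub>E i\<in>I. {..\<gamma> i})" using j by (intro image_eqI[of _ _ "restrict j I"]) auto
  qed (auto intro!: imageI dest: PiE_mem)
  have inj_h: "inj_on ?h (\<Pi>\<^sub>E i\<in>I. {..\<gamma> i})"
  proof (rule inj_onI)
    fix j k assume jk: "j \<in> (\<Pi>\<^sub>E i\<in>I. {..\<gamma> i})" "k \<in> (\<Pi>\<^sub>E i\<in>I. {..\<gamma> i})" "?h j = ?h k"
    show "j = k"
    proof (rule PiE_ext[OF jk(1,2)])
      fix i assume i: "i \<in> I"
      then have "x (i, j i) = x (i, k i)" using fun_cong[OF jk(3), of i] by simp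
      then show "j i = k i" using inj_onD[OF inj[OF i]] jk(1,2) i by (auto dest: PiE_mem)
    qed
  qed
  have "mdd smul I ?S (\<lambda>y. f (restrict y I)) (\<lambda>_. undefined) = (\<Sum>j\<in>(\<Pi>\<^sub>E i\<in>I. {..\<gamma> i}).
      smul (\<Prod>i\<in>I. node_weight (?S i) (?h j i)) (f (restrict (override_on (\<lambda>_. undefined) (?h j) I) I)))"
    unfolding mdd_def img by (subst sum.reindex[OF inj_h]) simp
  also have "\<dots> = divided_difference smul I \<gamma> f x"
    unfolding divided_difference_def
  proof (rule sum.cong[OF refl])
    fix j assume j: "j \<in> (\<Pi>\<^sub>E i\<in>I. {..\<gamma> i})"
    have "node_weight (?S i) (?h j i) = (\<Prod>k\<in>{..\<gamma> i} - {j i}. 1 / (x (i, j i) - x (i, k)))" if i: "i \<in> I" for i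
    proof -
      have "?S i - {?h j i} = (\<lambda>k. x (i, k)) ` ({..\<gamma> i} - {j i})"
        using i PiE_mem[OF j i] inj_onD[OF inj[OF i]] by auto
      moreover have "inj_on (\<lambda>k. x (i, k)) ({..\<gamma> i} - {j i})"
        using inj[OF i] by (rule inj_on_subset) auto
      ultimately show ?thesis using i by (simp add: node_weight_def prod.reindex)
    qed
    moreover have "restrict (override_on (\<lambda>_. undefined) (?h j) I) I = ?h j"
      by (auto simp: override_on_def)
    ultimately show "smul (\<Prod>i\<in>I. node_weight (?S i) (?h j i)) (f (restrict (override_on (\<lambda>_. undefined) (?h j) I) I)) =
        smul (\<Prod>i\<in>I. \<Prod>k\<in>{..\<gamma> i} - {j i}. 1 / (x (i, j i) - x (i, k))) (f (?h j))"
      by (simp only: cong: prod.cong)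
  qed
  finally show ?thesis by simp
qed

text \<open>Continuous functions into a Hausdorff space are determined by their values on the dense
  set of tuples with distinct entries.\<close>

lemma extends_divided_difference_unique:
  fixes smul :: "'k::ultrametric_field \<Rightarrow> 'e::{ab_group_add, t2_space} \<Rightarrow> 'e"
  assumes "finite I" "cartesian_factors I V"
    and g: "extends_divided_difference smul I V \<gamma> f g" and h: "extends_divided_difference smul I V \<gamma> f h"
  shows "g = h"
proof (rule extensionalityI)
  let ?X = "multi_space I V \<gamma>"
  show "g \<in> extensional (topspace ?X)" "h \<in> extensional (topspace ?X)"
    using g h by (auto simp: extends_divided_difference_def continuous_functions_def)
  fix x assume x: "x \<in> topspace ?X"
  show "g x = h x"
  proof (rule ccontr)
    assume "g x \<noteq> h x"
    then obtain A B where AB: "open A" "open B" "g x \<in> A" "h x \<in> B" "A \<inter> B = {}" by (meson hausdorff)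
    let ?W = "{y \<in> topspace ?X. g y \<in> A} \<inter> {y \<in> topspace ?X. h y \<in> B}"
    have cont: "continuous_map ?X euclidean g" "continuous_map ?X euclidean h"
      using g h by (auto simp: extends_divided_difference_def continuous_functions_def)
    then have "openin ?X ?W"
      using AB(1,2) by (intro openin_Int openin_continuous_map_preimage) (auto simp flip: open_openin)
    moreover have "x \<in> ?W" using x AB by blast
    ultimately obtain y where "y \<in> ?W" "y \<in> distinct_points I V \<gamma>"
      using multi_space_nonisolated_dense[OF assms(1,2)] by blast
    then show False using g h AB(5) by (auto simp: extends_divided_difference_def)
  qed
qed

lemma extended_divided_difference_eq:
  fixes smul :: "'k::ultrametric_field \<Rightarrow> 'e::{ab_group_add, t2_space} \<Rightarrow> 'e"
  assumes "finite I" "cartesian_factors I V" "extends_divided_difference smul I V \<gamma> f g"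
  shows "extended_divided_difference smul I V \<gamma> f = g"
  unfolding extended_divided_difference_def
  using assms extends_divided_difference_unique[OF assms(1,2)] by blast

context ultrametric_lcs
begin

text \<open>The continuous extension is defined at coinciding nodes too, so it is uniformly
  continuous near the whole compact product of the sets \<open>K i\<close>. Restricted to distinct
  nodes this is the oscillation condition for the order \<gamma>.\<close>

lemma dd_oscillation_within_if_extends:
  fixes V K :: "'i \<Rightarrow> 'k set"
  assumes I: "finite I" and ext: "extends_divided_difference smul I V \<gamma> f g"
    and K: "\<And>i. i \<in> I \<Longrightarrow> compact (K i) \<and> K i \<subseteq> V i"
    and Q: "unit_ball_submodule smul Q" "open Q"
  shows "\<exists>\<epsilon>>0. dd_oscillation_within I V (\<lambda>S. \<forall>i\<in>I. card (S i) = Suc (\<gamma> i))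
    (\<lambda>y. f (restrict y I)) (\<lambda>_. undefined) K Q \<epsilon>"
proof -
  let ?X = "multi_space I V \<gamma>" and ?\<Sigma> = "SIGMA i:I. {..\<gamma> i}"
  let ?K = "Pi\<^sub>E ?\<Sigma> (\<lambda>z. K (fst z))"
  have cont: "continuous_map ?X euclidean g" and ext': "\<And>x. x \<in> distinct_points I V \<gamma> \<Longrightarrow> g x = divided_difference smul I \<gamma> f x"
    using ext by (auto simp: extends_divided_difference_def continuous_functions_def)
  have X: "?X = product_topology (\<lambda>z. subtopology euclidean (V (fst z))) ?\<Sigma>"
    by (simp add: multi_space_def case_prod_unfold)
  have top: "topspace ?X = Pi\<^sub>E ?\<Sigma> (\<lambda>z. V (fst z))" by (simp add: X)
  have fin: "finite ?\<Sigma>" using I by auto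
  have compK: "compactin ?X ?K"
    unfolding X compactin_PiE
    using K by (auto simp: compactin_subtopology)
  have "\<exists>e>0. \<forall>y\<in>topspace ?X. (\<forall>z\<in>?\<Sigma>. dist (y z) (k z) < e) \<longrightarrow> g y - g k \<in> Q" if k: "k \<in> ?K" for k
  proof -
    have "open ((\<lambda>v. v - g k) -` Q)" using Q(2) by (intro open_vimage continuous_intros)
    then have "openin ?X {y \<in> topspace ?X. g y \<in> (\<lambda>v. v - g k) -` Q}"
      using cont by (intro openin_continuous_map_preimage) (auto simp flip: open_openin)
    moreover have "k \<in> topspace ?X" using k compactin_subset_topspace[OF compK] by blast
    ultimately have "\<exists>e>0. \<forall>y\<in>Pi\<^sub>E ?\<Sigma> (\<lambda>z. V (fst z)). (\<forall>z\<in>?\<Sigma>. dist (y z) (k z) < e) \<longrightarrow>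
        y \<in> {y \<in> topspace ?X. g y \<in> (\<lambda>v. v - g k) -` Q}"
      unfolding X using submodule_0[OF Q(1)] by (intro product_topology_box[OF fin]) auto
    then show ?thesis unfolding top by simp
  qed
  then obtain e where e: "\<And>k. k \<in> ?K \<Longrightarrow> 0 < e k"
    and eQ: "\<And>k y. \<lbrakk>k \<in> ?K; y \<in> topspace ?X; \<forall>z\<in>?\<Sigma>. dist (y z) (k z) < e k\<rbrakk> \<Longrightarrow> g y - g k \<in> Q"
    by metis
  have "\<exists>\<epsilon>>0. \<forall>x\<in>?K. \<exists>k\<in>?K. \<epsilon> \<le> e k \<and> (\<forall>z\<in>?\<Sigma>. dist (x z) (k z) < e k)"
    by (rule product_topology_box_cover[OF fin compK[unfolded X] e])
  then obtain \<epsilon> where \<epsilon>: "\<epsilon> > 0"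
    and cover: "\<forall>x\<in>?K. \<exists>k\<in>?K. \<epsilon> \<le> e k \<and> (\<forall>z\<in>?\<Sigma>. dist (x z) (k z) < e k)" by blast
  have main: "mdd smul I S (\<lambda>y. f (restrict y I)) (\<lambda>_. undefined) - mdd smul I S' (\<lambda>y. f (restrict y I)) (\<lambda>_. undefined) \<in> Q"
    if S: "\<forall>i\<in>I. finite (S i) \<and> S i \<noteq> {} \<and> S i \<subseteq> V i \<inter> near (K i) \<epsilon> \<and>
        finite (S' i) \<and> S' i \<subseteq> V i \<and> card (S' i) = card (S i) \<and>
        (S i = S' i \<or> (\<forall>s\<in>S i. \<forall>s'\<in>S' i. dist s s' < \<epsilon>))"
      and card: "\<forall>i\<in>I. card (S i) = Suc (\<gamma> i)" for S S'
  proof -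
    \<comment> \<open>Any enumeration will do: the oscillation condition compares every node of
      \<open>S i\<close> with every node of \<open>S' i\<close>, and equal sets receive equal
      enumerations.\<close>
    define enum where "enum T = (\<lambda>(i, j)\<in>?\<Sigma>. from_nat_into (T i) j)" for T :: "'i \<Rightarrow> 'k set"
    have bij: "bij_betw (\<lambda>j. enum T (i, j)) {..\<gamma> i} (T i)"
      if "i \<in> I" "finite (T i)" "card (T i) = Suc (\<gamma> i)" for T i
    proof -
      have "bij_betw (from_nat_into (T i)) {..<card (T i)} (T i)"
        using that(2) by (rule bij_betw_from_nat_into_finite)
      then show ?thesis using that
        by (subst bij_betw_cong[of _ _ "from_nat_into (T i)"]) (auto simp: enum_def lessThan_Suc_atMost)
    qed
    have mdd: "enum T \<in> distinct_points I V \<gamma>" "mdd smul I T (\<lambda>y. f (restrict y I)) (\<lambda>_. undefined) = g (enum T)"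
      if T: "\<And>i. i \<in> I \<Longrightarrow> finite (T i) \<and> card (T i) = Suc (\<gamma> i) \<and> T i \<subseteq> V i" for T
    proof -
      have b: "bij_betw (\<lambda>j. enum T (i, j)) {..\<gamma> i} (T i)" if "i \<in> I" for i using bij T that by blast
      have "enum T \<in> Pi\<^sub>E ?\<Sigma> (\<lambda>z. V (fst z))"
      proof (rule PiE_I)
        fix z assume "z \<in> ?\<Sigma>"
        then show "enum T z \<in> V (fst z)" using b T bij_betwE by fastforce
      qed (simp add: enum_def)
      moreover have "enum T (i, j) \<noteq> enum T (i, k)" if "i \<in> I" "j < k" "k \<le> \<gamma> i" for i j k
        using bij_betw_imp_inj_on[OF b[OF that(1)]] that(2,3) by (auto dest: inj_onD[of _ _ j k])
      ultimately show dp: "enum T \<in> distinct_points I V \<gamma>"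
        by (auto simp: distinct_points_def topspace_multi_space case_prod_unfold)
      have "mdd smul I T (\<lambda>y. f (restrict y I)) (\<lambda>_. undefined) =
          mdd smul I (\<lambda>i. (\<lambda>j. enum T (i, j)) ` {..\<gamma> i}) (\<lambda>y. f (restrict y I)) (\<lambda>_. undefined)"
        by (rule mdd_cong) (use b in \<open>auto simp: bij_betw_def\<close>)
      then show "mdd smul I T (\<lambda>y. f (restrict y I)) (\<lambda>_. undefined) = g (enum T)"
        by (simp only: divided_difference_eq_mdd[OF I distinct_points_inj[OF dp]] ext'[OF dp])
    qed
    have TS: "finite (S i) \<and> card (S i) = Suc (\<gamma> i) \<and> S i \<subseteq> V i"
      "finite (S' i) \<and> card (S' i) = Suc (\<gamma> i) \<and> S' i \<subseteq> V i" if "i \<in> I" for i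
      using S card that by auto
    have mem: "enum S z \<in> S (fst z)" "enum S' z \<in> S' (fst z)" if z: "z \<in> ?\<Sigma>" for z
    proof -
      obtain i j where ij: "z = (i, j)" "i \<in> I" "j \<in> {..\<gamma> i}" using z by blast
      show "enum S z \<in> S (fst z)" "enum S' z \<in> S' (fst z)"
        using bij_betw_apply[OF bij[of i S] ij(3)] bij_betw_apply[OF bij[of i S'] ij(3)] TS[OF ij(2)] ij(1,2)
        by simp_all
    qed
    have "\<exists>k. k \<in> K (fst z) \<and> dist (enum S z) k < \<epsilon>" if z: "z \<in> ?\<Sigma>" for z
    proof -
      have "S (fst z) \<subseteq> near (K (fst z)) \<epsilon>" using S z by auto
      then show ?thesis using mem(1)[OF z] by (auto simp: near_def)
    qed
    then obtain k0 where k0: "\<And>z. z \<in> ?\<Sigma> \<Longrightarrow> k0 z \<in> K (fst z) \<and> dist (enum S z) (k0 z) < \<epsilon>" by metis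
    then have "restrict k0 ?\<Sigma> \<in> ?K" by auto
    from bspec[OF cover this] obtain l where lK: "l \<in> ?K" and l: "\<epsilon> \<le> e l"
      "\<forall>z\<in>?\<Sigma>. dist (restrict k0 ?\<Sigma> z) (l z) < e l" by (elim bexE conjE) (rule that)
    have d1: "dist (enum S z) (l z) < e l" if z: "z \<in> ?\<Sigma>" for z
    proof -
      have "dist (k0 z) (l z) < e l" using bspec[OF l(2) z] z by simp
      moreover have "dist (enum S z) (k0 z) < e l" using k0[OF z] l(1) by linarith
      ultimately show ?thesis using dist_ultrametric_less by blast
    qed
    have d2: "dist (enum S' z) (l z) < e l" if z: "z \<in> ?\<Sigma>" for z
    proof -
      have "fst z \<in> I" using z by auto
      from bspec[OF S this] have "S (fst z) = S' (fst z) \<or> (\<forall>s\<in>S (fst z). \<forall>s'\<in>S' (fst z). dist s s' < \<epsilon>)"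
        by (elim conjE)
      then have "S (fst z) = S' (fst z) \<or> dist (enum S z) (enum S' z) < \<epsilon>"
        using mem[OF z] by blast
      then have "dist (enum S z) (enum S' z) < \<epsilon>"
      proof
        assume "S (fst z) = S' (fst z)"
        then have "enum S z = enum S' z" using z by (simp add: enum_def case_prod_unfold)
        then show ?thesis using \<epsilon> by simp
      qed
      then have "dist (enum S' z) (enum S z) < e l" using l(1) by (simp add: dist_commute)
      then show ?thesis using d1[OF z] dist_ultrametric_less by blast
    qed
    have enum_top: "enum S \<in> topspace ?X" "enum S' \<in> topspace ?X"
      using mdd(1)[of S] mdd(1)[of S'] TS by (auto simp: distinct_points_def)
    have "g (enum S) - g l \<in> Q" by (rule eQ[OF lK enum_top(1)]) (intro ballI d1)
    moreover have "g (enum S') - g l \<in> Q" by (rule eQ[OF lK enum_top(2)]) (intro ballI d2)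
    ultimately have "(g (enum S) - g l) - (g (enum S') - g l) \<in> Q" by (rule submodule_diff[OF Q(1)])
    then show ?thesis using mdd(2)[of S] mdd(2)[of S'] TS by simp
  qed
  show ?thesis
    unfolding dd_oscillation_within_def
    by (intro exI[of _ \<epsilon>] conjI \<epsilon> allI impI) (rule main, assumption+)
qed

end

section \<open>Divided differences of polynomials at coinciding nodes\<close>

lemma continuous_map_euclidean_compose2:
  assumes "continuous_on UNIV (\<lambda>(x, y). h x y)"
    and "continuous_map X euclidean f" "continuous_map X euclidean g"
  shows "continuous_map X euclidean (\<lambda>x. h (f x) (g x))"
proof -
  have "continuous_map X (prod_topology euclidean euclidean) (\<lambda>x. (f x, g x))"
    by (intro continuous_map_pairedI assms(2,3))
  then have pair: "continuous_map X euclidean (\<lambda>x. (f x, g x))" by simp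
  have "continuous_map euclidean euclidean (\<lambda>(x, y). h x y)" using assms(1) by simp
  from continuous_map_compose[OF pair this] show ?thesis by (simp add: o_def)
qed

lemma continuous_on_ultrametric_mult: "continuous_on UNIV (\<lambda>(x, y). x * y :: 'k::ultrametric_field)"
  unfolding continuous_on_def
proof (intro ballI)
  fix z :: "'k \<times> 'k"
  obtain a b where z: "z = (a, b)" by force
  let ?bound = "\<lambda>w. dist (fst w) 0 * dist (snd w) b + dist (fst w) a * dist b 0"
  have "(?bound \<longlongrightarrow> dist (fst z) 0 * dist (snd z) b + dist (fst z) a * dist b 0) (at z within UNIV)"
    by (intro tendsto_intros)
  then have lim: "(?bound \<longlongrightarrow> 0) (at z within UNIV)" by (simp add: z)
  have le: "dist (case w of (x, y) \<Rightarrow> x * y) (a * b) \<le> ?bound w" for w :: "'k \<times> 'k"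
  proof -
    obtain x y where w: "w = (x, y)" by force
    have "x * y - a * b = x * (y - b) + (x - a) * b" by (simp add: algebra_simps)
    then have "abs_value (x * y - a * b) \<le> max (abs_value (x * (y - b))) (abs_value ((x - a) * b))"
      using abs_value_ultrametric by metis
    also have "\<dots> \<le> abs_value (x * (y - b)) + abs_value ((x - a) * b)" by simp
    finally show ?thesis by (simp add: w dist_abs_value abs_value_mult)
  qed
  have "((\<lambda>w. dist (case w of (x, y) \<Rightarrow> x * y) (a * b)) \<longlongrightarrow> 0) (at z within UNIV)"
    by (rule tendsto_sandwich[OF always_eventually always_eventually tendsto_const lim]) (simp, blast intro: le)
  then show "((\<lambda>(x, y). x * y) \<longlongrightarrow> (case z of (x, y) \<Rightarrow> x * y)) (at z within UNIV)"
    by (subst tendsto_dist_iff) (simp only: z prod.case)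
qed

lemma continuous_on_ultrametric_add: "continuous_on UNIV (\<lambda>(x, y). x + y :: 'k::ultrametric_field)"
  unfolding continuous_on_def
proof (intro ballI)
  fix z :: "'k \<times> 'k"
  obtain a b where z: "z = (a, b)" by force
  let ?bound = "\<lambda>w. dist (fst w) a + dist (snd w) b"
  have "(?bound \<longlongrightarrow> dist (fst z) a + dist (snd z) b) (at z within UNIV)"
    by (intro tendsto_intros)
  then have lim: "(?bound \<longlongrightarrow> 0) (at z within UNIV)" by (simp add: z)
  have le: "dist (case w of (x, y) \<Rightarrow> x + y) (a + b) \<le> ?bound w" for w :: "'k \<times> 'k"
  proof -
    obtain x y where w: "w = (x, y)" by force
    have "x + y - (a + b) = (x - a) + (y - b)" by (simp add: algebra_simps)
    then have "abs_value (x + y - (a + b)) \<le> max (abs_value (x - a)) (abs_value (y - b))"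
      using abs_value_ultrametric by metis
    also have "\<dots> \<le> abs_value (x - a) + abs_value (y - b)" by simp
    finally show ?thesis by (simp add: w dist_abs_value)
  qed
  have "((\<lambda>w. dist (case w of (x, y) \<Rightarrow> x + y) (a + b)) \<longlongrightarrow> 0) (at z within UNIV)"
    by (rule tendsto_sandwich[OF always_eventually always_eventually tendsto_const lim]) (simp, blast intro: le)
  then show "((\<lambda>(x, y). x + y) \<longlongrightarrow> (case z of (x, y) \<Rightarrow> x + y)) (at z within UNIV)"
    by (subst tendsto_dist_iff) (simp only: z prod.case)
qed

lemma continuous_map_ultrametric_prod:
  fixes f :: "'i \<Rightarrow> 'a \<Rightarrow> 'k::ultrametric_field"
  assumes "\<And>i. i \<in> I \<Longrightarrow> continuous_map X euclidean (f i)"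
  shows "continuous_map X euclidean (\<lambda>x. \<Prod>i\<in>I. f i x)"
  using assms
  by (induction I rule: infinite_finite_induct)
    (auto intro!: continuous_map_euclidean_compose2[OF continuous_on_ultrametric_mult])

lemma continuous_map_group_sum:
  fixes f :: "'i \<Rightarrow> 'a \<Rightarrow> 'e::topological_ab_group_add"
  assumes "\<And>i. i \<in> I \<Longrightarrow> continuous_map X euclidean (f i)"
  shows "continuous_map X euclidean (\<lambda>x. \<Sum>i\<in>I. f i x)"
proof -
  have "continuous_on UNIV (\<lambda>(x, y). x + y :: 'e)"
    unfolding case_prod_unfold by (intro continuous_intros)
  note add = continuous_map_euclidean_compose2[OF this]
  show ?thesis using assms
    by (induction I rule: infinite_finite_induct) (auto intro!: add)
qed

text \<open>The complete homogeneous symmetric polynomial of degree \<open>m - k\<close> in \<open>t 0, \<dots>, t k\<close>, which is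
  zero for \<open>m < k\<close>.\<close>

primrec homogeneous_sum :: "nat \<Rightarrow> nat \<Rightarrow> (nat \<Rightarrow> 'k::comm_ring_1) \<Rightarrow> 'k" where
  "homogeneous_sum 0 k t = (if k = 0 then 1 else 0)"
| "homogeneous_sum (Suc m) k t = t k * homogeneous_sum m k t +
     (case k of 0 \<Rightarrow> 0 | Suc k' \<Rightarrow> homogeneous_sum m k' t)"

text \<open>Differences of a monomial are polynomials in the nodes and so extend continuously to
  coinciding nodes. Splitting \<open>x ^ Suc m\<close> at the last node reproduces the recursion of
  \<open>homogeneous_sum\<close>.\<close>

lemma scalar_dd_power:
  fixes t :: "nat \<Rightarrow> 'k::field"
  assumes "inj_on t {..k}"
  shows "scalar_dd (t ` {..k}) (\<lambda>x. x ^ m) = homogeneous_sum m k t"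
  using assms
proof (induction m arbitrary: k)
  case 0
  have "card (t ` {..k}) = Suc k" using 0 by (simp add: card_image)
  then show ?case by (simp add: vector_space_over_itself.point_dd_const)
next
  case (Suc m)
  have "scalar_dd (t ` {..k}) (\<lambda>x. x ^ Suc m) =
      scalar_dd (t ` {..k}) (\<lambda>x. (x - t k) * x ^ m + t k * x ^ m)"
    by (rule vector_space_over_itself.point_dd_cong) (simp add: algebra_simps)
  also have "\<dots> = scalar_dd (t ` {..k} - {t k}) (\<lambda>x. x ^ m) + t k * scalar_dd (t ` {..k}) (\<lambda>x. x ^ m)"
    by (simp only: vector_space_over_itself.point_dd_add vector_space_over_itself.point_dd_scale
        vector_space_over_itself.point_dd_linear_factor finite_imageI finite_atMost imageI atMost_iff order_refl)
  also have "t ` {..k} - {t k} = t ` {..<k}"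
  proof -
    have "{..k} = insert k {..<k}" by auto
    moreover have "t k \<notin> t ` {..<k}" using inj_onD[OF Suc.prems, of k] by force
    ultimately show ?thesis by auto
  qed
  also have "scalar_dd (t ` {..<k}) (\<lambda>x. x ^ m) = (case k of 0 \<Rightarrow> 0 | Suc k' \<Rightarrow> homogeneous_sum m k' t)"
  proof (cases k)
    case (Suc k')
    have "inj_on t {..k'}" using Suc.prems Suc by (auto intro: inj_on_subset)
    from Suc.IH[OF this] show ?thesis using Suc by (simp add: lessThan_Suc_atMost)
  qed simp
  finally show ?case using Suc.IH[OF Suc.prems] by (simp add: add.commute)
qed

lemma continuous_map_homogeneous_sum:
  fixes f :: "nat \<Rightarrow> 'a \<Rightarrow> 'k::ultrametric_field"
  assumes "\<And>j. j \<le> k \<Longrightarrow> continuous_map X euclidean (f j)"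
  shows "continuous_map X euclidean (\<lambda>x. homogeneous_sum m k (\<lambda>j. f j x))"
  using assms
proof (induction m arbitrary: k)
  case (Suc m)
  then show ?case
    by (cases k) (auto intro!: continuous_map_euclidean_compose2[OF continuous_on_ultrametric_add]
        continuous_map_euclidean_compose2[OF continuous_on_ultrametric_mult])
qed simp

text \<open>For a property closed under intersections and supersets it is enough to look at the
  subbasic sets containing \<open>f\<close>. It is used with \<open>P W\<close> saying that
  \<open>W\<close> contains a neighbourhood of \<open>f\<close> of a prescribed form.\<close>

lemma generate_topology_on_local_property:
  assumes "generate_topology_on \<S> W" "f \<in> W"
    and "\<And>W. \<lbrakk>W \<in> \<S>; f \<in> W\<rbrakk> \<Longrightarrow> P W"
    and "\<And>W W'. \<lbrakk>P W; P W'\<rbrakk> \<Longrightarrow> P (W \<inter> W')" "\<And>W W'. \<lbrakk>P W; W \<subseteq> W'\<rbrakk> \<Longrightarrow> P W'"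
  shows "P W"
  using assms(1,2)
proof induction
  case (UN \<W>)
  then obtain W where "W \<in> \<W>" "f \<in> W" by blast
  then show ?case using UN.IH assms(5)[of W "\<Union> \<W>"] by blast
qed (use assms in auto)

context ultrametric_lcs
begin

lemma Pol_extends:
  assumes I: "finite I" and V: "Pi\<^sub>E I V \<subseteq> U" and p: "p \<in> Pol smul I U"
  shows "\<exists>g. extends_divided_difference smul I V \<gamma> p g"
proof -
  obtain B a where p: "p = (\<lambda>x\<in>U. \<Sum>\<beta>\<in>B. smul (\<Prod>i\<in>I. x i ^ \<beta> i) (a \<beta>))"
    using p unfolding Pol_def by blast
  let ?X = "multi_space I V \<gamma>"
  \<comment> \<open>The extension is explicit: in each coordinate the monomial is replaced by its
    difference, a complete homogeneous symmetric polynomial in the nodes.\<close>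
  define h where "h x = (\<Sum>\<beta>\<in>B. smul (\<Prod>i\<in>I. homogeneous_sum (\<beta> i) (\<gamma> i) (\<lambda>j. x (i, j))) (a \<beta>))"
    for x :: "'a \<times> nat \<Rightarrow> 'k"
  have proj: "continuous_map ?X euclidean (\<lambda>x. x (i, j))" if "i \<in> I" "j \<le> \<gamma> i" for i j
  proof -
    have "continuous_map ?X (subtopology euclidean (V i)) (\<lambda>x. x (i, j))"
      using continuous_map_product_projection[of "(i, j)" "SIGMA i:I. {..\<gamma> i}"
          "\<lambda>(i, j). subtopology euclidean (V i)"] that by (simp add: multi_space_def)
    then show ?thesis by (rule continuous_map_into_fulltopology)
  qed
  have "continuous_map ?X euclidean h"
    unfolding h_def
    by (intro continuous_map_group_sum continuous_map_euclidean_compose2[OF continuous_smul]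
        continuous_map_ultrametric_prod continuous_map_homogeneous_sum proj) auto
  then have "continuous_map ?X euclidean (restrict h (topspace ?X))"
    by (rule continuous_map_eq) simp
  then have "restrict h (topspace ?X) \<in> continuous_functions ?X euclidean"
    by (simp add: continuous_functions_def)
  moreover have "h x = divided_difference smul I \<gamma> p x" if x: "x \<in> distinct_points I V \<gamma>" for x
  proof -
    let ?S = "\<lambda>i. (\<lambda>j. x (i, j)) ` {..\<gamma> i}"
    note inj = distinct_points_inj[OF x]
    have "x \<in> Pi\<^sub>E (SIGMA i:I. {..\<gamma> i}) (\<lambda>(i, j). V i)"
      using x by (simp add: distinct_points_def topspace_multi_space)
    then have SV: "?S i \<subseteq> V i" if "i \<in> I" for i using that by (auto dest: PiE_mem)
    have "divided_difference smul I \<gamma> p x = mdd smul I ?S (\<lambda>y. p (restrict y I)) (\<lambda>_. undefined)"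
      by (rule divided_difference_eq_mdd[OF I inj])
    also have "\<dots> = mdd smul I ?S (\<lambda>y. \<Sum>\<beta>\<in>B. smul (\<Prod>i\<in>I. y i ^ \<beta> i) (a \<beta>)) (\<lambda>_. undefined)"
    proof (rule mdd_cong[OF refl])
      fix y assume y: "\<And>i. i \<in> I \<Longrightarrow> y i \<in> ?S i"
      have "\<forall>i\<in>I. y i \<in> V i" by (intro ballI subsetD[OF SV y])
      then have "restrict y I \<in> U" by (intro subsetD[OF V]) (simp add: restrict_PiE_iff)
      then show "p (restrict y I) = (\<Sum>\<beta>\<in>B. smul (\<Prod>i\<in>I. y i ^ \<beta> i) (a \<beta>))"
        by (simp add: p cong: prod.cong)
    qed
    also have "\<dots> = h x"
      unfolding mdd_sum h_def
    proof (rule sum.cong[OF refl])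
      fix \<beta>
      have "mdd smul I ?S (\<lambda>y. smul (\<Prod>i\<in>I. y i ^ \<beta> i) (a \<beta>)) (\<lambda>_. undefined) =
          smul (\<Prod>i\<in>I. scalar_dd (?S i) (\<lambda>t. t ^ \<beta> i)) (a \<beta>)"
        using mdd_tensor[OF I, of ?S "\<lambda>_. undefined" "\<lambda>_. a \<beta>" "\<lambda>i t. t ^ \<beta> i"] by simp
      then show "mdd smul I ?S (\<lambda>y. smul (\<Prod>i\<in>I. y i ^ \<beta> i) (a \<beta>)) (\<lambda>_. undefined) =
          smul (\<Prod>i\<in>I. homogeneous_sum (\<beta> i) (\<gamma> i) (\<lambda>j. x (i, j))) (a \<beta>)"
        using scalar_dd_power[OF inj] by (simp cong: prod.cong)
    qed
    finally show ?thesis by simp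
  qed
  ultimately show ?thesis
    unfolding extends_divided_difference_def
    by (intro exI[of _ "restrict h (topspace ?X)"]) (auto simp: distinct_points_def)
qed

lemma cartesian_charts_subset: "V \<in> cartesian_charts I U \<Longrightarrow> Pi\<^sub>E I V \<subseteq> U"
  unfolding cartesian_charts_def using openin_subset[of "subtopology (power_space I) U"] by fastforce

lemma Pol_subset_C_eta:
  assumes "finite I"
  shows "Pol smul I U \<subseteq> C_eta smul I U \<eta>"
proof
  fix p assume p: "p \<in> Pol smul I U"
  show "p \<in> C_eta smul I U \<eta>"
    unfolding C_eta_def
  proof (intro CollectI conjI ballI)
    show "p \<in> extensional U" using p by (auto simp: Pol_def)
  qed (rule Pol_extends[OF assms cartesian_charts_subset p])
qed

text \<open>The compact image of \<open>K\<close> under \<open>h\<close> is covered by finitely many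
  cosets \<open>v + Q v\<close> contained in the prescribed open set. As each \<open>Q v\<close> is
  a submodule, a perturbation lying in all of them leaves every value in its coset.\<close>

lemma compact_open_neighbourhood:
  assumes "openin (compact_open_topology X (euclidean :: 'e topology)) W" "h \<in> W"
  shows "\<exists>K Q. compactin X K \<and> unit_ball_submodule smul Q \<and> open Q \<and>
    (\<forall>h'\<in>continuous_functions X euclidean. (\<forall>k\<in>K. h' k - h k \<in> Q) \<longrightarrow> h' \<in> W)"
proof (rule generate_topology_on_local_property[where f = h and W = W])
  show "generate_topology_on {{f \<in> continuous_functions X euclidean. f ` K \<subseteq> W} |K W. compactin X K \<and> openin euclidean W} W"
    using assms(1) unfolding compact_open_topology_def openin_topology_generated_by_iff .
next
  fix S assume "S \<in> {{f \<in> continuous_functions X euclidean. f ` K \<subseteq> W} |K W. compactin X K \<and> openin euclidean (W :: 'e set)}"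
    and h: "h \<in> S"
  then obtain K W where S: "S = {f \<in> continuous_functions X euclidean. f ` K \<subseteq> W}"
    and K: "compactin X K" and W: "open W" by (auto simp flip: open_openin)
  have hK: "compact (h ` K)"
    using h K image_compactin[of X K euclidean h] by (auto simp: S continuous_functions_def)
  have "\<exists>Q. open Q \<and> unit_ball_submodule smul Q \<and> (\<forall>q\<in>Q. v + q \<in> W)" if "v \<in> h ` K" for v
  proof -
    have "open ((\<lambda>q. v + q) -` W)" using W by (intro open_vimage continuous_intros)
    moreover have "v \<in> W" using h that by (auto simp: S)
    then have "0 \<in> (\<lambda>q. v + q) -` W" by simp
    ultimately obtain Q where "open Q" "Q \<subseteq> (\<lambda>q. v + q) -` W" "unit_ball_submodule smul Q"
      using locally_convex by blast
    then show ?thesis by blast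
  qed
  then obtain Q where Q: "\<And>v. v \<in> h ` K \<Longrightarrow> open (Q v)" "\<And>v. v \<in> h ` K \<Longrightarrow> unit_ball_submodule smul (Q v)"
    "\<And>v q. \<lbrakk>v \<in> h ` K; q \<in> Q v\<rbrakk> \<Longrightarrow> v + q \<in> W" by metis
  have op: "open ((\<lambda>w. w - v) -` Q v)" if "v \<in> h ` K" for v
    using Q(1)[OF that] by (intro open_vimage continuous_intros)
  have cover: "h ` K \<subseteq> (\<Union>v\<in>h ` K. (\<lambda>w. w - v) -` Q v)"
  proof
    fix v assume v: "v \<in> h ` K"
    then have "v \<in> (\<lambda>w. w - v) -` Q v" using submodule_0[OF Q(2)[OF v]] by simp
    with v show "v \<in> (\<Union>v\<in>h ` K. (\<lambda>w. w - v) -` Q v)" by (rule UN_I)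
  qed
  obtain F where F: "F \<subseteq> h ` K" "finite F" "h ` K \<subseteq> (\<Union>v\<in>F. (\<lambda>w. w - v) -` Q v)"
    by (rule compactE_image[OF hK op cover])
  define R where "R = (\<Inter>v\<in>F. Q v)"
  have "unit_ball_submodule smul R" using Q(2) F(1) by (auto simp: R_def unit_ball_submodule_def)
  moreover have "open R" unfolding R_def using F(1,2) Q(1) by (intro open_INT) auto
  moreover have "h' \<in> S" if h': "h' \<in> continuous_functions X euclidean" "\<forall>k\<in>K. h' k - h k \<in> R" for h'
  proof -
    have "h' k \<in> W" if "k \<in> K" for k
    proof -
      have "h k \<in> (\<Union>v\<in>F. (\<lambda>w. w - v) -` Q v)" using F(3) that by blast
      then obtain v where v: "v \<in> F" "h k - v \<in> Q v" by auto
      have vK: "v \<in> h ` K" using v(1) F(1) by (rule subsetD[rotated])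
      have "h' k - h k \<in> Q v" using bspec[OF h'(2) that] v(1) unfolding R_def by (rule INT_D)
      then have "(h' k - h k) + (h k - v) \<in> Q v" using v(2) by (rule submodule_add[OF Q(2)[OF vK]])
      then have "h' k - v \<in> Q v" by simp
      from Q(3)[OF vK this] have "v + (h' k - v) \<in> W" .
      then show ?thesis by simp
    qed
    then show ?thesis using h'(1) by (auto simp: S)
  qed
  ultimately show "\<exists>K Q. compactin X K \<and> unit_ball_submodule smul Q \<and> open Q \<and>
    (\<forall>h'\<in>continuous_functions X euclidean. (\<forall>k\<in>K. h' k - h k \<in> Q) \<longrightarrow> h' \<in> S)"
    using K by blast
next
  fix W W'
  assume "\<exists>K Q. compactin X K \<and> unit_ball_submodule smul Q \<and> open Q \<and>
      (\<forall>h'\<in>continuous_functions X euclidean. (\<forall>k\<in>K. h' k - h k \<in> Q) \<longrightarrow> h' \<in> W)"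
    and "\<exists>K Q. compactin X K \<and> unit_ball_submodule smul Q \<and> open Q \<and>
      (\<forall>h'\<in>continuous_functions X euclidean. (\<forall>k\<in>K. h' k - h k \<in> Q) \<longrightarrow> h' \<in> W')"
  then obtain K Q K' Q' where "compactin X K" "unit_ball_submodule smul Q" "open Q"
    "compactin X K'" "unit_ball_submodule smul Q'" "open Q'"
    and W: "\<forall>h'\<in>continuous_functions X euclidean. (\<forall>k\<in>K. h' k - h k \<in> Q) \<longrightarrow> h' \<in> W"
    and W': "\<forall>h'\<in>continuous_functions X euclidean. (\<forall>k\<in>K'. h' k - h k \<in> Q') \<longrightarrow> h' \<in> W'"
    by (elim exE conjE) (rule that)
  then have "compactin X (K \<union> K')" "unit_ball_submodule smul (Q \<inter> Q')" "open (Q \<inter> Q')"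
    by (auto simp: compactin_Un unit_ball_submodule_def)
  moreover have "\<forall>h'\<in>continuous_functions X euclidean. (\<forall>k\<in>K \<union> K'. h' k - h k \<in> Q \<inter> Q') \<longrightarrow> h' \<in> W \<inter> W'"
    using W W' by simp
  ultimately show "\<exists>K Q. compactin X K \<and> unit_ball_submodule smul Q \<and> open Q \<and>
      (\<forall>h'\<in>continuous_functions X euclidean. (\<forall>k\<in>K. h' k - h k \<in> Q) \<longrightarrow> h' \<in> W \<inter> W')"
    by (intro exI conjI)
next
  fix W W'
  assume "\<exists>K Q. compactin X K \<and> unit_ball_submodule smul Q \<and> open Q \<and>
      (\<forall>h'\<in>continuous_functions X euclidean. (\<forall>k\<in>K. h' k - h k \<in> Q) \<longrightarrow> h' \<in> W)" "W \<subseteq> W'"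
  then show "\<exists>K Q. compactin X K \<and> unit_ball_submodule smul Q \<and> open Q \<and>
      (\<forall>h'\<in>continuous_functions X euclidean. (\<forall>k\<in>K. h' k - h k \<in> Q) \<longrightarrow> h' \<in> W')"
    by (meson subsetD)
qed (rule assms(2))

end

section \<open>Approximation on charts\<close>

lemma cball_eq_ultrametric:
  fixes c :: "'k::ultrametric_field"
  assumes "y \<in> cball c r"
  shows "cball y r = cball c r"
  using assms dist_ultrametric_le[of y c r] dist_ultrametric_le[of c y r] by (auto simp: dist_commute)

lemma open_cball_ultrametric:
  fixes c :: "'k::ultrametric_field"
  assumes "0 < r"
  shows "open (cball c r)"
  unfolding open_contains_ball
proof
  fix y assume "y \<in> cball c r"
  then have "ball y r \<subseteq> cball c r" using cball_eq_ultrametric[of y c r] ball_subset_cball[of y r] by simp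
  with assms show "\<exists>e>0. ball y e \<subseteq> cball c r" by blast
qed

text \<open>Closed balls of positive radius are open, so the smaller product stays relatively open
  in \<open>U\<close>, and intersecting with an open set creates no isolated points.\<close>

lemma chart_Int_cball:
  fixes V :: "'i \<Rightarrow> 'k::ultrametric_field set"
  assumes I: "finite I" and V: "V \<in> cartesian_charts I U" and r: "0 < r"
  shows "(\<lambda>i. V i \<inter> cball (y i) r) \<in> cartesian_charts I U"
proof -
  let ?C = "\<lambda>i. cball (y i) r"
  have iso: "\<not> x isolated_in (V i \<inter> ?C i)" if "i \<in> I" for i x
  proof
    assume "x isolated_in (V i \<inter> ?C i)"
    then obtain T where T: "x \<in> V i" "open T" "T \<inter> (V i \<inter> ?C i) = {x}"
      by (auto simp: isolated_in_def)
    then have "open (T \<inter> ?C i)" "(T \<inter> ?C i) \<inter> V i = {x}"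
      using open_cball_ultrametric[OF r] by (auto intro: open_Int)
    then have "x isolated_in V i" using T(1) unfolding isolated_in_def by blast
    then show False using V that by (auto simp: cartesian_charts_def cartesian_factors_def)
  qed
  have "openin (power_space I) (Pi\<^sub>E I ?C)"
    unfolding power_space_def using I open_cball_ultrametric[OF r] by (subst openin_PiE) auto
  moreover obtain T where "openin (power_space I) T" "Pi\<^sub>E I V = T \<inter> U"
    using V by (auto simp: cartesian_charts_def openin_subtopology)
  ultimately have "openin (power_space I) (T \<inter> Pi\<^sub>E I ?C)" "Pi\<^sub>E I V \<inter> Pi\<^sub>E I ?C = (T \<inter> Pi\<^sub>E I ?C) \<inter> U"
    by (auto intro: openin_Int)
  then have "openin (subtopology (power_space I) U) (Pi\<^sub>E I V \<inter> Pi\<^sub>E I ?C)"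
    unfolding openin_subtopology by (intro exI conjI)
  with iso show ?thesis
    by (simp add: cartesian_charts_def cartesian_factors_def PiE_Int)
qed

text \<open>A chart is \<open>T \<inter> U\<close> with \<open>T\<close> open, and by compactness
  all boxes of small radius around points of the product of the \<open>K i\<close> lie in
  \<open>T\<close>. So on such a box the chart is described by \<open>U\<close> alone, which makes
  different charts comparable.\<close>

lemma ex_chart_radius:
  fixes V :: "'i \<Rightarrow> 'k::ultrametric_field set"
  assumes I: "finite I" and V: "V \<in> cartesian_charts I U"
    and K: "\<And>i. i \<in> I \<Longrightarrow> compact (K i) \<and> K i \<subseteq> V i"
  shows "\<exists>r>0. \<forall>y\<in>Pi\<^sub>E I K. \<forall>\<rho>. 0 < \<rho> \<longrightarrow> \<rho> < r \<longrightarrow>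
    U \<inter> Pi\<^sub>E I (\<lambda>i. cball (y i) \<rho>) = Pi\<^sub>E I (\<lambda>i. V i \<inter> cball (y i) \<rho>)"
proof -
  have P: "power_space I = product_topology (\<lambda>i. subtopology euclidean (UNIV :: 'k set)) I"
    by (simp add: power_space_def)
  obtain T where T: "openin (power_space I) T" "Pi\<^sub>E I V = T \<inter> U"
    using V by (auto simp: cartesian_charts_def openin_subtopology)
  have comp: "compactin (power_space I) (Pi\<^sub>E I K)"
    unfolding power_space_def compactin_PiE using K by auto
  have KV: "Pi\<^sub>E I K \<subseteq> Pi\<^sub>E I V" using K by (intro PiE_mono) blast
  have "\<exists>e>0. \<forall>x\<in>Pi\<^sub>E I (\<lambda>_. UNIV). (\<forall>i\<in>I. dist (x i) (k i) < e) \<longrightarrow> x \<in> T" if "k \<in> Pi\<^sub>E I K" for k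
    using T KV that unfolding P by (intro product_topology_box[OF I]) auto
  then obtain e where e: "\<And>k. k \<in> Pi\<^sub>E I K \<Longrightarrow> 0 < e k"
    and eT: "\<And>k. k \<in> Pi\<^sub>E I K \<Longrightarrow> \<forall>x\<in>Pi\<^sub>E I (\<lambda>_. UNIV). (\<forall>i\<in>I. dist (x i) (k i) < e k) \<longrightarrow> x \<in> T"
    by metis
  have "\<exists>r>0. \<forall>x\<in>Pi\<^sub>E I K. \<exists>k\<in>Pi\<^sub>E I K. r \<le> e k \<and> (\<forall>i\<in>I. dist (x i) (k i) < e k)"
    by (rule product_topology_box_cover[OF I comp[unfolded P] e])
  then obtain r where r: "r > 0" and cover: "\<forall>x\<in>Pi\<^sub>E I K. \<exists>k\<in>Pi\<^sub>E I K. r \<le> e k \<and> (\<forall>i\<in>I. dist (x i) (k i) < e k)"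
    by (elim exE conjE) (rule that)
  have "U \<inter> Pi\<^sub>E I (\<lambda>i. cball (y i) \<rho>) = Pi\<^sub>E I (\<lambda>i. V i \<inter> cball (y i) \<rho>)"
    if y: "y \<in> Pi\<^sub>E I K" and \<rho>: "0 < \<rho>" "\<rho> < r" for y \<rho>
  proof (intro equalityI subsetI)
    fix x assume x: "x \<in> U \<inter> Pi\<^sub>E I (\<lambda>i. cball (y i) \<rho>)"
    from bspec[OF cover y] obtain k where k: "k \<in> Pi\<^sub>E I K" "r \<le> e k" "\<forall>i\<in>I. dist (y i) (k i) < e k"
      by (elim bexE conjE) (rule that)
    have "dist (x i) (k i) < e k" if "i \<in> I" for i
    proof -
      have "dist (x i) (y i) < e k" using x that \<rho>(2) k(2) by (auto simp: dist_commute PiE_iff)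
      then show ?thesis using bspec[OF k(3) that] by (rule dist_ultrametric_less)
    qed
    then have "x \<in> T" using bspec[OF eT[OF k(1)], of x] x by (auto simp: PiE_iff)
    then have "x \<in> Pi\<^sub>E I V" using x T(2) by blast
    with x show "x \<in> Pi\<^sub>E I (\<lambda>i. V i \<inter> cball (y i) \<rho>)" by (auto simp: PiE_iff)
  next
    fix x assume "x \<in> Pi\<^sub>E I (\<lambda>i. V i \<inter> cball (y i) \<rho>)"
    then have "x \<in> Pi\<^sub>E I V" "x \<in> Pi\<^sub>E I (\<lambda>i. cball (y i) \<rho>)" by (auto simp: PiE_iff)
    then show "x \<in> U \<inter> Pi\<^sub>E I (\<lambda>i. cball (y i) \<rho>)" using T(2) by blast
  qed
  with r show ?thesis by (intro exI[of _ r] conjI ballI allI impI)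
qed

context ultrametric_lcs
begin

text \<open>The complement is a union of cosets of \<open>Q\<close>.\<close>

lemma closed_submodule:
  assumes "unit_ball_submodule smul Q" "open Q"
  shows "closed Q"
proof -
  have "- Q = (\<Union>v\<in>- Q. (\<lambda>w. w - v) -` Q)"
  proof (intro equalityI subsetI)
    fix v assume "v \<in> - Q"
    then show "v \<in> (\<Union>v\<in>- Q. (\<lambda>w. w - v) -` Q)"
      using submodule_0[OF assms(1)] by (intro UN_I[of v]) auto
  next
    fix w assume "w \<in> (\<Union>v\<in>- Q. (\<lambda>w. w - v) -` Q)"
    then obtain v where v: "v \<notin> Q" "w - v \<in> Q" by auto
    have "v = w - (w - v)" by simp
    then show "w \<in> - Q" using submodule_diff[OF assms(1), of w "w - v"] v by auto
  qed
  moreover have "open (\<Union>v\<in>- Q. (\<lambda>w. w - v) -` Q)"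
    using assms(2) by (intro open_UN ballI open_vimage continuous_intros)
  ultimately show ?thesis by (simp add: closed_def)
qed

lemma dd_oscillation_within_mono:
  assumes "dd_oscillation_within I X P f x K Q \<epsilon>'" "\<epsilon> \<le> \<epsilon>'"
    and "\<And>S. P' S \<Longrightarrow> (\<forall>i\<in>I. finite (S i) \<and> S i \<noteq> {}) \<Longrightarrow> P S"
  shows "dd_oscillation_within I X P' f x K Q \<epsilon>"
  unfolding dd_oscillation_within_def
proof (intro allI impI)
  fix S S' assume S: "\<forall>i\<in>I. finite (S i) \<and> S i \<noteq> {} \<and> S i \<subseteq> X i \<inter> near (K i) \<epsilon> \<and>
      finite (S' i) \<and> S' i \<subseteq> X i \<and> card (S' i) = card (S i) \<and>
      (S i = S' i \<or> (\<forall>s\<in>S i. \<forall>s'\<in>S' i. dist s s' < \<epsilon>))" and P': "P' S"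
  show "mdd smul I S f x - mdd smul I S' f x \<in> Q"
  proof (rule assms(1)[unfolded dd_oscillation_within_def, rule_format])
    fix i assume i: "i \<in> I"
    have "near (K i) \<epsilon> \<subseteq> near (K i) \<epsilon>'" by (rule near_mono[OF order_refl assms(2)])
    moreover have "dist s s' < \<epsilon>'" if "dist s s' < \<epsilon>" for s s' :: 'k using that assms(2) by simp
    ultimately show "finite (S i) \<and> S i \<noteq> {} \<and> S i \<subseteq> X i \<inter> near (K i) \<epsilon>' \<and>
      finite (S' i) \<and> S' i \<subseteq> X i \<and> card (S' i) = card (S i) \<and>
      (S i = S' i \<or> (\<forall>s\<in>S i. \<forall>s'\<in>S' i. dist s s' < \<epsilon>'))"
      using bspec[OF S i] by auto
  qed (rule assms(3)[OF P'], use S in simp)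
qed

text \<open>Only finitely many orders obey the bounds \<open>a\<close>, so the least of their
  oscillation radii serves all of them.\<close>

lemma dd_uniformly_continuous_if_extends:
  fixes B :: "'j \<Rightarrow> 'i set" and X :: "'i \<Rightarrow> 'k set"
  assumes R: "finite R" and B: "\<And>j. j \<in> R \<Longrightarrow> finite (B j)"
    and ext: "\<And>\<gamma>. \<lbrakk>\<gamma> \<in> (\<Union>j\<in>R. B j) \<rightarrow>\<^sub>E UNIV; \<And>j. j \<in> R \<Longrightarrow> (\<Sum>i\<in>B j. \<gamma> i) \<le> a j\<rbrakk> \<Longrightarrow>
      \<exists>g. extends_divided_difference smul (\<Union>j\<in>R. B j) X \<gamma> f g"
  shows "dd_uniformly_continuous (\<Union>j\<in>R. B j) X (block_order R B a)
    (\<lambda>y. f (restrict y (\<Union>j\<in>R. B j))) (\<lambda>_. undefined)"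
  unfolding dd_uniformly_continuous_def
proof (intro allI impI)
  fix K Q
  let ?I = "\<Union>j\<in>R. B j"
  let ?f = "\<lambda>y. f (restrict y ?I)" and ?x = "\<lambda>_. undefined"
  assume K: "\<forall>i\<in>?I. compact (K i) \<and> K i \<subseteq> X i" and Q: "unit_ball_submodule smul Q" "open Q"
  have I: "finite ?I" using R B by simp
  define \<Gamma> where "\<Gamma> = {\<gamma> \<in> ?I \<rightarrow>\<^sub>E UNIV. \<forall>j\<in>R. (\<Sum>i\<in>B j. \<gamma> i) \<le> a j}"
  have "\<Gamma> \<subseteq> (\<Pi>\<^sub>E i\<in>?I. {..\<Sum>j\<in>R. a j})"
  proof
    fix \<gamma> assume \<gamma>: "\<gamma> \<in> \<Gamma>"
    have "\<gamma> i \<le> (\<Sum>j\<in>R. a j)" if i: "i \<in> ?I" for i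
    proof -
      obtain j where j: "j \<in> R" "i \<in> B j" using i by blast
      have "\<gamma> i \<le> (\<Sum>i\<in>B j. \<gamma> i)" using member_le_sum[OF j(2), of \<gamma>] B[OF j(1)] by simp
      also have "\<dots> \<le> a j" using \<gamma> j(1) by (simp add: \<Gamma>_def)
      also have "\<dots> \<le> (\<Sum>j\<in>R. a j)" using member_le_sum[OF j(1), of a] R by simp
      finally show ?thesis .
    qed
    then show "\<gamma> \<in> (\<Pi>\<^sub>E i\<in>?I. {..\<Sum>j\<in>R. a j})" using \<gamma> by (simp add: \<Gamma>_def PiE_iff)
  qed
  then have fin: "finite \<Gamma>" by (rule finite_subset) (use I in \<open>auto intro: finite_PiE\<close>)
  define osc where "osc \<gamma> \<epsilon> \<longleftrightarrow> dd_oscillation_within ?I X (\<lambda>S. \<forall>i\<in>?I. card (S i) = Suc (\<gamma> i)) ?f ?x K Q \<epsilon>"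
    for \<gamma> \<epsilon>
  have "\<exists>\<epsilon>>0. osc \<gamma> \<epsilon>" if "\<gamma> \<in> \<Gamma>" for \<gamma>
  proof -
    have "\<gamma> \<in> ?I \<rightarrow>\<^sub>E UNIV" "\<forall>j\<in>R. (\<Sum>i\<in>B j. \<gamma> i) \<le> a j" using that by (simp_all add: \<Gamma>_def)
    then have "\<exists>g. extends_divided_difference smul ?I X \<gamma> f g" by (intro ext) auto
    then obtain g where "extends_divided_difference smul ?I X \<gamma> f g" by (rule exE)
    then show ?thesis unfolding osc_def by (rule dd_oscillation_within_if_extends[OF I _ _ Q]) (rule bspec[OF K])
  qed
  then obtain e where e: "\<And>\<gamma>. \<gamma> \<in> \<Gamma> \<Longrightarrow> 0 < e \<gamma>"
    and osc: "\<And>\<gamma>. \<gamma> \<in> \<Gamma> \<Longrightarrow> osc \<gamma> (e \<gamma>)"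
    by metis
  have "\<exists>\<epsilon>>0. \<forall>\<gamma>\<in>\<Gamma>. \<epsilon> \<le> e \<gamma>" by (rule finite_ex_positive_lower_bound[OF fin e])
  then obtain \<epsilon> where \<epsilon>: "\<epsilon> > 0" "\<forall>\<gamma>\<in>\<Gamma>. \<epsilon> \<le> e \<gamma>" by (elim exE conjE) (rule that)
  have "dd_oscillation_within ?I X (block_order R B a) ?f ?x K Q \<epsilon>"
    unfolding dd_oscillation_within_def
  proof (intro allI impI)
    fix S S' assume S: "\<forall>i\<in>?I. finite (S i) \<and> S i \<noteq> {} \<and> S i \<subseteq> X i \<inter> near (K i) \<epsilon> \<and>
        finite (S' i) \<and> S' i \<subseteq> X i \<and> card (S' i) = card (S i) \<and>
        (S i = S' i \<or> (\<forall>s\<in>S i. \<forall>s'\<in>S' i. dist s s' < \<epsilon>))" and ord: "block_order R B a S"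
    define \<gamma> where "\<gamma> = (\<lambda>i\<in>?I. card (S i) - 1)"
    have card: "card (S i) = Suc (\<gamma> i)" if "i \<in> ?I" for i
    proof -
      have "0 < card (S i)" using bspec[OF S that] by (simp add: card_gt_0_iff)
      then show ?thesis using that by (simp add: \<gamma>_def)
    qed
    have "(\<Sum>i\<in>B j. \<gamma> i) \<le> a j" if j: "j \<in> R" for j
    proof -
      have "(\<Sum>i\<in>B j. card (S i)) = (\<Sum>i\<in>B j. Suc (\<gamma> i))" using card j by (intro sum.cong) auto
      also have "\<dots> = (\<Sum>i\<in>B j. \<gamma> i) + card (B j)" by (rule sum_Suc)
      finally show ?thesis using bspec[OF ord[unfolded block_order_def] j] by linarith
    qed
    then have "\<gamma> \<in> \<Gamma>" by (simp add: \<Gamma>_def \<gamma>_def)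
    then have "dd_oscillation_within ?I X (\<lambda>S. \<forall>i\<in>?I. card (S i) = Suc (\<gamma> i)) ?f ?x K Q \<epsilon>"
      using dd_oscillation_within_mono[OF osc[OF \<open>\<gamma> \<in> \<Gamma>\<close>, unfolded osc_def]] \<epsilon>(2) by simp
    from this[unfolded dd_oscillation_within_def, THEN spec[of _ S], THEN spec[of _ S'], THEN mp[OF _ S]] card
    show "mdd smul ?I S ?f ?x - mdd smul ?I S' ?f ?x \<in> Q" by simp
  qed
  with \<epsilon>(1) show "\<exists>\<epsilon>>0. dd_oscillation_within ?I X (block_order R B a) ?f ?x K Q \<epsilon>"
    by (intro exI[of _ \<epsilon>] conjI)
qed

end

text \<open>A point within \<epsilon> \<le> \<open>r\<close> of a point of the ball lies in the same
  ball.\<close>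

lemma near_Int_cball:
  fixes c :: "'k::ultrametric_field"
  assumes "S \<subseteq> near K \<epsilon>" "S \<subseteq> cball c r" "\<epsilon> \<le> r"
  shows "S \<subseteq> near (K \<inter> cball c r) \<epsilon>"
proof
  fix s assume s: "s \<in> S"
  then obtain k where k: "k \<in> K" "dist s k < \<epsilon>" using assms(1) by (auto simp: near_def)
  have "dist c s \<le> r" "dist s k \<le> r" using s assms(2,3) k(2) by auto
  then have "k \<in> cball c r" using dist_ultrametric_le[of c s r k] by simp
  with k show "s \<in> near (K \<inter> cball c r) \<epsilon>" unfolding near_def by blast
qed

context ultrametric_lcs
begin

text \<open>One polynomial has to work for all charts in \<open>D\<close>. On each box of a
  separated cover the charts entering it agree, so a single sum of tensors approximates
  \<open>f\<close> there; these sums are cut off and glued, and the result, again a sum of tensors,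
  is approximated by a polynomial.\<close>

lemma polynomial_approximation:
  fixes B :: "'j \<Rightarrow> 'i set" and V K :: "'d \<Rightarrow> 'i \<Rightarrow> 'k set"
  assumes R: "finite R" and B: "\<And>j. j \<in> R \<Longrightarrow> finite (B j)" and disj: "disjoint_family_on B R"
    and I: "I = (\<Union>j\<in>R. B j)"
    and D: "finite D" and V: "\<And>d. d \<in> D \<Longrightarrow> V d \<in> cartesian_charts I U"
    and K: "\<And>d i. \<lbrakk>d \<in> D; i \<in> I\<rbrakk> \<Longrightarrow> compact (K d i) \<and> K d i \<subseteq> V d i"
    and ext: "\<And>X \<gamma>. \<lbrakk>X \<in> cartesian_charts I U; \<gamma> \<in> I \<rightarrow>\<^sub>E UNIV; \<And>j. j \<in> R \<Longrightarrow> (\<Sum>i\<in>B j. \<gamma> i) \<le> a j\<rbrakk> \<Longrightarrow>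
      \<exists>g. extends_divided_difference smul I X \<gamma> f g"
    and Q: "unit_ball_submodule smul Q" "open Q"
  shows "\<exists>p\<in>polynomial_functions I. \<exists>\<epsilon>>0. \<forall>d\<in>D. \<forall>S.
    (\<forall>i\<in>I. finite (S i) \<and> S i \<noteq> {} \<and> S i \<subseteq> V d i \<inter> near (K d i) \<epsilon>) \<longrightarrow> block_order R B a S \<longrightarrow>
    mdd smul I S (\<lambda>y. f (restrict y I) - p y) (\<lambda>_. undefined) \<in> Q"
proof -
  let ?f = "\<lambda>y. f (restrict y I)" and ?x = "\<lambda>_::'i. undefined :: 'k"
  have finI: "finite I" using R B by (simp add: I)
  define chart where "chart d r \<longleftrightarrow> (\<forall>y\<in>Pi\<^sub>E I (K d). \<forall>\<rho>. 0 < \<rho> \<longrightarrow> \<rho> < r \<longrightarrow>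
      U \<inter> Pi\<^sub>E I (\<lambda>i. cball (y i) \<rho>) = Pi\<^sub>E I (\<lambda>i. V d i \<inter> cball (y i) \<rho>))" for d r
  have "\<exists>r>0. chart d r" if "d \<in> D" for d
    unfolding chart_def by (rule ex_chart_radius[OF finI V[OF that] K[OF that]])
  then obtain rad where rad: "\<And>d. d \<in> D \<Longrightarrow> 0 < rad d" and chart: "\<And>d. d \<in> D \<Longrightarrow> chart d (rad d)"
    by metis
  have "\<exists>r>0. \<forall>d\<in>D. r \<le> rad d" by (rule finite_ex_positive_lower_bound[OF D rad])
  then obtain r where r: "r > 0" "\<forall>d\<in>D. r \<le> rad d" by (elim exE conjE) (rule that)
  obtain \<pi> :: 'k where \<pi>: "\<pi> \<noteq> 0" "abs_value \<pi> < min r 1"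
    by (rule ex_small_scalar[of "min r 1"]) (use r in auto)
  let ?\<rho> = "abs_value \<pi>"
  have \<rho>: "0 < ?\<rho>" "?\<rho> \<le> 1" "\<And>d. d \<in> D \<Longrightarrow> ?\<rho> < rad d" using \<pi> r(2) by force+
  define L where "L i = (\<Union>d\<in>D. K d i)" for i
  have L: "compact (L i)" if "i \<in> I" for i
    unfolding L_def using D K that by (intro compact_UN) auto
  define separated_cover where "separated_cover i C \<longleftrightarrow> finite C \<and> L i \<subseteq> (\<Union>c\<in>C. cball c ?\<rho>) \<and>
    (\<forall>c\<in>C. \<forall>d\<in>C. c \<noteq> d \<longrightarrow> ?\<rho> < dist c d)" for i C
  have "\<exists>C. separated_cover i C" if i: "i \<in> I" for i
    using compact_separated_cover[OF L[OF i] \<rho>(1)] unfolding separated_cover_def by metis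
  then obtain C where sc: "\<And>i. i \<in> I \<Longrightarrow> separated_cover i (C i)" by metis
  have C: "\<And>i. i \<in> I \<Longrightarrow> finite (C i)" "\<And>i. i \<in> I \<Longrightarrow> L i \<subseteq> (\<Union>c\<in>C i. cball c ?\<rho>)"
    "\<And>i c d. \<lbrakk>i \<in> I; c \<in> C i; d \<in> C i; c \<noteq> d\<rbrakk> \<Longrightarrow> ?\<rho> < dist c d"
    using sc unfolding separated_cover_def by simp_all
  define N where "N = (\<Sum>j\<in>R. a j + card (B j))"
  \<comment> \<open>This is \<open>Q\<close> scaled by \<open>\<pi> ^ N\<close>. The radius |\<pi>|
    is fixed before any approximation is made, so the loss in gluing, at most \<open>N\<close>
    factors, can be paid in advance.\<close>
  define Q' where "Q' = {v. smul (inverse (\<pi> ^ N)) v \<in> Q}"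
  have Q': "unit_ball_submodule smul Q'" "open Q'"
    unfolding Q'_def by (rule submodule_vimage[OF Q(1)], rule open_scale_vimage[OF Q(2)])
  have sumN: "(\<Sum>i\<in>I. card (S i)) \<le> N" if "block_order R B a S" for S :: "'i \<Rightarrow> 'k set"
  proof -
    have "(\<Sum>i\<in>I. card (S i)) = (\<Sum>j\<in>R. \<Sum>i\<in>B j. card (S i))"
      unfolding I using R B disj by (intro sum.UNION_disjoint_family) auto
    also have "\<dots> \<le> N" unfolding N_def using that by (intro sum_mono) (simp add: block_order_def)
    finally show ?thesis .
  qed
  define meets where "meets c d \<longleftrightarrow> (\<forall>i\<in>I. K d i \<inter> cball (c i) ?\<rho> \<noteq> {})" for c d
  \<comment> \<open>All compact sets entering the box are collected, so that one function serves
    every chart meeting it.\<close>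
  define Kc where "Kc c i = (\<Union>d\<in>{d \<in> D. meets c d}. K d i \<inter> cball (c i) ?\<rho>)" for c i
  define close where "close c t e \<longleftrightarrow> (\<forall>d\<in>D. \<forall>S. meets c d \<longrightarrow>
      (\<forall>i\<in>I. finite (S i) \<and> S i \<noteq> {} \<and> S i \<subseteq> V d i \<inter> cball (c i) ?\<rho> \<inter> near (Kc c i) e) \<longrightarrow>
      block_order R B a S \<longrightarrow> mdd smul I S (\<lambda>y. ?f y - t y) ?x \<in> Q')" for c t e
  have "\<exists>t e. t \<in> locpoly_tensors I \<and> 0 < e \<and> close c t e" for c
  proof (cases "\<exists>d\<in>D. meets c d")
    case False
    \<comment> \<open>Nothing is required on a box that no chart meets through its compact
      sets.\<close>
    then have "close c (\<lambda>_. 0) 1" by (auto simp: close_def)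
    moreover have "(\<lambda>_. 0) \<in> locpoly_tensors I" by (rule locpoly_tensors.zero)
    ultimately show ?thesis by (metis zero_less_one)
  next
    case True
    then obtain d where d: "d \<in> D" "meets c d" by blast
    define X where "X i = V d i \<inter> cball (c i) ?\<rho>" for i
    have X: "X \<in> cartesian_charts I U"
      unfolding X_def[abs_def] by (rule chart_Int_cball[OF finI V[OF d(1)] \<rho>(1)])
    have "\<forall>i\<in>I. \<exists>y. y \<in> K d i \<inter> cball (c i) ?\<rho>" using d(2) unfolding meets_def by blast
    then obtain y where y: "\<And>i. i \<in> I \<Longrightarrow> y i \<in> K d i \<inter> cball (c i) ?\<rho>" by metis
    have "restrict y I \<in> Pi\<^sub>E I (K d)" using y by simp
    from chart[OF d(1), unfolded chart_def, rule_format, OF this \<rho>(1) \<rho>(3)[OF d(1)]]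
    have "U \<inter> Pi\<^sub>E I (\<lambda>i. cball (restrict y I i) ?\<rho>) = Pi\<^sub>E I (\<lambda>i. V d i \<inter> cball (restrict y I i) ?\<rho>)" .
    moreover have ceq: "cball (restrict y I i) ?\<rho> = cball (c i) ?\<rho>" if "i \<in> I" for i
      using y[OF that] that cball_eq_ultrametric[of "y i" "c i" ?\<rho>] by simp
    ultimately have PX: "Pi\<^sub>E I X = U \<inter> Pi\<^sub>E I (\<lambda>i. cball (c i) ?\<rho>)"
      by (simp add: X_def cong: PiE_cong)
    \<comment> \<open>A grid in another chart and in the box lies in \<open>U\<close> and in the
      box, hence in the product of the \<open>X i\<close>; as the grid is not empty, the inclusion
      holds factor by factor.\<close>
    have sub: "S i \<subseteq> X i" if d': "d' \<in> D" and S: "\<forall>i\<in>I. S i \<noteq> {} \<and> S i \<subseteq> V d' i \<inter> cball (c i) ?\<rho>" and i: "i \<in> I"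
      for d' S i
    proof -
      have "Pi\<^sub>E I S \<subseteq> Pi\<^sub>E I (V d')" "Pi\<^sub>E I S \<subseteq> Pi\<^sub>E I (\<lambda>i. cball (c i) ?\<rho>)"
        using S by (intro PiE_mono; simp)+
      then have "Pi\<^sub>E I S \<subseteq> Pi\<^sub>E I X" unfolding PX using cartesian_charts_subset[OF V[OF d']] by blast
      moreover have "Pi\<^sub>E I S \<noteq> {}" using S by (simp add: PiE_eq_empty_iff)
      ultimately show ?thesis using i by (simp add: subset_PiE)
    qed
    have KcX: "compact (Kc c i) \<and> Kc c i \<subseteq> X i" if i: "i \<in> I" for i
    proof
      show "compact (Kc c i)"
        unfolding Kc_def using D K i by (intro compact_UN compact_Int_closed) auto
      have "K d' i \<inter> cball (c i) ?\<rho> \<subseteq> X i" if "d' \<in> D" "meets c d'" for d'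
        by (rule sub[OF that(1), of "\<lambda>i. K d' i \<inter> cball (c i) ?\<rho>", OF _ i])
          (use that K[OF that(1)] in \<open>auto simp: meets_def\<close>)
      then show "Kc c i \<subseteq> X i" unfolding Kc_def by blast
    qed
    have "dd_uniformly_continuous I X (block_order R B a) ?f ?x"
      unfolding I
    proof (rule dd_uniformly_continuous_if_extends[OF R B])
      fix \<gamma> assume "\<gamma> \<in> (\<Union>j\<in>R. B j) \<rightarrow>\<^sub>E UNIV" "\<And>j. j \<in> R \<Longrightarrow> (\<Sum>i\<in>B j. \<gamma> i) \<le> a j"
      then show "\<exists>g. extends_divided_difference smul (\<Union>j\<in>R. B j) X \<gamma> f g"
        using ext[OF X, of \<gamma>] by (simp add: I)
    qed
    moreover have "\<not> v isolated_in X i" if "j \<in> R" "i \<in> B j" for j i v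
      using X that by (auto simp: cartesian_charts_def cartesian_factors_def I)
    moreover have "compact (Kc c i) \<and> Kc c i \<subseteq> X i" if "j \<in> R" "i \<in> B j" for j i
      using KcX that by (auto simp: I)
    ultimately have "\<exists>t\<in>locpoly_tensors I. \<exists>e>0. dd_close I X (block_order R B a) ?x (Kc c) Q' ?f t e"
      unfolding I by (intro locpoly_tensors_dense R B disj Q')
    then obtain t e where t: "t \<in> locpoly_tensors I" "0 < e"
      "dd_close I X (block_order R B a) ?x (Kc c) Q' ?f t e" by blast
    have "close c t e"
      unfolding close_def
    proof (intro ballI allI impI)
      fix d' S assume d': "d' \<in> D" and S: "\<forall>i\<in>I. finite (S i) \<and> S i \<noteq> {} \<and>
          S i \<subseteq> V d' i \<inter> cball (c i) ?\<rho> \<inter> near (Kc c i) e" and ord: "block_order R B a S"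
      have "S i \<subseteq> X i" if "i \<in> I" for i by (rule sub[OF d' _ that]) (use S in auto)
      then have "\<forall>i\<in>I. finite (S i) \<and> S i \<noteq> {} \<and> S i \<subseteq> X i \<inter> near (Kc c i) e" using S by simp
      from t(3)[unfolded dd_close_def, THEN spec[of _ S], THEN mp[OF _ this], THEN mp[OF _ ord]]
      show "mdd smul I S (\<lambda>y. ?f y - t y) ?x \<in> Q'" .
    qed
    with t(1,2) show ?thesis by blast
  qed
  then obtain t e where t: "\<And>c. t c \<in> locpoly_tensors I" and e: "\<And>c. 0 < e c"
    and close: "\<And>c. close c (t c) (e c)" by metis
  have finC: "finite (Pi\<^sub>E I C)" using finI C(1) by (rule finite_PiE)
  have "\<exists>\<epsilon>>0. \<forall>c\<in>Pi\<^sub>E I C. \<epsilon> \<le> e c" by (rule finite_ex_positive_lower_bound[OF finC e])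
  then obtain \<epsilon>0 where \<epsilon>0: "\<epsilon>0 > 0" "\<forall>c\<in>Pi\<^sub>E I C. \<epsilon>0 \<le> e c" by (elim exE conjE) (rule that)
  define \<epsilon>1 where "\<epsilon>1 = min ?\<rho> \<epsilon>0"
  have \<epsilon>1: "0 < \<epsilon>1" "\<epsilon>1 \<le> ?\<rho>" "\<And>c. c \<in> Pi\<^sub>E I C \<Longrightarrow> \<epsilon>1 \<le> e c"
    using \<epsilon>0 \<rho>(1) by (force simp: \<epsilon>1_def)+
  let ?box = "\<lambda>c y. \<forall>i\<in>I. y i \<in> cball (c i) ?\<rho>"
  \<comment> \<open>The cut-off is written as a product of one-variable indicators, here the
    constant polynomial 1 cut off to balls, so that \<open>T\<close> remains a sum of
    tensors.\<close>
  define T where "T y = (\<Sum>c\<in>Pi\<^sub>E I C.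
      smul (\<Prod>i\<in>I. if y i \<in> cball (c i) ?\<rho> then poly 1 (y i) else 0) (t c y))" for y
  have T: "T \<in> locpoly_tensors I"
    unfolding T_def[abs_def]
    by (intro locpoly_tensors_sum locpoly_tensors_mult_same uniformly_locally_polynomial_cutoff \<rho>(1) t)
  have T_eq: "T y = (\<Sum>c\<in>Pi\<^sub>E I C. if ?box c y then t c y else 0)" for y
    unfolding T_def
  proof (rule sum.cong[OF refl])
    fix c
    show "smul (\<Prod>i\<in>I. if y i \<in> cball (c i) ?\<rho> then poly 1 (y i) else 0) (t c y) = (if ?box c y then t c y else 0)"
      unfolding prod_if_zero[OF finI] by (rule case_split[of "?box c y"]) (simp_all only: if_P if_False poly_1 prod.neutral_const scale_one scale_zero_left)
  qed
  have approxT: "mdd smul I S (\<lambda>y. ?f y - T y) ?x \<in> Q"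
    if d: "d \<in> D" and S: "\<forall>i\<in>I. finite (S i) \<and> S i \<noteq> {} \<and> S i \<subseteq> V d i \<inter> near (K d i) \<epsilon>1"
      and ord: "block_order R B a S" for d S
  proof -
    have S_cover: "S i \<subseteq> (\<Union>c\<in>C i. cball c ?\<rho>)" if i: "i \<in> I" for i
    proof -
      have "K d i \<subseteq> L i" using d by (auto simp: L_def)
      then have "near (K d i) \<epsilon>1 \<subseteq> (\<Union>c\<in>C i. cball c ?\<rho>)"
        using C(2)[OF i] by (intro near_subset_cballs \<epsilon>1(2)) (rule order_trans)
      then show ?thesis using bspec[OF S i] by blast
    qed
    let ?e = "\<lambda>y. \<Sum>c\<in>Pi\<^sub>E I C. if ?box c y then ?f y - t c y else 0"
    have "mdd smul I S (\<lambda>y. ?f y - T y) ?x = mdd smul I S ?e ?x"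
    proof (rule mdd_cong[OF refl])
      fix y assume y: "\<And>i. i \<in> I \<Longrightarrow> y i \<in> S i"
      have "(\<Sum>c\<in>Pi\<^sub>E I C. if ?box c y then ?f y else 0) = ?f y"
      proof (rule sum_boxes_eq[OF finI C(1,3)])
        fix i assume i: "i \<in> I"
        show "y i \<in> (\<Union>c\<in>C i. cball c ?\<rho>)" by (rule subsetD[OF S_cover[OF i] y[OF i]])
      qed
      moreover have "?e y = (\<Sum>c\<in>Pi\<^sub>E I C. if ?box c y then ?f y else 0) - T y"
        unfolding T_eq by (simp flip: sum_subtractf add: if_distrib cong: if_cong)
      ultimately show "?f y - T y = ?e y" by simp
    qed
    moreover have "smul (\<pi> ^ (\<Sum>i\<in>I. card (S i))) (mdd smul I S ?e ?x) \<in> Q'"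
    proof (rule mdd_glue_boxes[OF finI Q'(1) C(1)])
      fix c S' assume c: "c \<in> Pi\<^sub>E I C"
        and S': "\<And>i. i \<in> I \<Longrightarrow> S' i \<subseteq> S i \<inter> cball (c i) ?\<rho> \<and> S' i \<noteq> {}"
      have near: "S' i \<subseteq> near (K d i \<inter> cball (c i) ?\<rho>) \<epsilon>1" if i: "i \<in> I" for i
        by (rule near_Int_cball[OF _ _ \<epsilon>1(2)]) (use S'[OF i] bspec[OF S i] in blast)+
      \<comment> \<open>A node in the box and near \<open>K d i\<close> has its nearby point of
        \<open>K d i\<close> in the same box, because \<open>\<epsilon>1\<close> does not exceed the
        radius.\<close>
      have meets: "meets c d"
        unfolding meets_def
      proof
        fix i assume i: "i \<in> I"
        show "K d i \<inter> cball (c i) ?\<rho> \<noteq> {}" using near[OF i] S'[OF i] by (auto simp: near_def)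
      qed
      have "S' i \<subseteq> near (Kc c i) (e c)" if i: "i \<in> I" for i
      proof (rule order_trans[OF near[OF i] near_mono[OF _ \<epsilon>1(3)[OF c]]])
        show "K d i \<inter> cball (c i) ?\<rho> \<subseteq> Kc c i" using d meets unfolding Kc_def by blast
      qed
      moreover have "finite (S' i) \<and> S' i \<noteq> {} \<and> S' i \<subseteq> V d i \<inter> cball (c i) ?\<rho>" if i: "i \<in> I" for i
        using bspec[OF S i] S'[OF i] by (auto dest: finite_subset)
      ultimately have conf: "\<forall>i\<in>I. finite (S' i) \<and> S' i \<noteq> {} \<and> S' i \<subseteq> V d i \<inter> cball (c i) ?\<rho> \<inter> near (Kc c i) (e c)"
        by simp
      have "card (S' i) \<le> card (S i)" if "i \<in> I" for i
        using S'[OF that] bspec[OF S that] by (intro card_mono) auto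
      then have "(\<Sum>i\<in>B j. card (S' i)) \<le> (\<Sum>i\<in>B j. card (S i))" if "j \<in> R" for j
        using that by (intro sum_mono) (auto simp: I)
      then have "block_order R B a S'" using ord unfolding block_order_def by (meson order_trans)
      then have "mdd smul I S' (\<lambda>y. ?f y - t c y) ?x \<in> Q'"
        using close[of c] d meets conf unfolding close_def by simp
      moreover have "abs_value (\<pi> ^ (\<Sum>i\<in>I. card (S' i))) \<le> 1"
        using \<rho> by (simp add: abs_value_power power_le_one)
      ultimately show "smul (\<pi> ^ (\<Sum>i\<in>I. card (S' i))) (mdd smul I S' (\<lambda>y. ?f y - t c y) ?x) \<in> Q'"
        by (intro submodule_scale[OF Q'(1)])
    next
      show "finite (S i)" if "i \<in> I" for i using bspec[OF S that] by (elim conjE)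
    qed
    ultimately have "smul (inverse (\<pi> ^ N) * \<pi> ^ (\<Sum>i\<in>I. card (S i))) (mdd smul I S (\<lambda>y. ?f y - T y) ?x) \<in> Q"
      by (simp add: Q'_def)
    \<comment> \<open>There are at most \<open>N\<close> nodes, so the remaining scalar has absolute
      value at least 1 and may be dropped.\<close>
    moreover have "abs_value 1 \<le> abs_value (inverse (\<pi> ^ N) * \<pi> ^ (\<Sum>i\<in>I. card (S i)))"
    proof -
      have "?\<rho> ^ N \<le> ?\<rho> ^ (\<Sum>i\<in>I. card (S i))" using sumN[OF ord] \<rho> by (intro power_decreasing) auto
      then show ?thesis using \<rho>(1) by (simp add: abs_value_mult abs_value_inverse abs_value_divide abs_value_power field_simps)
    qed
    ultimately have "smul 1 (mdd smul I S (\<lambda>y. ?f y - T y) ?x) \<in> Q"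
      by (rule submodule_scale_le[OF Q(1)])
    then show ?thesis by simp
  qed
  have "\<exists>p\<in>polynomial_functions I. \<exists>\<epsilon>>0. \<forall>S.
    (\<forall>i\<in>I. finite (S i) \<and> S i \<noteq> {} \<and> card (S i) \<le> N \<and> S i \<subseteq> near (L i) \<epsilon>) \<longrightarrow>
    mdd smul I S (\<lambda>y. T y - p y) ?x \<in> Q"
    by (rule locpoly_tensor_approx[OF finI L Q T])
  then obtain p \<epsilon>2 where p: "p \<in> polynomial_functions I" and \<epsilon>2: "\<epsilon>2 > 0"
    and approxp: "\<forall>S. (\<forall>i\<in>I. finite (S i) \<and> S i \<noteq> {} \<and> card (S i) \<le> N \<and> S i \<subseteq> near (L i) \<epsilon>2) \<longrightarrow>
      mdd smul I S (\<lambda>y. T y - p y) ?x \<in> Q" by (elim bexE exE conjE) (rule that)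
  have "mdd smul I S (\<lambda>y. ?f y - p y) ?x \<in> Q"
    if d: "d \<in> D" and S: "\<forall>i\<in>I. finite (S i) \<and> S i \<noteq> {} \<and> S i \<subseteq> V d i \<inter> near (K d i) (min \<epsilon>1 \<epsilon>2)"
      and ord: "block_order R B a S" for d S
  proof -
    have "near (K d i) (min \<epsilon>1 \<epsilon>2) \<subseteq> near (K d i) \<epsilon>1" "near (K d i) (min \<epsilon>1 \<epsilon>2) \<subseteq> near (L i) \<epsilon>2" for i
    proof -
      have "K d i \<subseteq> L i" using d by (auto simp: L_def)
      then show "near (K d i) (min \<epsilon>1 \<epsilon>2) \<subseteq> near (L i) \<epsilon>2" by (rule near_mono) simp
      show "near (K d i) (min \<epsilon>1 \<epsilon>2) \<subseteq> near (K d i) \<epsilon>1" by (rule near_mono) simp_all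
    qed
    then have "\<forall>i\<in>I. finite (S i) \<and> S i \<noteq> {} \<and> S i \<subseteq> V d i \<inter> near (K d i) \<epsilon>1"
      "\<forall>i\<in>I. S i \<subseteq> near (L i) \<epsilon>2" using S by blast+
    moreover have "card (S i) \<le> N" if "i \<in> I" for i
      using member_le_sum[OF that, of "\<lambda>i. card (S i)"] finI sumN[OF ord] by simp
    ultimately have "mdd smul I S (\<lambda>y. ?f y - T y) ?x \<in> Q" "mdd smul I S (\<lambda>y. T y - p y) ?x \<in> Q"
      using approxT[OF d _ ord] approxp by simp_all
    then have "mdd smul I S (\<lambda>y. (?f y - T y) + (T y - p y)) ?x \<in> Q"
      unfolding mdd_add by (rule submodule_add[OF Q(1)])
    then show ?thesis by simp
  qed
  moreover have "0 < min \<epsilon>1 \<epsilon>2" using \<epsilon>1(1) \<epsilon>2 by simp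
  ultimately show ?thesis
    by (intro bexI[OF _ p] exI[of _ "min \<epsilon>1 \<epsilon>2"] conjI ballI allI impI)
qed

end

section \<open>The topology on functions of class \<open>C\<^sup>\<alpha>\<close>\<close>

lemma topspace_initial_topology: "topspace (initial_topology S J h T) = S"
  by (auto simp: initial_topology_def)

lemma multi_orders_mono:
  assumes "\<eta> \<in> multi_orders l n \<alpha>" "\<gamma> \<in> (\<Pi>\<^sub>E i\<in>block_indices l n. {..\<eta> i})"
  shows "\<gamma> \<in> multi_orders l n \<alpha>"
proof -
  have "enat (\<Sum>i\<in>{1..n j}. \<gamma> (j, i)) \<le> \<alpha> j" if j: "j \<in> {1..l}" for j
  proof -
    have "(\<Sum>i\<in>{1..n j}. \<gamma> (j, i)) \<le> (\<Sum>i\<in>{1..n j}. \<eta> (j, i))"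
      using PiE_mem[OF assms(2)] j by (intro sum_mono) (auto simp: block_indices_def)
    then have "enat (\<Sum>i\<in>{1..n j}. \<gamma> (j, i)) \<le> enat (\<Sum>i\<in>{1..n j}. \<eta> (j, i))" by simp
    also have "\<dots> \<le> \<alpha> j" using assms(1) j by (simp add: multi_orders_def)
    finally show ?thesis .
  qed
  then show ?thesis using assms(2) by (simp add: multi_orders_def PiE_iff)
qed

lemma C_alpha_extends:
  assumes "f \<in> C_alpha smul l n U \<alpha>" "V \<in> cartesian_charts (block_indices l n) U" "\<gamma> \<in> multi_orders l n \<alpha>"
  shows "\<exists>g. extends_divided_difference smul (block_indices l n) V \<gamma> f g"
proof -
  have "f \<in> C_eta smul (block_indices l n) U \<gamma>" using assms(1,3) by (simp add: C_alpha_def)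
  moreover have "\<gamma> \<in> (\<Pi>\<^sub>E i\<in>block_indices l n. {..\<gamma> i})"
    using assms(3) by (simp add: multi_orders_def PiE_iff)
  ultimately show ?thesis using assms(2) by (simp add: C_eta_def)
qed

context ultrametric_lcs
begin

lemma extends_extended_divided_difference:
  assumes "finite I" "V \<in> cartesian_charts I U" "\<exists>g. extends_divided_difference smul I V \<gamma> f g"
  shows "extends_divided_difference smul I V \<gamma> f (extended_divided_difference smul I V \<gamma> f)"
proof -
  obtain g where g: "extends_divided_difference smul I V \<gamma> f g" using assms(3) by (rule exE)
  moreover have "cartesian_factors I V" using assms(2) by (simp add: cartesian_charts_def)
  ultimately show ?thesis using extended_divided_difference_eq[OF assms(1)] by metis
qed

text \<open>Says that \<open>W\<close> contains a basic neighbourhood of \<open>f\<close>: finitely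
  many charts, orders and compact sets, with one submodule common to all of them.\<close>

definition C_alpha_neighbourhood ::
  "nat \<Rightarrow> (nat \<Rightarrow> nat) \<Rightarrow> (nat \<times> nat \<Rightarrow> 'k) set \<Rightarrow> (nat \<Rightarrow> enat) \<Rightarrow> ((nat \<times> nat \<Rightarrow> 'k) \<Rightarrow> 'e) \<Rightarrow>
    ((nat \<times> nat \<Rightarrow> 'k) \<Rightarrow> 'e) set \<Rightarrow> bool" where
  "C_alpha_neighbourhood l n U \<alpha> f W \<longleftrightarrow> (\<exists>D Q. finite D \<and>
     (\<forall>(V, \<gamma>, K)\<in>D. V \<in> cartesian_charts (block_indices l n) U \<and> \<gamma> \<in> multi_orders l n \<alpha> \<and>
       compactin (multi_space (block_indices l n) V \<gamma>) K) \<and>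
     unit_ball_submodule smul Q \<and> open Q \<and>
     (\<forall>g\<in>C_alpha smul l n U \<alpha>. (\<forall>(V, \<gamma>, K)\<in>D. \<forall>k\<in>K.
       extended_divided_difference smul (block_indices l n) V \<gamma> g k -
       extended_divided_difference smul (block_indices l n) V \<gamma> f k \<in> Q) \<longrightarrow> g \<in> W))"

lemma C_alpha_neighbourhood_Int:
  assumes "C_alpha_neighbourhood l n U \<alpha> f W" "C_alpha_neighbourhood l n U \<alpha> f W'"
  shows "C_alpha_neighbourhood l n U \<alpha> f (W \<inter> W')"
proof -
  let ?I = "block_indices l n"
  let ?valid = "\<lambda>D. \<forall>(V, \<gamma>, K)\<in>D. V \<in> cartesian_charts ?I U \<and> \<gamma> \<in> multi_orders l n \<alpha> \<and>
       compactin (multi_space ?I V \<gamma>) K"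
  let ?near = "\<lambda>D Q g. \<forall>(V, \<gamma>, K)\<in>D. \<forall>k\<in>K.
       extended_divided_difference smul ?I V \<gamma> g k - extended_divided_difference smul ?I V \<gamma> f k \<in> Q"
  obtain D Q where D: "finite D" "?valid D" "unit_ball_submodule smul Q" "open Q"
    and W: "\<forall>g\<in>C_alpha smul l n U \<alpha>. ?near D Q g \<longrightarrow> g \<in> W"
    using assms(1) unfolding C_alpha_neighbourhood_def by (elim exE conjE) (rule that)
  obtain D' Q' where D': "finite D'" "?valid D'" "unit_ball_submodule smul Q'" "open Q'"
    and W': "\<forall>g\<in>C_alpha smul l n U \<alpha>. ?near D' Q' g \<longrightarrow> g \<in> W'"
    using assms(2) unfolding C_alpha_neighbourhood_def by (elim exE conjE) (rule that)
  have "finite (D \<union> D')" using D(1) D'(1) by simp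
  moreover have "?valid (D \<union> D')" using D(2) D'(2) by (simp add: ball_Un)
  moreover have "unit_ball_submodule smul (Q \<inter> Q')" using D(3) D'(3) by (simp add: unit_ball_submodule_def)
  moreover have "open (Q \<inter> Q')" using D(4) D'(4) by (rule open_Int)
  moreover have "\<forall>g\<in>C_alpha smul l n U \<alpha>. ?near (D \<union> D') (Q \<inter> Q') g \<longrightarrow> g \<in> W \<inter> W'"
  proof (intro ballI impI IntI)
    fix g assume g: "g \<in> C_alpha smul l n U \<alpha>" and near: "?near (D \<union> D') (Q \<inter> Q') g"
    have "?near D Q g" "?near D' Q' g" using near by (auto simp: ball_Un split: prod.splits)
    then show "g \<in> W" "g \<in> W'" using W W' g by simp_all
  qed
  ultimately show ?thesis unfolding C_alpha_neighbourhood_def by (intro exI conjI)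
qed

lemma C_alpha_neighbourhood_mono:
  assumes "C_alpha_neighbourhood l n U \<alpha> f W" "W \<inter> C_alpha smul l n U \<alpha> \<subseteq> W'"
  shows "C_alpha_neighbourhood l n U \<alpha> f W'"
proof -
  let ?I = "block_indices l n"
  let ?near = "\<lambda>D Q g. \<forall>(V, \<gamma>, K)\<in>D. \<forall>k\<in>K.
       extended_divided_difference smul ?I V \<gamma> g k - extended_divided_difference smul ?I V \<gamma> f k \<in> Q"
  obtain D Q where D: "finite D" "\<forall>(V, \<gamma>, K)\<in>D. V \<in> cartesian_charts ?I U \<and> \<gamma> \<in> multi_orders l n \<alpha> \<and>
       compactin (multi_space ?I V \<gamma>) K" "unit_ball_submodule smul Q" "open Q"
    and W: "\<forall>g\<in>C_alpha smul l n U \<alpha>. ?near D Q g \<longrightarrow> g \<in> W"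
    using assms(1) unfolding C_alpha_neighbourhood_def by (elim exE conjE) (rule that)
  have "\<forall>g\<in>C_alpha smul l n U \<alpha>. ?near D Q g \<longrightarrow> g \<in> W'"
  proof (intro ballI impI)
    fix g assume g: "g \<in> C_alpha smul l n U \<alpha>" and "?near D Q g"
    then have "g \<in> W" by (rule bspec[OF W, THEN mp])
    with g show "g \<in> W'" using assms(2) by blast
  qed
  with D show ?thesis unfolding C_alpha_neighbourhood_def by (intro exI conjI)
qed

lemma C_alpha_neighbourhood_UNIV: "C_alpha_neighbourhood l n U \<alpha> f UNIV"
  unfolding C_alpha_neighbourhood_def
  by (rule exI[of _ "{}"], rule exI[of _ UNIV]) (simp add: unit_ball_submodule_def)

lemma openin_C_eta_neighbourhood:
  assumes f: "f \<in> C_alpha smul l n U \<alpha>" and \<eta>: "\<eta> \<in> multi_orders l n \<alpha>"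
    and W: "openin (C_eta_topology smul (block_indices l n) U \<eta>) W" "f \<in> W"
  shows "C_alpha_neighbourhood l n U \<alpha> f W"
proof -
  let ?I = "block_indices l n"
  let ?S = "C_eta smul ?I U \<eta>"
  let ?J = "cartesian_charts ?I U \<times> (\<Pi>\<^sub>E i\<in>?I. {..\<eta> i})"
  let ?h = "\<lambda>(V, \<gamma>). extended_divided_difference smul ?I V \<gamma>"
  let ?T = "\<lambda>(V, \<gamma>). compact_open_topology (multi_space ?I V \<gamma>) euclidean"
  have finI: "finite ?I" by (simp add: block_indices_def)
  have sub: "C_alpha smul l n U \<alpha> \<subseteq> ?S" using \<eta> by (auto simp: C_alpha_def)
  have "generate_topology_on (insert ?S {?S \<inter> ?h j -` W | j W. j \<in> ?J \<and> openin (?T j) W}) W"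
    using W(1) unfolding C_eta_topology_def initial_topology_def openin_topology_generated_by_iff .
  then show ?thesis
  proof (rule generate_topology_on_local_property[OF _ W(2)])
    fix A assume "A \<in> insert ?S {?S \<inter> ?h j -` W | j W. j \<in> ?J \<and> openin (?T j) W}" and fA: "f \<in> A"
    then consider "A = ?S" | j W where "j \<in> ?J" "openin (?T j) W" "A = ?S \<inter> ?h j -` W" by auto
    then show "C_alpha_neighbourhood l n U \<alpha> f A"
    proof cases
      case 1
      then show ?thesis using C_alpha_neighbourhood_mono[OF C_alpha_neighbourhood_UNIV] sub by auto
    next
      case 2
      obtain V \<gamma> where j: "j = (V, \<gamma>)" by force
      have V: "V \<in> cartesian_charts ?I U" and \<gamma>: "\<gamma> \<in> multi_orders l n \<alpha>"
        using 2(1) multi_orders_mono[OF \<eta>] by (auto simp: j)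
      let ?ext = "extended_divided_difference smul ?I V \<gamma>"
      have "openin (compact_open_topology (multi_space ?I V \<gamma>) euclidean) W" "?ext f \<in> W"
        using 2(2,3) fA by (auto simp: j)
      from compact_open_neighbourhood[OF this]
      obtain K Q where K: "compactin (multi_space ?I V \<gamma>) K" and Q: "unit_ball_submodule smul Q" "open Q"
        and near: "\<forall>h'\<in>continuous_functions (multi_space ?I V \<gamma>) euclidean. (\<forall>k\<in>K. h' k - ?ext f k \<in> Q) \<longrightarrow> h' \<in> W"
        by (elim exE conjE) (rule that)
      have "g \<in> A" if g: "g \<in> C_alpha smul l n U \<alpha>" and "\<forall>k\<in>K. ?ext g k - ?ext f k \<in> Q" for g
      proof -
        have "?ext g \<in> continuous_functions (multi_space ?I V \<gamma>) euclidean"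
          using extends_extended_divided_difference[OF finI V C_alpha_extends[OF g V \<gamma>]]
          by (simp add: extends_divided_difference_def)
        with near that(2) have "?ext g \<in> W" by simp
        then show ?thesis using g sub by (auto simp: 2(3) j)
      qed
      then show ?thesis unfolding C_alpha_neighbourhood_def using V \<gamma> K Q
        by (intro exI[of _ "{(V, \<gamma>, K)}"] exI[of _ Q]) simp
    qed
  next
    fix A A' assume "C_alpha_neighbourhood l n U \<alpha> f A" "A \<subseteq> A'"
    then show "C_alpha_neighbourhood l n U \<alpha> f A'"
      by (rule C_alpha_neighbourhood_mono[OF _ order_trans[OF Int_lower1]])
  qed (rule C_alpha_neighbourhood_Int)
qed

lemma openin_C_alpha_neighbourhood:
  assumes f: "f \<in> C_alpha smul l n U \<alpha>"
    and W: "openin (C_alpha_topology smul l n U \<alpha>) W" "f \<in> W"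
  shows "C_alpha_neighbourhood l n U \<alpha> f W"
proof -
  let ?S = "C_alpha smul l n U \<alpha>"
  let ?T = "C_eta_topology smul (block_indices l n) U"
  have "generate_topology_on (insert ?S {?S \<inter> (\<lambda>f. f) -` W | \<eta> W. \<eta> \<in> multi_orders l n \<alpha> \<and> openin (?T \<eta>) W}) W"
    using W(1) unfolding C_alpha_topology_def initial_topology_def openin_topology_generated_by_iff .
  then show ?thesis
  proof (rule generate_topology_on_local_property[OF _ W(2)])
    fix A assume "A \<in> insert ?S {?S \<inter> (\<lambda>f. f) -` W | \<eta> W. \<eta> \<in> multi_orders l n \<alpha> \<and> openin (?T \<eta>) W}" and fA: "f \<in> A"
    then consider "A = ?S" | \<eta> W where "\<eta> \<in> multi_orders l n \<alpha>" "openin (?T \<eta>) W" "A = ?S \<inter> W" by auto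
    then show "C_alpha_neighbourhood l n U \<alpha> f A"
    proof cases
      case 1
      then show ?thesis using C_alpha_neighbourhood_mono[OF C_alpha_neighbourhood_UNIV] by auto
    next
      case 2
      have "C_alpha_neighbourhood l n U \<alpha> f W"
        by (rule openin_C_eta_neighbourhood[OF f 2(1,2)]) (use fA 2(3) in simp)
      then show ?thesis by (rule C_alpha_neighbourhood_mono) (auto simp: 2(3))
    qed
  next
    fix A A' assume "C_alpha_neighbourhood l n U \<alpha> f A" "A \<subseteq> A'"
    then show "C_alpha_neighbourhood l n U \<alpha> f A'"
      by (rule C_alpha_neighbourhood_mono[OF _ order_trans[OF Int_lower1]])
  qed (rule C_alpha_neighbourhood_Int)
qed

text \<open>The tuple \<open>k\<close> may have repeated entries, where the extensions are not given
  by a formula. Tuples with distinct entries exist in every neighbourhood of \<open>k\<close>, and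
  there the hypothesis on sets of nodes applies.\<close>

lemma submodule_extends:
  fixes V K :: "'i \<Rightarrow> 'k set"
  assumes I: "finite I" and V: "cartesian_factors I V"
    and Q: "unit_ball_submodule smul Q" "open Q" and \<epsilon>: "0 < \<epsilon>"
    and g: "extends_divided_difference smul I V \<gamma> f g" and h: "extends_divided_difference smul I V \<gamma> p h"
    and k: "k \<in> topspace (multi_space I V \<gamma>)" "\<And>i j. \<lbrakk>i \<in> I; j \<le> \<gamma> i\<rbrakk> \<Longrightarrow> k (i, j) \<in> K i"
    and close: "\<And>S. (\<And>i. i \<in> I \<Longrightarrow> finite (S i) \<and> S i \<subseteq> V i \<inter> near (K i) \<epsilon> \<and> card (S i) = Suc (\<gamma> i)) \<Longrightarrow>
      mdd smul I S (\<lambda>y. f (restrict y I) - p (restrict y I)) (\<lambda>_. undefined) \<in> Q"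
  shows "h k - g k \<in> Q"
proof (rule ccontr)
  assume kQ: "h k - g k \<notin> Q"
  let ?X = "multi_space I V \<gamma>" and ?\<Sigma> = "SIGMA i:I. {..\<gamma> i}"
  have X: "?X = product_topology (\<lambda>z. subtopology euclidean (V (fst z))) ?\<Sigma>"
    by (simp add: multi_space_def case_prod_unfold)
  have top: "topspace ?X = Pi\<^sub>E ?\<Sigma> (\<lambda>z. V (fst z))" by (simp add: X)
  let ?W = "{y \<in> topspace ?X. h y - g y \<in> - Q}"
  let ?N = "{y \<in> Pi\<^sub>E ?\<Sigma> (\<lambda>z. V (fst z)). \<forall>z\<in>?\<Sigma>. dist (y z) (k z) < \<epsilon>}"
  have cont: "continuous_map ?X euclidean g" "continuous_map ?X euclidean h"
    using g h by (auto simp: extends_divided_difference_def continuous_functions_def)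
  have "continuous_on UNIV (\<lambda>(x, y). x - y :: 'e)"
    unfolding case_prod_unfold by (intro continuous_intros)
  from continuous_map_euclidean_compose2[OF this cont(2,1)]
  have "openin ?X ?W"
    using closed_submodule[OF Q] by (intro openin_continuous_map_preimage) (auto simp flip: open_openin)
  moreover have "openin ?X ?N" unfolding X using I by (intro openin_product_topology_box) auto
  ultimately have "openin ?X (?W \<inter> ?N)" by (rule openin_Int)
  moreover have "k \<in> ?W \<inter> ?N" using k(1) kQ \<epsilon> by (simp add: top)
  ultimately have "(?W \<inter> ?N) \<inter> distinct_points I V \<gamma> \<noteq> {}"
    by (intro multi_space_nonisolated_dense[OF I V]) auto
  then obtain x where x: "x \<in> ?W" "x \<in> ?N" "x \<in> distinct_points I V \<gamma>" by blast
  note inj = distinct_points_inj[OF x(3)]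
  let ?S = "\<lambda>i. (\<lambda>j. x (i, j)) ` {..\<gamma> i}"
  have "mdd smul I ?S (\<lambda>y. f (restrict y I) - p (restrict y I)) (\<lambda>_. undefined) \<in> Q"
  proof (rule close)
    fix i assume i: "i \<in> I"
    have "x (i, j) \<in> V i \<inter> near (K i) \<epsilon>" if j: "j \<le> \<gamma> i" for j
    proof -
      have "(i, j) \<in> ?\<Sigma>" using i j by simp
      moreover from this have "dist (x (i, j)) (k (i, j)) < \<epsilon>" using x(2) by blast
      moreover have "x (i, j) \<in> V (fst (i, j))"
        using x(2) \<open>(i, j) \<in> ?\<Sigma>\<close> by (blast dest: PiE_mem)
      ultimately show ?thesis using k(2)[OF i j] unfolding near_def by auto
    qed
    then show "finite (?S i) \<and> ?S i \<subseteq> V i \<inter> near (K i) \<epsilon> \<and> card (?S i) = Suc (\<gamma> i)"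
      using inj[OF i] by (auto simp: card_image)
  qed
  moreover have "g x = mdd smul I ?S (\<lambda>y. f (restrict y I)) (\<lambda>_. undefined)"
    "h x = mdd smul I ?S (\<lambda>y. p (restrict y I)) (\<lambda>_. undefined)"
    using g h x(3) by (simp_all add: extends_divided_difference_def divided_difference_eq_mdd[OF I inj])
  ultimately have "g x - h x \<in> Q" by (simp add: mdd_diff)
  then have "h x - g x \<in> Q" using submodule_minus[OF Q(1)] by fastforce
  then show False using x(1) by simp
qed

text \<open>Reduces the approximation for finitely many charts, orders and compact sets to the
  statement about sets of nodes: the compact sets are replaced by products of their projections, and
  \<alpha> by finite bounds.\<close>

lemma C_alpha_approximation:
  assumes f: "f \<in> C_alpha smul l n U \<alpha>" and D: "finite D"
    and valid: "\<And>V \<gamma> K. (V, \<gamma>, K) \<in> D \<Longrightarrow> V \<in> cartesian_charts (block_indices l n) U \<and>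
      \<gamma> \<in> multi_orders l n \<alpha> \<and> compactin (multi_space (block_indices l n) V \<gamma>) K"
    and Q: "unit_ball_submodule smul Q" "open Q"
  shows "\<exists>p\<in>Pol smul (block_indices l n) U. \<forall>(V, \<gamma>, K)\<in>D. \<forall>k\<in>K.
    extended_divided_difference smul (block_indices l n) V \<gamma> p k -
    extended_divided_difference smul (block_indices l n) V \<gamma> f k \<in> Q"
proof -
  let ?I = "block_indices l n" and ?R = "{1..l}"
  define B where "B j = Pair j ` {1..n j}" for j
  have B: "finite (B j)" for j by (simp add: B_def)
  have disj: "disjoint_family_on B ?R" by (auto simp: disjoint_family_on_def B_def)
  have I: "?I = (\<Union>j\<in>?R. B j)" by (auto simp: block_indices_def B_def)
  have finI: "finite ?I" by (simp add: block_indices_def)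
  have sumB: "(\<Sum>i\<in>B j. \<gamma> i) = (\<Sum>i\<in>{1..n j}. \<gamma> (j, i))" for \<gamma> :: "nat \<times> nat \<Rightarrow> nat" and j
    unfolding B_def by (subst sum.reindex) (auto simp: inj_on_def)
  define m where "m d j = (\<Sum>i\<in>B j. fst (snd d) i)"
    for d :: "(nat \<times> nat \<Rightarrow> 'k set) \<times> (nat \<times> nat \<Rightarrow> nat) \<times> (((nat \<times> nat) \<times> nat) \<Rightarrow> 'k) set" and j
  \<comment> \<open>The largest block order occurring in \<open>D\<close>: finite even if
    \<open>\<alpha> j\<close> is infinite, and at most \<open>\<alpha> j\<close>, so that
    \<open>f\<close> has all the differences used. The inserted 0 covers an empty
    \<open>D\<close>.\<close>
  define a where "a j = Max (insert 0 ((\<lambda>d. m d j) ` D))" for j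
  have m_le: "m d j \<le> a j" if "d \<in> D" for d j using D that by (simp add: a_def)
  have a_le: "enat (a j) \<le> \<alpha> j" if j: "j \<in> ?R" for j
  proof -
    have "a j \<in> insert 0 ((\<lambda>d. m d j) ` D)" unfolding a_def using D by (intro Max_in) auto
    then consider "a j = 0" | d where "d \<in> D" "a j = m d j" by (metis imageE insertE)
    then show ?thesis
    proof cases
      case 1
      then show ?thesis by (simp add: zero_enat_def [symmetric])
    next
      case 2
      have "fst (snd d) \<in> multi_orders l n \<alpha>" using valid[of "fst d" "fst (snd d)" "snd (snd d)"] 2(1) by simp
      then show ?thesis using j by (simp add: 2(2) m_def sumB multi_orders_def)
    qed
  qed
  \<comment> \<open>All components belonging to the coordinate \<open>i\<close> are projected to a
    single compact set, since the nodes of one coordinate are treated as an unordered set.\<close>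
  define K' where "K' d i = (\<Union>j\<in>{..fst (snd d) i}. (\<lambda>x. x (i, j)) ` snd (snd d))"
    for d :: "(nat \<times> nat \<Rightarrow> 'k set) \<times> (nat \<times> nat \<Rightarrow> nat) \<times> (((nat \<times> nat) \<times> nat) \<Rightarrow> 'k) set" and i
  have K': "compact (K' d i) \<and> K' d i \<subseteq> fst d i" if d: "d \<in> D" and i: "i \<in> ?I" for d i
  proof -
    obtain V \<gamma> K where VK: "d = (V, \<gamma>, K)" by (rule prod_cases3)
    have compK: "compactin (multi_space ?I V \<gamma>) K" using valid[of V \<gamma> K] d VK by simp
    have "compactin (subtopology euclidean (V i)) ((\<lambda>x. x (i, j)) ` K)" if "j \<le> \<gamma> i" for j
    proof (rule image_compactin[OF compK])
      show "continuous_map (multi_space ?I V \<gamma>) (subtopology euclidean (V i)) (\<lambda>x. x (i, j))"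
        using continuous_map_product_projection[of "(i, j)" "SIGMA i:?I. {..\<gamma> i}"
            "\<lambda>(i, j). subtopology euclidean (V i)"] that i by (simp add: multi_space_def)
    qed
    then have "compact ((\<lambda>x. x (i, j)) ` K) \<and> (\<lambda>x. x (i, j)) ` K \<subseteq> V i" if "j \<le> \<gamma> i" for j
      using that by (simp add: compactin_subtopology)
    then show ?thesis unfolding K'_def VK by (auto intro!: compact_UN)
  qed
  have "\<exists>p\<in>polynomial_functions ?I. \<exists>\<epsilon>>0. \<forall>d\<in>D. \<forall>S.
    (\<forall>i\<in>?I. finite (S i) \<and> S i \<noteq> {} \<and> S i \<subseteq> fst d i \<inter> near (K' d i) \<epsilon>) \<longrightarrow> block_order ?R B a S \<longrightarrow>
    mdd smul ?I S (\<lambda>y. f (restrict y ?I) - p y) (\<lambda>_. undefined) \<in> Q"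
  proof (rule polynomial_approximation[OF _ B disj I D _ K' _ Q])
    show "fst d \<in> cartesian_charts ?I U" if "d \<in> D" for d
      using valid[of "fst d" "fst (snd d)" "snd (snd d)"] that by simp
    fix X \<gamma> assume X: "X \<in> cartesian_charts ?I U" and \<gamma>: "\<gamma> \<in> ?I \<rightarrow>\<^sub>E UNIV"
      "\<And>j. j \<in> ?R \<Longrightarrow> (\<Sum>i\<in>B j. \<gamma> i) \<le> a j"
    have "enat (\<Sum>i\<in>{1..n j}. \<gamma> (j, i)) \<le> \<alpha> j" if j: "j \<in> ?R" for j
    proof -
      have "enat (\<Sum>i\<in>B j. \<gamma> i) \<le> enat (a j)" using \<gamma>(2)[OF j] by simp
      then show ?thesis using a_le[OF j] unfolding sumB by (rule order_trans)
    qed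
    then have "\<gamma> \<in> multi_orders l n \<alpha>" using \<gamma>(1) by (simp add: multi_orders_def)
    then show "\<exists>g. extends_divided_difference smul ?I X \<gamma> f g" by (rule C_alpha_extends[OF f X])
  qed simp_all
  then obtain p \<epsilon> where p: "p \<in> polynomial_functions ?I" and \<epsilon>: "\<epsilon> > 0"
    and close: "\<forall>d\<in>D. \<forall>S.
    (\<forall>i\<in>?I. finite (S i) \<and> S i \<noteq> {} \<and> S i \<subseteq> fst d i \<inter> near (K' d i) \<epsilon>) \<longrightarrow> block_order ?R B a S \<longrightarrow>
    mdd smul ?I S (\<lambda>y. f (restrict y ?I) - p y) (\<lambda>_. undefined) \<in> Q" by (elim bexE exE conjE) (rule that)
  obtain A c where p_eq: "p = (\<lambda>x. \<Sum>\<beta>\<in>A. smul (\<Prod>i\<in>?I. x i ^ \<beta> i) (c \<beta>))" and A: "finite A" "A \<subseteq> ?I \<rightarrow>\<^sub>E UNIV"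
    using p unfolding polynomial_functions_def by (elim CollectE exE conjE) (rule that)
  have Pol: "restrict p U \<in> Pol smul ?I U"
    unfolding Pol_def p_eq using A by (intro CollectI exI[of _ A] exI[of _ c]) simp
  have p_restrict: "p (restrict y ?I) = p y" for y unfolding p_eq by (simp cong: prod.cong)
  have "extended_divided_difference smul ?I V \<gamma> (restrict p U) k - extended_divided_difference smul ?I V \<gamma> f k \<in> Q"
    if d: "(V, \<gamma>, K) \<in> D" and k: "k \<in> K" for V \<gamma> K k
  proof -
    have V: "V \<in> cartesian_charts ?I U" and \<gamma>: "\<gamma> \<in> multi_orders l n \<alpha>" and K: "compactin (multi_space ?I V \<gamma>) K"
      using valid[OF d] by simp_all
    have factors: "cartesian_factors ?I V" using V by (simp add: cartesian_charts_def)
    note VU = cartesian_charts_subset[OF V]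
    show ?thesis
    proof (rule submodule_extends[OF finI factors Q \<epsilon>
          extends_extended_divided_difference[OF finI V C_alpha_extends[OF f V \<gamma>]]
          extends_extended_divided_difference[OF finI V Pol_extends[OF finI VU Pol]],
          where K = "K' (V, \<gamma>, K)"])
      show "k \<in> topspace (multi_space ?I V \<gamma>)" using compactin_subset_topspace[OF K] k by blast
      show "k (i, j) \<in> K' (V, \<gamma>, K) i" if "i \<in> ?I" "j \<le> \<gamma> i" for i j
        using k that by (auto simp: K'_def)
      fix S assume S: "\<And>i. i \<in> ?I \<Longrightarrow> finite (S i) \<and> S i \<subseteq> V i \<inter> near (K' (V, \<gamma>, K) i) \<epsilon> \<and> card (S i) = Suc (\<gamma> i)"
      have S_ne: "S i \<noteq> {}" if "i \<in> ?I" for i using S[OF that] by auto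
      have "(\<Sum>i\<in>B j. card (S i)) \<le> a j + card (B j)" if j: "j \<in> ?R" for j
      proof -
        have "i \<in> ?I" if "i \<in> B j" for i using j that unfolding I by (rule UN_I)
        then have "(\<Sum>i\<in>B j. card (S i)) = (\<Sum>i\<in>B j. Suc (\<gamma> i))"
          using S by (intro sum.cong) simp_all
        also have "\<dots> = m (V, \<gamma>, K) j + card (B j)" by (simp only: sum_Suc m_def fst_conv snd_conv)
        finally show ?thesis using m_le[OF d, of j] by linarith
      qed
      then have ord: "block_order ?R B a S" by (simp add: block_order_def)
      have "\<forall>i\<in>?I. finite (S i) \<and> S i \<noteq> {} \<and> S i \<subseteq> fst (V, \<gamma>, K) i \<inter> near (K' (V, \<gamma>, K) i) \<epsilon>"
        using S S_ne by simp
      from bspec[OF close d, THEN spec[of _ S], THEN mp[OF _ this], THEN mp[OF _ ord]]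
      have "mdd smul ?I S (\<lambda>y. f (restrict y ?I) - p y) (\<lambda>_. undefined) \<in> Q" .
      also have "mdd smul ?I S (\<lambda>y. f (restrict y ?I) - p y) (\<lambda>_. undefined) =
          mdd smul ?I S (\<lambda>y. f (restrict y ?I) - restrict p U (restrict y ?I)) (\<lambda>_. undefined)"
      proof (rule mdd_cong[OF refl])
        fix y assume y: "\<And>i. i \<in> ?I \<Longrightarrow> y i \<in> S i"
        have "y i \<in> V i" if "i \<in> ?I" for i using y[OF that] S[OF that] by blast
        then have "restrict y ?I \<in> U" by (intro subsetD[OF VU]) (simp add: restrict_PiE_iff)
        then show "f (restrict y ?I) - p y = f (restrict y ?I) - restrict p U (restrict y ?I)"
          by (simp add: p_restrict)
      qed
      finally show "mdd smul ?I S (\<lambda>y. f (restrict y ?I) - restrict p U (restrict y ?I)) (\<lambda>_. undefined) \<in> Q" .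
    qed
  qed
  then show ?thesis by (intro bexI[OF _ Pol]) auto
qed

end

theorem proposition9p12:
  fixes smul :: "'k::{ultrametric_field, complete_space} \<Rightarrow>
      'e::{topological_ab_group_add, t2_space} \<Rightarrow> 'e"
    and l :: nat
    and n :: "nat \<Rightarrow> nat"
    and \<alpha> :: "nat \<Rightarrow> enat"
    and U :: "(nat \<times> nat \<Rightarrow> 'k) set"
  assumes "ultrametric_lcs smul"
    and "1 \<le> l"
    and "\<And>j. j \<in> {1..l} \<Longrightarrow> 1 \<le> n j"
    and "locally_closed (power_space (block_indices l n)) U"
    and "locally_cartesian (block_indices l n) U"
  shows "Pol smul (block_indices l n) U \<subseteq> C_alpha smul l n U \<alpha> \<and>
    C_alpha_topology smul l n U \<alpha> closure_of Pol smul (block_indices l n) U =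
      C_alpha smul l n U \<alpha>"
proof
  interpret ultrametric_lcs smul by (rule assms(1))
  let ?I = "block_indices l n" and ?T = "C_alpha_topology smul l n U \<alpha>"
  have "finite ?I" by (simp add: block_indices_def)
  then show Pol: "Pol smul ?I U \<subseteq> C_alpha smul l n U \<alpha>"
    unfolding C_alpha_def by (intro INT_greatest Pol_subset_C_eta)
  have top: "topspace ?T = C_alpha smul l n U \<alpha>"
    unfolding C_alpha_topology_def by (rule topspace_initial_topology)
  show "?T closure_of Pol smul ?I U = C_alpha smul l n U \<alpha>"
  proof
    show "?T closure_of Pol smul ?I U \<subseteq> C_alpha smul l n U \<alpha>"
      using closure_of_subset_topspace[of ?T] by (simp add: top)
    show "C_alpha smul l n U \<alpha> \<subseteq> ?T closure_of Pol smul ?I U"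
    proof
      fix f assume f: "f \<in> C_alpha smul l n U \<alpha>"
      have "\<exists>p. p \<in> Pol smul ?I U \<and> p \<in> W" if W: "f \<in> W" "openin ?T W" for W
      proof -
        obtain D Q where D: "finite D"
          "\<forall>(V, \<gamma>, K)\<in>D. V \<in> cartesian_charts ?I U \<and> \<gamma> \<in> multi_orders l n \<alpha> \<and> compactin (multi_space ?I V \<gamma>) K"
          and Q: "unit_ball_submodule smul Q" "open Q"
          and near: "\<forall>g\<in>C_alpha smul l n U \<alpha>. (\<forall>(V, \<gamma>, K)\<in>D. \<forall>k\<in>K.
            extended_divided_difference smul ?I V \<gamma> g k - extended_divided_difference smul ?I V \<gamma> f k \<in> Q) \<longrightarrow> g \<in> W"
          using openin_C_alpha_neighbourhood[OF f W(2,1)] unfolding C_alpha_neighbourhood_def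
          by (elim exE conjE) (rule that)
        have "\<exists>p\<in>Pol smul ?I U. \<forall>(V, \<gamma>, K)\<in>D. \<forall>k\<in>K.
          extended_divided_difference smul ?I V \<gamma> p k - extended_divided_difference smul ?I V \<gamma> f k \<in> Q"
          by (rule C_alpha_approximation[OF f D(1) _ Q]) (drule bspec[OF D(2)], simp)
        then obtain p where p: "p \<in> Pol smul ?I U" "\<forall>(V, \<gamma>, K)\<in>D. \<forall>k\<in>K.
          extended_divided_difference smul ?I V \<gamma> p k - extended_divided_difference smul ?I V \<gamma> f k \<in> Q"
          by (elim bexE) (rule that)
        with bspec[OF near subsetD[OF Pol p(1)]] show ?thesis by (intro exI[of _ p] conjI) (rule p(1), rule mp)
      qed
      then show "f \<in> ?T closure_of Pol smul ?I U" using f by (simp add: in_closure_of top)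
    qed
  qed
qed

end
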